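(* Let $f$ be a nonzero modular form of weight $r>0$ for a finite index subgroup $\Gamma$ of $\mathrm{SL}_2(\mathbb Z)$ (setting as in the context), and let $\alpha>0$. Then: (1) If $\alpha\le\alpha_0$, the series defining $f_\alpha$ diverges on a dense subset of $\mathbb R$. (2) If $\alpha>\alpha_0$, the series defining $f_\alpha$ converges uniformly on $\mathbb R$ to a continuous function. Moreover $f_\alpha\in\mathcal C^{[\alpha-\alpha_0],\{\alpha-\alpha_0\}}(\mathbb R)$ if $\alpha-\alpha_0\notin\mathbb Z$, and $f_\alpha\in\mathcal C^{\alpha-\alpha_0-1,1}_{\log}(\mathbb R)$ otherwise. (3) If $0<\alpha-\alpha_0\le1$, then $f_\alpha\notin\mathcal C^{1,0}(I)$ for any open interval $I\subset\mathbb R$; the same holds for $\Re f_\alpha$ and $\Im f_\alpha$.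
   Context: Let $\Gamma$ be a subgroup of finite index of $\mathrm{SL}_2(\mathbb Z)$, $r>0$ real, and $\{\mu_\gamma\}_{\gamma\in\Gamma}$ a multiplier system of unimodular complex numbers. $f$ is a nonzero modular form of weight $r$: holomorphic on the upper half-plane $\mathbb H$, $f(\gamma z)=\mu_\gamma(cz+d)^rf(z)$ for all $\gamma=\begin{pmatrix}a&b\\c&d\end{pmatrix}\in\Gamma$, where $\gamma z=(az+b)/(cz+d)$, and $f$ has at most polynomial growth as $\Im z\to0^+$. All powers and logarithms use the branch with $-\pi<\arg z\le\pi$. Write $j_\gamma(z)=cz+d$ and, for $\gamma\in\mathrm{GL}_2^+(\mathbb R)$, $f^\gamma(z)=f|_\gamma(z)=(\det\gamma)^{r/2}f(\gamma z)/(j_\gamma(z))^r$. Cusps are the elements of $\mathbb Q\cup\{\infty\}$; the width $m_{\mathfrak a}$ of a cusp $\mathfrak a$ is the order of the stabilizer of $\mathfrak a$ in $\mathrm{SL}_2(\mathbb Z)$ modulo $\Gamma$. A scaling matrix for $\mathfrak a$ is $\sigma_{\mathfrak a}=\gamma\eta$ with $\gamma\in\mathrm{SL}_2(\mathbb Z)$, $\gamma(\infty)=\mathfrak a$, bottom row $(c,d)$ of $\gamma$ satisfying $c<0$ or ($c=0,d=1$), and $\eta=\mathrm{diag}(\sqrt{m_{\mathfrak a}},1/\sqrt{m_{\mathfrak a}})$. Then $f^{\sigma_{\mathfrak a}}(z)=\sum_{n\ge0}a_n^{\mathfrak a}e^{2\pi i(n+\kappa_{\mathfrak a})z}$ with $0\le\kappa_{\mathfrak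 a}<1$; it is assumed that every $\kappa_{\mathfrak a}\in\mathbb Q$. $f$ is cuspidal at $\mathfrak a$ if $\kappa_{\mathfrak a}>0$ or $a_0^{\mathfrak a}=0$; $f$ is a cusp form if it is cuspidal at every cusp. At $\infty$ (with $\sigma_\infty=\eta$) write $f(mz)=\sum_{n\ge0}a_ne^{2\pi i(n+\kappa)z}$, $m=m_\infty$, $\kappa=\kappa_\infty$. The $\alpha$-fractional integral is the series $f_\alpha(mx)=\sum_{n+\kappa>0}a_n(n+\kappa)^{-\alpha}e^{2\pi i(n+\kappa)x}$, $x\in\mathbb R$. Set $\alpha_0=r/2$ if $f$ is a cusp form and $\alpha_0=r$ otherwise. For real $s$, $[s]$ is the integer part and $\{s\}=s-[s]$. Function spaces: for $0\le s\le1$ and $\Omega\subset\mathbb R$, $\Lambda^s(\Omega)$ is the set of continuous functions with $|g(x)-g(y)|\le C|x-y|^s$ uniformly on $\Omega$. For an open set $\Omega$, an integer $k\ge0$ and $0\le s\le1$, $\mathcal C^{k,s}(\Omega)$ is the set of continuous $g$ such that $g^{(k)}$ exists on $\Omega$ and $g^{(k)}\in\Lambda^s(K)$ for every compact $K\subset\Omega$. $\mathcal C^{k,s}_{\log}(\Omega)$ is defined in the same way with $|x-y|^s$ replaced by $|x-y|^s|\log|x-y||$.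
   Formalization: In the class C^{k,s}_log the bound by |x-y|^s |log|x-y|| is required only for |x-y| ≤ 1/2; read literally it would be 0 at |x-y| = 1 and force f_α(y+1) = f_α(y), which fails for f(z) = Δ(z/2), α = 7. *)

theory Defs
  imports "HOL-Analysis.Analysis"
begin

type_synonym mat2 = "int \<times> int \<times> int \<times> int"  (* (a,b,c,d) = [[a,b],[c,d]] *)

definition SL2Z :: "mat2 set" where
  "SL2Z = {(a,b,c,d). a*d - b*c = 1}"

fun mmul :: "mat2 \<Rightarrow> mat2 \<Rightarrow> mat2" where
  "mmul (a,b,c,d) (a',b',c',d') = (a*a'+b*c', a*b'+b*d', c*a'+d*c', c*b'+d*d')"

fun minv :: "mat2 \<Rightarrow> mat2" where
  "minv (a,b,c,d) = (d, -b, -c, a)"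

definition finite_index_subgroup :: "mat2 set \<Rightarrow> bool" where
  "finite_index_subgroup \<Gamma> \<longleftrightarrow>
     \<Gamma> \<subseteq> SL2Z \<and> (1,0,0,1) \<in> \<Gamma> \<and>
     (\<forall>g\<in>\<Gamma>. \<forall>h\<in>\<Gamma>. mmul g h \<in> \<Gamma>) \<and> (\<forall>g\<in>\<Gamma>. minv g \<in> \<Gamma>) \<and>
     finite {(\<lambda>h. mmul g h) ` \<Gamma> | g. g \<in> SL2Z}"

fun moeb :: "mat2 \<Rightarrow> complex \<Rightarrow> complex" where
  "moeb (a,b,c,d) z = (of_int a * z + of_int b) / (of_int c * z + of_int d)"

fun jfac :: "mat2 \<Rightarrow> complex \<Rightarrow> complex" where
  "jfac (a,b,c,d) z = of_int c * z + of_int d"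

text \<open>Complex powers use the principal branch (Isabelle's powr / Ln, with
  -pi < arg z <= pi).\<close>

definition modular_form :: "mat2 set \<Rightarrow> (mat2 \<Rightarrow> complex) \<Rightarrow> real \<Rightarrow> (complex \<Rightarrow> complex) \<Rightarrow> bool" where
  "modular_form \<Gamma> \<mu> r f \<longleftrightarrow>
     f holomorphic_on {z. Im z > 0} \<and>
     (\<forall>\<gamma>\<in>\<Gamma>. norm (\<mu> \<gamma>) = 1) \<and>
     (\<forall>\<gamma>\<in>\<Gamma>. \<forall>z. Im z > 0 \<longrightarrow>
        f (moeb \<gamma> z) = \<mu> \<gamma> * (jfac \<gamma> z) powr (of_real r) * f z) \<and>
     (\<exists>C N. \<forall>z. 0 < Im z \<and> Im z < 1 \<longrightarrow> norm (f z) \<le> C * Im z powr (- N))"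

text \<open>A cusp is represented by any gamma in SL2(Z) with gamma(infinity) equal to it.
  The stabiliser of gamma(infinity) in SL2(Z) is gamma {+-T^k} gamma^-1; the width is
  the index of (+-Gamma) in it, i.e. the least m>0 with gamma (+-T^m) gamma^-1 in Gamma.\<close>

definition cusp_width :: "mat2 set \<Rightarrow> mat2 \<Rightarrow> nat" where
  "cusp_width \<Gamma> \<gamma> = (LEAST m::nat. m > 0 \<and>
      (mmul (mmul \<gamma> (1, int m, 0, 1)) (minv \<gamma>) \<in> \<Gamma> \<or>
       mmul (mmul \<gamma> (-1, - int m, 0, -1)) (minv \<gamma>) \<in> \<Gamma>))"

fun admissible_scaling :: "mat2 \<Rightarrow> bool" where
  "admissible_scaling (a,b,c,d) \<longleftrightarrow> (a,b,c,d) \<in> SL2Z \<and> (c < 0 \<or> (c = 0 \<and> d = 1))"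

text \<open>f^sigma for sigma = gamma * diag(sqrt m, 1/sqrt m) (determinant 1):
  f^sigma(z) = f(sigma z) / (j_sigma z)^r, with sigma z = gamma (m z) and
  j_sigma z = c sqrt m z + d / sqrt m.\<close>

fun slash_scaled :: "(complex \<Rightarrow> complex) \<Rightarrow> real \<Rightarrow> mat2 \<Rightarrow> nat \<Rightarrow> complex \<Rightarrow> complex" where
  "slash_scaled f r (a,b,c,d) m z =
     f (moeb (a,b,c,d) (of_nat m * z)) /
     (of_real (of_int c * sqrt (real m)) * z + of_real (of_int d / sqrt (real m))) powr (of_real r)"

definition has_expansion :: "(complex \<Rightarrow> complex) \<Rightarrow> real \<Rightarrow> (nat \<Rightarrow> complex) \<Rightarrow> bool" where
  "has_expansion g \<kappa> a \<longleftrightarrow> 0 \<le> \<kappa> \<and> \<kappa> < 1 \<and>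
     (\<forall>z. Im z > 0 \<longrightarrow>
        (\<lambda>n. a n * exp (2 * of_real pi * \<i> * of_real (real n + \<kappa>) * z)) sums g z)"

definition cusp_form :: "mat2 set \<Rightarrow> real \<Rightarrow> (complex \<Rightarrow> complex) \<Rightarrow> bool" where
  "cusp_form \<Gamma> r f \<longleftrightarrow>
     (\<forall>\<gamma>. admissible_scaling \<gamma> \<longrightarrow> (\<forall>\<kappa> a.
        has_expansion (slash_scaled f r \<gamma> (cusp_width \<Gamma> \<gamma>)) \<kappa> a \<longrightarrow> \<kappa> > 0 \<or> a 0 = 0))"

definition rational_kappas :: "mat2 set \<Rightarrow> real \<Rightarrow> (complex \<Rightarrow> complex) \<Rightarrow> bool" where
  "rational_kappas \<Gamma> r f \<longleftrightarrow>
     (\<forall>\<gamma>. admissible_scaling \<gamma> \<longrightarrow> (\<forall>\<kappa> a.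
        has_expansion (slash_scaled f r \<gamma> (cusp_width \<Gamma> \<gamma>)) \<kappa> a \<longrightarrow> \<kappa> \<in> \<rat>))"

text \<open>n-th term of the series defining f_alpha at the point y (so that f_alpha(m x) =
  sum_{n+kappa>0} a_n (n+kappa)^(-alpha) e^{2 pi i (n+kappa) x}).\<close>

definition frac_term :: "(nat \<Rightarrow> complex) \<Rightarrow> real \<Rightarrow> real \<Rightarrow> nat \<Rightarrow> nat \<Rightarrow> real \<Rightarrow> complex" where
  "frac_term a \<kappa> \<alpha> m n y =
     (if real n + \<kappa> > 0
      then a n * of_real ((real n + \<kappa>) powr (- \<alpha>)) *
           exp (2 * of_real pi * \<i> * of_real ((real n + \<kappa>) * y / real m))
      else 0)"

definition Holder :: "real set \<Rightarrow> real \<Rightarrow> (real \<Rightarrow> 'b::real_normed_vector) \<Rightarrow> bool" where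
  "Holder \<Omega> s g \<longleftrightarrow> continuous_on \<Omega> g \<and>
     (\<exists>C. \<forall>x\<in>\<Omega>. \<forall>y\<in>\<Omega>. norm (g x - g y) \<le> C * \<bar>x - y\<bar> powr s)"

definition Holder_log :: "real set \<Rightarrow> real \<Rightarrow> (real \<Rightarrow> 'b::real_normed_vector) \<Rightarrow> bool" where
  "Holder_log \<Omega> s g \<longleftrightarrow> continuous_on \<Omega> g \<and>
     (\<exists>C. \<forall>x\<in>\<Omega>. \<forall>y\<in>\<Omega>. \<bar>x - y\<bar> \<le> 1/2 \<longrightarrow>
        norm (g x - g y) \<le> C * \<bar>x - y\<bar> powr s * \<bar>ln \<bar>x - y\<bar>\<bar>)"

definition derivs_upto :: "real set \<Rightarrow> nat \<Rightarrow> (real \<Rightarrow> 'b::real_normed_vector) \<Rightarrow> (nat \<Rightarrow> real \<Rightarrow> 'b) \<Rightarrow> bool" where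
  "derivs_upto \<Omega> k g D \<longleftrightarrow> D 0 = g \<and>
     (\<forall>j<k. \<forall>x\<in>\<Omega>. (D j has_vector_derivative D (Suc j) x) (at x))"

definition Ck :: "real set \<Rightarrow> nat \<Rightarrow> real \<Rightarrow> (real \<Rightarrow> 'b::real_normed_vector) \<Rightarrow> bool" where
  "Ck \<Omega> k s g \<longleftrightarrow> continuous_on \<Omega> g \<and>
     (\<exists>D. derivs_upto \<Omega> k g D \<and> (\<forall>K. compact K \<and> K \<subseteq> \<Omega> \<longrightarrow> Holder K s (D k)))"

definition Ck_log :: "real set \<Rightarrow> nat \<Rightarrow> real \<Rightarrow> (real \<Rightarrow> 'b::real_normed_vector) \<Rightarrow> bool" where
  "Ck_log \<Omega> k s g \<longleftrightarrow> continuous_on \<Omega> g \<and>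
     (\<exists>D. derivs_upto \<Omega> k g D \<and> (\<forall>K. compact K \<and> K \<subseteq> \<Omega> \<longrightarrow> Holder_log K s (D k)))"

end

theory Submission
  imports Defs "HOL-Complex_Analysis.Complex_Analysis"
begin

text \<open>
  Write \<open>H(x + i t)\<close> for \<open>f(x + i t)\<close> minus its constant term at infinity.  The three parts
  reduce to the size of \<open>H\<close> near the real line.

  If the series for \<open>f\<^sub>\<alpha>\<close> converges at \<open>x\<close>, summation by parts gives
  \<open>t\<^sup>\<alpha> H(x + i t) \<longlonglongrightarrow> 0\<close> as \<open>t\<close> tends to \<open>0\<close>.  On the other hand \<open>t\<^bsup>\<alpha>\<^sub>0\<^esup> H(x + i t)\<close> does not tend
  to \<open>0\<close> for a dense set of \<open>x\<close>: if \<open>f\<close> is not cuspidal at some cusp, for \<open>x\<close> in the \<open>\<Gamma>\<close>-orbit of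
  that cusp; otherwise for generic \<open>x\<close> in the sense of Baire, because the orbit of a point where
  \<open>f\<close> does not vanish accumulates at every rational number and \<open>t\<^bsup>r/2\<^esup> |f|\<close> is invariant.

  Reduction theory and the Fourier expansions at the cusps give
  \<open>|H(x + i t)| \<le> B t\<^bsup>-\<alpha>\<^sub>0\<^esup>\<close>.  For \<open>\<alpha> > \<alpha>\<^sub>0\<close> the function \<open>f\<^sub>\<alpha>\<close> is a multiple of
  \<open>\<integral> t\<^bsup>\<alpha>-1\<^esup> H(x + i t) dt\<close>; convolution with the Dirichlet kernel bounds the truncations of \<open>H\<close> up to
  a factor \<open>t\<^bsup>-\<epsilon>\<^esup>\<close>, which yields uniform convergence, and Cauchy's estimate for \<open>H'\<close> inside the
  integral yields the modulus of continuity.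

  If \<open>f\<^sub>\<alpha>\<close>, or its real or imaginary part, is differentiable at \<open>x\<close> and
  \<open>\<alpha> - \<alpha>\<^sub>0 \<le> 1\<close>, then integrating it against the periodic kernel \<open>\<Sum> k\<^sup>j e\<^bsup>-k w (y + i u)\<^esup>\<close>, which has
  only frequencies of one sign and is \<open>O((|u| + y)\<^bsup>-j-1\<^esup>)\<close>, shows
  \<open>t\<^bsup>\<alpha>\<^sub>0\<^esup> H(x + i t) \<longlonglongrightarrow> 0\<close> again; so this fails on the same dense set.  Rationality of \<open>\<kappa>\<close> is what makes
  \<open>f\<^sub>\<alpha>\<close> periodic.
\<close>

section \<open>Elementary estimates\<close>

text \<open>The integral formula for f_\<alpha> can be summed term by term only if the truncations
  of H are dominated by a power of t uniformly in their length. Absolute values of the modes would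
  discard the cancellation behind the bound for H; a Dirichlet kernel keeps it at the price of a
  logarithm, harmless because \<alpha> exceeds \<open>\<alpha>\<^sub>0\<close> strictly. In the
  differentiability part the kernel multiplies the frequency of index k by k^j. An integer j >
  \<alpha> therefore turns the coefficients of f_\<alpha> into those of H times a positive power
  \<beta> = j - \<alpha> of the frequency, and a Gamma integral in the height removes that power
  again. Differentiability makes the kernel integral o(y^(1-j)), and y^(1-j) is at most
  y^(-\<beta>-\<open>\<alpha>\<^sub>0\<close>) for y < 1 exactly when \<alpha> -
  \<open>\<alpha>\<^sub>0\<close> is at most 1. Sizes of translates of f are compared through
  \<open>slash_norm\<close>, free of the branch of the power. The branch matters where the expansion
  at a cusp is constructed; there c < 0 keeps the factor off the cut.\<close>

lemma has_integral_Gamma_scaled: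
  fixes \<beta> p :: real
  assumes "\<beta> > 0" "p > 0"
  shows "((\<lambda>t. t powr (\<beta> - 1) * exp (- p * t)) has_integral Gamma \<beta> * p powr (-\<beta>)) {0..}"
proof -
  define F :: "real \<Rightarrow> real" where "F = (\<lambda>t. t powr (\<beta> - 1) / exp t)"
  have F: "(F has_integral Gamma \<beta>) {0..}"
    using Gamma_integral_real[OF assms(1)] by (simp add: F_def)
  have Fa: "F absolutely_integrable_on {0..}"
    using F by (intro nonnegative_absolutely_integrable_1) (auto simp: F_def)
  have img: "(\<lambda>t. p * t) ` {0..} = {0..}"
  proof (intro equalityI subsetI)
    fix x :: real assume "x \<in> {0..}"
    thus "x \<in> (\<lambda>t. p * t) ` {0..}"
      using assms(2) by (intro image_eqI[of _ _ "x / p"]) auto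
  qed (use assms(2) in auto)
  have der: "((\<lambda>t. p * t) has_field_derivative p) (at t within {0..})" for t
    by (auto intro!: derivative_eq_intros)
  have inj: "inj_on (\<lambda>t. p * t) {0..}"
    using assms(2) by (auto simp: inj_on_def)
  have "(\<lambda>t. \<bar>p\<bar> *\<^sub>R F (p * t)) absolutely_integrable_on {0..} \<and>
        integral {0..} (\<lambda>t. \<bar>p\<bar> *\<^sub>R F (p * t)) = Gamma \<beta>"
    using has_absolute_integral_change_of_variables_1'[of "{0..}" "\<lambda>t. p * t" "\<lambda>_. p" F "Gamma \<beta>"] der inj Fa F img
    by (auto simp: integral_unique)
  hence "((\<lambda>t. \<bar>p\<bar> *\<^sub>R F (p * t)) has_integral Gamma \<beta>) {0..}"
    using absolutely_integrable_on_def has_integral_integral by metis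
  hence "((\<lambda>t. p powr (-\<beta>) * (\<bar>p\<bar> *\<^sub>R F (p * t))) has_integral p powr (-\<beta>) * Gamma \<beta>) {0..}"
    by (rule has_integral_mult_right)
  moreover have "p powr (-\<beta>) * (\<bar>p\<bar> *\<^sub>R F (p * t)) = t powr (\<beta> - 1) * exp (- p * t)" if "t \<in> {0..}" for t
  proof -
    have "p powr (-\<beta>) * (p * (p * t) powr (\<beta> - 1)) = (p powr (-\<beta>) * (p powr 1 * p powr (\<beta> - 1))) * t powr (\<beta> - 1)"
      using that assms by (simp add: powr_mult)
    also have "p powr (-\<beta>) * (p powr 1 * p powr (\<beta> - 1)) = 1"
      using assms unfolding powr_add[symmetric] by simp
    finally show ?thesis using assms by (simp add: F_def exp_minus field_simps)
  qed
  ultimately show ?thesis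
    by (metis (no_types, lifting) has_integral_eq mult.commute)
qed


text \<open>Extension by zero to \<open>{0..}\<close> lets the dominating functions for different
  ranges of t be added as integrals over one domain.\<close>

lemma has_integral_powr_initial:
  fixes c k p :: real
  assumes "p > 0" "c \<ge> 0"
  shows "((\<lambda>t. if t \<in> {0..c} then k * t powr (p - 1) else 0) has_integral k * (c powr p / p)) {0..}"
  using has_integral_mult_right[OF has_integral_powr_from_0[of "p - 1" c], of k] assms
  by (subst has_integral_restrict) auto

lemma has_integral_powr_tail:
  fixes c k p :: real
  assumes "p < 0" "c > 0"
  shows "((\<lambda>t. if t \<in> {c..} then k * t powr (p - 1) else 0) has_integral k * (c powr p / (- p))) {0..}"
  using has_integral_mult_right[OF has_integral_powr_to_inf[of "p - 1" c], of k] assms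
  by (subst has_integral_restrict) auto

lemma powr_tendsto_0_at_right_0:
  "p > 0 \<Longrightarrow> ((\<lambda>t. t powr p * c) \<longlongrightarrow> 0) (at_right (0 :: real))"
  by (auto intro!: tendsto_eq_intros eventually_mono[OF eventually_at_right_less])

text \<open>Rise and fall each cost at most M. The single step from \<open>k\<close> to
  \<open>Suc k\<close> is unconstrained, because there a sampled weight may jump over its peak; it
  costs the third M.\<close>

lemma unimodal_variation:
  fixes b :: "nat \<Rightarrow> real"
  assumes nonneg: "\<And>n. 0 \<le> b n" and le: "\<And>n. b n \<le> M"
    and up: "\<And>n. Suc n \<le> k \<Longrightarrow> b n \<le> b (Suc n)"
    and down: "\<And>n. n > k \<Longrightarrow> b (Suc n) \<le> b n"
  shows "(\<Sum>n<N. \<bar>b (Suc n) - b n\<bar>) \<le> 3 * M"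
proof -
  \<comment> \<open>The induction carries a potential: while b rises, its present value pays for the
    variation; after the peak every drop of \<open>b N\<close> enlarges \<open>3 * M - b N\<close>
    by just that amount.\<close>
  have "(\<Sum>n<N. \<bar>b (Suc n) - b n\<bar>) \<le> (if N \<le> k then b N else 3 * M - b N)"
  proof (induction N)
    case 0
    show ?case using nonneg[of 0] le[of 0] by auto
  next
    case (Suc N)
    consider "Suc N \<le> k" | "N = k" | "N > k" by linarith
    thus ?case
    proof cases
      case 1
      with Suc up[of N] show ?thesis by simp
    next
      case 2
      with Suc nonneg[of N] nonneg[of "Suc N"] le[of N] le[of "Suc N"] show ?thesis by auto
    next
      case 3
      with Suc down[of N] show ?thesis by auto
    qed
  qed
  also have "\<dots> \<le> 3 * M" using nonneg[of N] le[of N] by auto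
  finally show ?thesis .
qed

text \<open>Summation by parts puts the differences on the weights, so only the partial sums of
  \<open>c\<close> have to be small, not its terms in absolute value.\<close>

lemma norm_sum_mult_le:
  fixes c :: "nat \<Rightarrow> 'a::real_normed_algebra" and b :: "nat \<Rightarrow> real" 
  fixes e :: real
  assumes "\<And>k. norm (\<Sum>n<k. c n) \<le> e" and "\<And>n. \<bar>b n\<bar> \<le> M"
    and "(\<Sum>n<N. \<bar>b (Suc n) - b n\<bar>) \<le> V"
  shows "norm (\<Sum>n<N. b n *\<^sub>R c n) \<le> e * (M + V)"
proof -
  define S where "S k = (\<Sum>n<k. c n)" for k
  have e: "e \<ge> 0" using assms(1)[of 0] by simp
  have eq: "(\<Sum>n<N. b n *\<^sub>R c n) = b N *\<^sub>R S N - (\<Sum>n<N. (b (Suc n) - b n) *\<^sub>R S (Suc n))"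
    by (induction N) (auto simp: S_def algebra_simps)
  have "norm (\<Sum>n<N. (b (Suc n) - b n) *\<^sub>R S (Suc n)) \<le> (\<Sum>n<N. \<bar>b (Suc n) - b n\<bar> * e)"
    using assms(1) by (intro sum_norm_le) (auto simp: S_def intro!: mult_left_mono simp del: sum.lessThan_Suc)
  also have "\<dots> = e * (\<Sum>n<N. \<bar>b (Suc n) - b n\<bar>)" by (simp add: sum_distrib_left mult.commute)
  also have "\<dots> \<le> e * V" using assms(3) e by (intro mult_left_mono)
  finally have 1: "norm (\<Sum>n<N. (b (Suc n) - b n) *\<^sub>R S (Suc n)) \<le> e * V" .
  have "norm (b N *\<^sub>R S N) \<le> M * e"
    using assms(1)[of N] assms(2)[of N] by (auto simp: S_def intro!: mult_mono)
  with 1 show ?thesis unfolding eq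
    using norm_triangle_ineq4[of "b N *\<^sub>R S N" "\<Sum>n<N. (b (Suc n) - b n) *\<^sub>R S (Suc n)"]
    by (simp add: algebra_simps)
qed


text \<open>The function peaks at \<open>\<alpha> / p\<close>. After passing to logarithms,
  monotonicity on either side of the peak comes from ln u \<le> u - 1 at a quotient of the two
  points.\<close>

lemma powr_exp_increasing:
  fixes \<alpha> p x y :: real
  assumes "\<alpha> > 0" "p > 0" "0 \<le> x" "x \<le> y" "y \<le> \<alpha> / p"
  shows "x powr \<alpha> * exp (- p * x) \<le> y powr \<alpha> * exp (- p * y)"
proof (cases "x = 0")
  case False
  hence pos: "x > 0" "y > 0" using assms by auto
  have "ln (x / y) \<le> x / y - 1" using pos by (intro ln_le_minus_one) auto
  hence "ln y - ln x \<ge> (y - x) / y" using pos by (simp add: ln_div field_simps)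
  hence "\<alpha> * (ln y - ln x) \<ge> \<alpha> * ((y - x) / y)" using assms by (intro mult_left_mono) auto
  moreover have "\<alpha> * ((y - x) / y) \<ge> p * (y - x)"
  proof -
    have "p \<le> \<alpha> / y" using assms pos by (simp add: field_simps)
    hence "p * (y - x) \<le> \<alpha> / y * (y - x)" using assms by (intro mult_right_mono) auto
    thus ?thesis by simp
  qed
  ultimately have "\<alpha> * ln x - p * x \<le> \<alpha> * ln y - p * y" by (simp add: algebra_simps)
  hence "exp (\<alpha> * ln x - p * x) \<le> exp (\<alpha> * ln y - p * y)" by simp
  thus ?thesis using pos by (simp add: powr_def exp_diff exp_minus field_simps)
qed (use assms in auto)

lemma powr_exp_decreasing:
  fixes \<alpha> p x y :: real
  assumes "\<alpha> > 0" "p > 0" "\<alpha> / p \<le> x" "x \<le> y"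
  shows "y powr \<alpha> * exp (- p * y) \<le> x powr \<alpha> * exp (- p * x)"
proof -
  have pos: "x > 0" "y > 0" using assms
    by (meson divide_pos_pos order_less_le_trans)+
  have "ln (y / x) \<le> y / x - 1" using pos by (intro ln_le_minus_one) auto
  hence "ln y - ln x \<le> (y - x) / x" using pos by (simp add: ln_div field_simps)
  hence "\<alpha> * (ln y - ln x) \<le> \<alpha> * ((y - x) / x)" using assms by (intro mult_left_mono) auto
  moreover have "\<alpha> * ((y - x) / x) \<le> p * (y - x)"
  proof -
    have "\<alpha> / x \<le> p" using assms pos by (simp add: field_simps)
    hence "\<alpha> / x * (y - x) \<le> p * (y - x)" using assms by (intro mult_right_mono) auto
    thus ?thesis by simp
  qed
  ultimately have "\<alpha> * ln y - p * y \<le> \<alpha> * ln x - p * x" by (simp add: algebra_simps)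
  hence "exp (\<alpha> * ln y - p * y) \<le> exp (\<alpha> * ln x - p * x)" by simp
  thus ?thesis using pos by (simp add: powr_def exp_diff exp_minus field_simps)
qed

lemma powr_exp_le_max:
  fixes \<alpha> p x :: real
  assumes "\<alpha> > 0" "p > 0" "x \<ge> 0"
  shows "x powr \<alpha> * exp (- p * x) \<le> (\<alpha> / p) powr \<alpha> * exp (- p * (\<alpha> / p))"
  using powr_exp_increasing[of \<alpha> p x "\<alpha> / p"] powr_exp_decreasing[of \<alpha> p "\<alpha> / p" x] assms
  by (cases "x \<le> \<alpha> / p") auto

lemma tendsto_0_at_right_0I:
  fixes f :: "real \<Rightarrow> real"
  assumes "\<And>t. f t \<ge> 0"
    and "\<And>e. e > 0 \<Longrightarrow> \<exists>d>0. \<forall>t. 0 < t \<and> t < d \<longrightarrow> f t < e"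
  shows "(f \<longlongrightarrow> 0) (at_right 0)"
proof (rule tendstoI)
  fix e :: real assume "e > 0"
  then obtain d where d: "d > 0" "\<And>t. 0 < t \<Longrightarrow> t < d \<Longrightarrow> f t < e"
    using assms(2) by blast
  have "\<forall>\<^sub>F t in at_right 0. t \<in> {0<..<d}"
    using d(1) by (rule eventually_at_right_real)
  thus "\<forall>\<^sub>F t in at_right 0. dist (f t) 0 < e"
    by eventually_elim (use d(2) assms(1) in auto)
qed

section \<open>Convergence of the series and growth in the half-plane\<close>

text \<open>Models a one-sided Fourier series in z = x + i t with frequencies \<omega> (n +
  \<kappa>). With the zero frequency excluded, H decays exponentially as t grows, so its integrals
  against powers of t converge at infinity.\<close>

locale half_plane_series =
  fixes b :: "nat \<Rightarrow> complex" and \<kappa> \<omega> :: real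
  assumes \<omega>_pos: "\<omega> > 0" and \<kappa>_nonneg: "\<kappa> \<ge> 0" 
    and zero_freq: "\<kappa> = 0 \<Longrightarrow> b 0 = 0"
    and summable_coeff: "t > 0 \<Longrightarrow> summable (\<lambda>n. norm (b n) * exp (- \<omega> * (real n + \<kappa>) * t))"
begin

definition mode :: "real \<Rightarrow> real \<Rightarrow> nat \<Rightarrow> complex" where
  "mode x t n = b n * of_real (exp (- \<omega> * (real n + \<kappa>) * t)) * cis (\<omega> * (real n + \<kappa>) * x)"

definition H :: "real \<Rightarrow> real \<Rightarrow> complex" where
  "H x t = (\<Sum>n. mode x t n)"

definition fterm :: "real \<Rightarrow> real \<Rightarrow> nat \<Rightarrow> complex" where
  "fterm \<alpha> x n = b n * of_real ((real n + \<kappa>) powr (- \<alpha>)) * cis (\<omega> * (real n + \<kappa>) * x)"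

definition majorant :: "real \<Rightarrow> real" where
  "majorant t = (\<Sum>n. norm (b n) * exp (- \<omega> * (real n + \<kappa>) * t))"

text \<open>A positive lower bound for all n + \<kappa> that carry a nonzero coefficient; it sets
  the rate of decay at infinity.\<close>

definition \<nu>0 :: real where "\<nu>0 = (if \<kappa> = 0 then 1 else \<kappa>)"

lemma \<nu>0_pos: "\<nu>0 > 0" using \<kappa>_nonneg by (auto simp: \<nu>0_def)

lemma freq_ge: "b n \<noteq> 0 \<Longrightarrow> \<nu>0 \<le> real n + \<kappa>"
  using zero_freq \<kappa>_nonneg by (cases n) (auto simp: \<nu>0_def)

lemma freq_pos: "b n \<noteq> 0 \<Longrightarrow> 0 < real n + \<kappa>"
  using freq_ge[of n] \<nu>0_pos by linarith

lemma norm_mode: "norm (mode x t n) = norm (b n) * exp (- \<omega> * (real n + \<kappa>) * t)"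
  by (simp add: mode_def norm_mult)

lemma summable_norm_mode: "t > 0 \<Longrightarrow> summable (\<lambda>n. norm (mode x t n))"
  using summable_coeff by (simp add: norm_mode)

lemma summable_mode: "t > 0 \<Longrightarrow> summable (mode x t)"
  using summable_norm_mode by (rule summable_norm_cancel)

text \<open>Splitting off a fixed height \<tau> leaves a summable constant, while the remaining
  height s - \<tau> contributes the decay rate of the lowest frequency, uniformly in n.\<close>

lemma coeff_decay:
  assumes "\<tau> \<le> s"
  shows "norm (b n) * exp (- \<omega> * (real n + \<kappa>) * s) \<le>
         norm (b n) * exp (- \<omega> * (real n + \<kappa>) * \<tau>) * exp (- \<omega> * \<nu>0 * (s - \<tau>))"
proof (cases "b n = 0")
  case False
  have "\<omega> * \<nu>0 * (s - \<tau>) \<le> \<omega> * (real n + \<kappa>) * (s - \<tau>)"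
    using freq_ge[OF False] \<omega>_pos assms by (intro mult_right_mono mult_left_mono) auto
  hence "exp (- \<omega> * (real n + \<kappa>) * s) \<le> exp (- \<omega> * (real n + \<kappa>) * \<tau> + - \<omega> * \<nu>0 * (s - \<tau>))"
    by (simp add: algebra_simps)
  thus ?thesis unfolding exp_add by (simp add: mult.assoc mult_left_mono)
qed auto

lemma majorant_nonneg: "t > 0 \<Longrightarrow> 0 \<le> majorant t"
  unfolding majorant_def by (intro suminf_nonneg summable_coeff) auto

lemma norm_partial_sum_le:
  assumes "0 < \<tau>" "\<tau> \<le> s" "finite N"
  shows "norm (\<Sum>n\<in>N. mode x s n) \<le> majorant \<tau> * exp (- \<omega> * \<nu>0 * (s - \<tau>))"
proof -
  have "norm (\<Sum>n\<in>N. mode x s n) \<le> (\<Sum>n\<in>N. norm (b n) * exp (- \<omega> * (real n + \<kappa>) * \<tau>) * exp (- \<omega> * \<nu>0 * (s - \<tau>)))"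
    using coeff_decay[OF assms(2)] by (intro sum_norm_le) (auto simp: norm_mode)
  also have "\<dots> = (\<Sum>n\<in>N. norm (b n) * exp (- \<omega> * (real n + \<kappa>) * \<tau>)) * exp (- \<omega> * \<nu>0 * (s - \<tau>))"
    by (simp add: sum_distrib_right)
  also have "\<dots> \<le> majorant \<tau> * exp (- \<omega> * \<nu>0 * (s - \<tau>))"
    unfolding majorant_def using assms by (intro mult_right_mono sum_le_suminf summable_coeff) auto
  finally show ?thesis .
qed

lemma partial_sums_tendsto_H:
  "t > 0 \<Longrightarrow> (\<lambda>N. \<Sum>n<N. mode x t n) \<longlonglongrightarrow> H x t"
  using summable_mode unfolding H_def by (intro summable_LIMSEQ)

lemma norm_H_le:
  assumes "0 < \<tau>" "\<tau> \<le> s"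
  shows "norm (H x s) \<le> majorant \<tau> * exp (- \<omega> * \<nu>0 * (s - \<tau>))"
  by (rule Lim_norm_ubound[OF _ partial_sums_tendsto_H])
     (use assms norm_partial_sum_le in \<open>auto intro!: always_eventually\<close>)

lemma mode_eq_fterm:
  "mode x t n = of_real ((real n + \<kappa>) powr \<alpha> * exp (- \<omega> * (real n + \<kappa>) * t)) * fterm \<alpha> x n"
proof (cases "b n = 0")
  case False
  from freq_pos[OF this] show ?thesis
    by (simp add: mode_def fterm_def powr_minus field_simps)
qed (auto simp: mode_def fterm_def)

text \<open>t^\<alpha> H is the convergent series reweighted by s^\<alpha> e^(-\<omega> s) at s = t
  (n + \<kappa>). This weight is unimodal and its maximum \<open>M\<close>, hence also its
  variation, does not depend on t. So a small tail of the series stays small for every t, and the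
  factor t^\<alpha> kills the finite head.\<close>

theorem convergence_imp_small_growth:
  assumes "\<alpha> > 0" "summable (fterm \<alpha> x)"
  shows "((\<lambda>t. t powr \<alpha> * norm (H x t)) \<longlongrightarrow> 0) (at_right 0)"
proof -
  define M where "M = (\<alpha> / \<omega>) powr \<alpha> * exp (- \<omega> * (\<alpha> / \<omega>))"
  have M_pos: "M > 0" using assms \<omega>_pos by (simp add: M_def)
  have key: "\<exists>d>0. \<forall>t. 0 < t \<and> t < d \<longrightarrow> t powr \<alpha> * norm (H x t) < e" if e: "e > 0" for e
  proof -
    \<comment> \<open>The tail will cost \<epsilon> (M + 3 M) = e / 2, one M for the boundary term
      and three for the variation; the other half is left for the head.\<close>
    define \<epsilon> where "\<epsilon> = e / (8 * M)"
    have \<epsilon>: "\<epsilon> > 0" using e M_pos by (simp add: \<epsilon>_def)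
    obtain N0 where N0: "\<And>m n. m \<ge> N0 \<Longrightarrow> norm (sum (fterm \<alpha> x) {m..<n}) < \<epsilon>"
      using assms(2) \<epsilon> unfolding summable_Cauchy by blast
    have part: "norm (\<Sum>n<k. fterm \<alpha> x (n + N0)) \<le> \<epsilon>" for k
    proof -
      have "(\<Sum>n<k. fterm \<alpha> x (n + N0)) = sum (fterm \<alpha> x) {N0..<N0+k}"
        using sum.shift_bounds_nat_ivl[of "fterm \<alpha> x" 0 N0 k] by (simp add: atLeast0LessThan add.commute)
      thus ?thesis using N0[of N0 "N0 + k"] by simp
    qed
    have tail: "norm (t powr \<alpha> *\<^sub>R (\<Sum>n<N. mode x t (n + N0))) \<le> \<epsilon> * (M + 3 * M)" if t: "t > 0" for t N
    proof -
      define \<phi> where "\<phi> s = s powr \<alpha> * exp (- \<omega> * s)" for s :: real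
      define \<beta> where "\<beta> n = \<phi> (t * (real n + real N0 + \<kappa>))" for n
      \<comment> \<open>The last index before the weight passes its peak s = \<alpha> / \<omega>. If
        the peak precedes \<open>N0\<close>, truncation by \<open>nat\<close> gives 0 and the rising
        part is empty.\<close>
      define k where "k = nat \<lfloor>\<alpha> / (\<omega> * t) - real N0 - \<kappa>\<rfloor>"
      have k1: "t * (real (Suc n) + real N0 + \<kappa>) \<le> \<alpha> / \<omega>" if "Suc n \<le> k" for n
      proof -
        from that have "real (Suc n) \<le> \<alpha> / (\<omega> * t) - real N0 - \<kappa>" unfolding k_def by linarith
        thus ?thesis using t \<omega>_pos by (simp add: field_simps)
      qed
      have k2: "t * (real n + real N0 + \<kappa>) \<ge> \<alpha> / \<omega>" if "n > k" for n
      proof -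
        from that have "real n \<ge> \<alpha> / (\<omega> * t) - real N0 - \<kappa>" unfolding k_def by linarith
        thus ?thesis using t \<omega>_pos by (simp add: field_simps)
      qed
      have "norm (\<Sum>n<N. \<beta> n *\<^sub>R fterm \<alpha> x (n + N0)) \<le> \<epsilon> * (M + 3 * M)"
      proof (rule norm_sum_mult_le[OF part])
        have le: "\<beta> n \<le> M" for n
          unfolding \<beta>_def \<phi>_def M_def using assms \<omega>_pos t \<kappa>_nonneg by (intro powr_exp_le_max) auto
        have nonneg: "0 \<le> \<beta> n" for n by (simp add: \<beta>_def \<phi>_def)
        show "\<bar>\<beta> n\<bar> \<le> M" for n using le[of n] nonneg[of n] by simp
        show "(\<Sum>n<N. \<bar>\<beta> (Suc n) - \<beta> n\<bar>) \<le> 3 * M"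
        proof (rule unimodal_variation[OF nonneg le])
          show "\<beta> n \<le> \<beta> (Suc n)" if "Suc n \<le> k" for n
            unfolding \<beta>_def \<phi>_def using assms \<omega>_pos t \<kappa>_nonneg k1[OF that]
            by (intro powr_exp_increasing mult_left_mono) auto
          show "\<beta> (Suc n) \<le> \<beta> n" if "n > k" for n
            unfolding \<beta>_def \<phi>_def using assms \<omega>_pos t k2[OF that]
            by (intro powr_exp_decreasing mult_left_mono) auto
        qed
      qed
      also have "(\<Sum>n<N. \<beta> n *\<^sub>R fterm \<alpha> x (n + N0)) = t powr \<alpha> *\<^sub>R (\<Sum>n<N. mode x t (n + N0))"
      proof -
        have "\<beta> n *\<^sub>R fterm \<alpha> x (n + N0) = t powr \<alpha> *\<^sub>R mode x t (n + N0)" for n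
          using t \<kappa>_nonneg unfolding mode_eq_fterm[of x t "n + N0" \<alpha>] \<beta>_def \<phi>_def
          by (simp add: powr_mult scaleR_conv_of_real mult_ac)
        thus ?thesis by (simp add: scaleR_sum_right)
      qed
      finally show ?thesis .
    qed
    have H_le: "t powr \<alpha> * norm (H x t) \<le> t powr \<alpha> * (\<Sum>n<N0. norm (b n)) + \<epsilon> * (M + 3 * M)" if t: "t > 0" for t
    proof -
      have "(\<lambda>N. t powr \<alpha> *\<^sub>R (\<Sum>n<N. mode x t (n + N0))) \<longlonglongrightarrow> t powr \<alpha> *\<^sub>R (\<Sum>n. mode x t (n + N0))"
        using summable_mode[OF t] by (intro tendsto_intros summable_LIMSEQ) (simp add: summable_iff_shift)
      hence 1: "norm (t powr \<alpha> *\<^sub>R (\<Sum>n. mode x t (n + N0))) \<le> \<epsilon> * (M + 3 * M)"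
        by (rule Lim_norm_ubound[rotated]) (use tail t in auto)
      have "norm (\<Sum>n<N0. mode x t n) \<le> (\<Sum>n<N0. norm (b n))"
        using t \<omega>_pos \<kappa>_nonneg by (intro sum_norm_le) (auto simp: norm_mode intro!: mult_left_le)
      hence 2: "norm (t powr \<alpha> *\<^sub>R (\<Sum>n<N0. mode x t n)) \<le> t powr \<alpha> * (\<Sum>n<N0. norm (b n))"
        by (simp add: mult_left_mono)
      have "t powr \<alpha> * norm (H x t) = norm (t powr \<alpha> *\<^sub>R H x t)" by simp
      also have "t powr \<alpha> *\<^sub>R H x t = t powr \<alpha> *\<^sub>R (\<Sum>n. mode x t (n + N0)) + t powr \<alpha> *\<^sub>R (\<Sum>n<N0. mode x t n)"
        unfolding H_def using suminf_split_initial_segment[OF summable_mode[OF t], of x N0]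
        by (simp add: scaleR_add_right)
      finally show ?thesis using 1 2 norm_triangle_ineq[of "t powr \<alpha> *\<^sub>R (\<Sum>n. mode x t (n + N0))" "t powr \<alpha> *\<^sub>R (\<Sum>n<N0. mode x t n)"]
        by linarith
    qed
    have "\<forall>\<^sub>F t in at_right 0. t powr \<alpha> * (\<Sum>n<N0. norm (b n)) < e / 2"
      using e assms by (intro order_tendstoD(2)[OF powr_tendsto_0_at_right_0]) auto
    then obtain d where d: "d > 0" "\<And>t. 0 < t \<Longrightarrow> t < d \<Longrightarrow> t powr \<alpha> * (\<Sum>n<N0. norm (b n)) < e / 2"
      unfolding eventually_at_right_field by auto
    have "t powr \<alpha> * norm (H x t) < e" if "0 < t" "t < d" for t
      using H_le[OF that(1)] d(2)[OF that] M_pos by (simp add: \<epsilon>_def)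
    thus ?thesis using d(1) by blast
  qed
  show ?thesis by (rule tendsto_0_at_right_0I) (use key in auto)
qed

end

section \<open>Truncations and the Dirichlet kernel\<close>

lemma sin_ge_half:
  fixes x :: real
  assumes "0 \<le> x" "x \<le> pi / 2"
  shows "x / 2 \<le> sin x"
proof -
  have "\<bar>sin x - (\<Sum>m<3. sin_coeff m * x ^ m)\<bar> \<le> inverse (fact 3) * \<bar>x\<bar> ^ 3"
    by (rule Maclaurin_sin_bound)
  moreover have "(\<Sum>m<3. sin_coeff m * x ^ m) = x"
    by (simp add: sin_coeff_def numeral_3_eq_3)
  moreover have "inverse (fact 3) * \<bar>x\<bar> ^ 3 = x ^ 3 / 6"
    using assms by (simp add: fact_numeral)
  ultimately have 1: "sin x \<ge> x - x ^ 3 / 6" by linarith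
  \<comment> \<open>pi / 2 < 8 / 5 and (8 / 5)^2 / 6 < 1 / 2, so the cubic Taylor term takes away at
    most half of x.\<close>
  have "x \<le> 8 / 5" using assms pi_approx by simp
  hence "x\<^sup>2 \<le> (8 / 5)\<^sup>2" using assms by (intro power_mono) auto
  hence "x * (x\<^sup>2 / 6) \<le> x * (1 / 2)" using assms by (intro mult_left_mono) (auto simp: power2_eq_square)
  with 1 show ?thesis by (simp add: power3_eq_cube power2_eq_square)
qed

lemma norm_one_minus_exp_cis_sq:
  "(norm (1 - of_real \<rho> * cis \<theta>))\<^sup>2 = (1 - \<rho>)\<^sup>2 + 4 * \<rho> * (sin (\<theta> / 2))\<^sup>2"
proof -
  have "cos \<theta> = 1 - 2 * (sin (\<theta> / 2))\<^sup>2"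
    using cos_double_sin[of "\<theta> / 2"] by simp
  moreover have "(norm (1 - of_real \<rho> * cis \<theta>))\<^sup>2 = (1 - \<rho>)\<^sup>2 + 2 * \<rho> * (1 - cos \<theta>)"
  proof -
    have "(norm (1 - of_real \<rho> * cis \<theta>))\<^sup>2 = (1 - \<rho> * cos \<theta>)\<^sup>2 + (\<rho> * sin \<theta>)\<^sup>2"
      by (simp add: cmod_power2)
    also have "\<dots> = 1 - 2 * \<rho> * cos \<theta> + \<rho>\<^sup>2 * ((sin \<theta>)\<^sup>2 + (cos \<theta>)\<^sup>2)"
      by algebra
    also have "\<dots> = (1 - \<rho>)\<^sup>2 + 2 * \<rho> * (1 - cos \<theta>)"
      by (simp only: sin_cos_squared_add) (simp add: power2_eq_square algebra_simps)
    finally show ?thesis .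
  qed
  ultimately show ?thesis by simp
qed

text \<open>Radial and angular displacement add up in the squared distance: 1 - e^(-s) is at least s
  e^(-s), and the sine is at least half its argument. This converts the closed forms of both
  geometric kernels into powers of |u| + t.\<close>

lemma norm_one_minus_exp_cis_ge:
  assumes "S \<ge> 0"
  obtains d where "d > 0"
    "\<And>\<theta> s. \<bar>\<theta>\<bar> \<le> pi \<Longrightarrow> 0 \<le> s \<Longrightarrow> s \<le> S \<Longrightarrow> d * (\<bar>\<theta>\<bar> + s) \<le> norm (1 - of_real (exp (- s)) * cis \<theta>)"
proof
  define e where "e = exp (- S)"
  have e: "0 < e" "e \<le> 1" using assms by (auto simp: e_def)
  thus "e / 4 > 0" by simp
  fix \<theta> s :: real
  assume th: "\<bar>\<theta>\<bar> \<le> pi" and s: "0 \<le> s" "s \<le> S"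
  have es: "e \<le> exp (- s)" using s by (simp add: e_def)
  have "s * e \<le> s * exp (- s)" using s es by (intro mult_left_mono)
  also have "s * exp (- s) \<le> 1 - exp (- s)"
    using exp_ge_add_one_self[of s] by (simp add: exp_minus field_simps)
  finally have "(s * e)\<^sup>2 \<le> (1 - exp (- s))\<^sup>2" using s e by (intro power_mono) auto
  moreover have "e * (\<theta>\<^sup>2 / 4) \<le> 4 * exp (- s) * (sin (\<theta> / 2))\<^sup>2"
  proof -
    have "\<bar>\<theta>\<bar> / 4 \<le> sin (\<bar>\<theta>\<bar> / 2)" using sin_ge_half[of "\<bar>\<theta>\<bar> / 2"] th by simp
    hence "(\<bar>\<theta>\<bar> / 4)\<^sup>2 \<le> (sin (\<bar>\<theta>\<bar> / 2))\<^sup>2" by (intro power_mono) auto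
    also have "\<dots> = (sin (\<theta> / 2))\<^sup>2" by (cases "\<theta> \<ge> 0") auto
    finally have "\<theta>\<^sup>2 / 4 \<le> 4 * (sin (\<theta> / 2))\<^sup>2" by (simp add: power2_eq_square)
    hence "e * (\<theta>\<^sup>2 / 4) \<le> exp (- s) * (4 * (sin (\<theta> / 2))\<^sup>2)"
      using es e by (intro mult_mono) auto
    thus ?thesis by simp
  qed
  moreover have "(e / 4 * (\<bar>\<theta>\<bar> + s))\<^sup>2 \<le> (s * e)\<^sup>2 + e * (\<theta>\<^sup>2 / 4)"
  proof -
    have "(\<bar>\<theta>\<bar> + s)\<^sup>2 \<le> 2 * \<theta>\<^sup>2 + 2 * s\<^sup>2"
      using sum_squares_bound[of "\<bar>\<theta>\<bar>" s] by (simp add: power2_sum)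
    hence "e\<^sup>2 / 16 * (\<bar>\<theta>\<bar> + s)\<^sup>2 \<le> e\<^sup>2 / 16 * (2 * \<theta>\<^sup>2 + 2 * s\<^sup>2)" by (intro mult_left_mono) auto
    moreover have "e\<^sup>2 * \<theta>\<^sup>2 \<le> e * \<theta>\<^sup>2" using e by (intro mult_right_mono) (auto simp: power2_eq_square mult_left_le)
    moreover have "0 \<le> e\<^sup>2 * s\<^sup>2" "0 \<le> e * \<theta>\<^sup>2" using e by auto
    moreover have "(e / 4 * (\<bar>\<theta>\<bar> + s))\<^sup>2 = e\<^sup>2 / 16 * (\<bar>\<theta>\<bar> + s)\<^sup>2"
      by (simp only: power_mult_distrib power_divide) simp
    moreover have "e\<^sup>2 / 16 * (2 * \<theta>\<^sup>2 + 2 * s\<^sup>2) = e\<^sup>2 * \<theta>\<^sup>2 / 8 + e\<^sup>2 * s\<^sup>2 / 8"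
      by (simp add: field_simps)
    moreover have "(s * e)\<^sup>2 = e\<^sup>2 * s\<^sup>2" by (simp add: power_mult_distrib)
    ultimately show ?thesis by linarith
  qed
  ultimately have "(e / 4 * (\<bar>\<theta>\<bar> + s))\<^sup>2 \<le> (norm (1 - of_real (exp (- s)) * cis \<theta>))\<^sup>2"
    unfolding norm_one_minus_exp_cis_sq by linarith
  thus "e / 4 * (\<bar>\<theta>\<bar> + s) \<le> norm (1 - of_real (exp (- s)) * cis \<theta>)"
    by (rule power2_le_imp_le) auto
qed

lemma has_integral_shifted_abs_powr:
  fixes y R p :: real
  assumes "y > 0" "R \<ge> 0" "p \<noteq> 1"
  shows "((\<lambda>u. (\<bar>u\<bar> + y) powr (-p)) has_integral
           2 * (((R + y) powr (1 - p) - y powr (1 - p)) / (1 - p))) {-R..R}"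
proof -
  define I where "I = ((R + y) powr (1 - p) - y powr (1 - p)) / (1 - p)"
  have der: "((\<lambda>u. (u + y) powr (1 - p) / (1 - p)) has_vector_derivative (u + y) powr (-p)) (at u within S)"
    if "u \<ge> 0" for u S
  proof -
    have "((\<lambda>u. (u + y) powr (1 - p)) has_real_derivative ((1 - p) * (u + y) powr (1 - p - 1)) * 1) (at u within S)"
      using that assms by (intro DERIV_chain2[OF has_real_derivative_powr]) (auto intro!: derivative_eq_intros)
    from DERIV_cdivide[OF this, of "1 - p"] show ?thesis
      using assms by (simp add: has_real_derivative_iff_has_vector_derivative)
  qed
  have "((\<lambda>u. (u + y) powr (-p)) has_integral
      ((R + y) powr (1 - p) / (1 - p) - (0 + y) powr (1 - p) / (1 - p))) {0..R}"
    using assms by (intro fundamental_theorem_of_calculus der) auto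
  hence 1: "((\<lambda>u. (\<bar>u\<bar> + y) powr (-p)) has_integral I) {0..R}"
    by (rule has_integral_eq_rhs[OF has_integral_eq[rotated]]) (auto simp: I_def diff_divide_distrib)
  have "((\<lambda>u. (\<bar>-u\<bar> + y) powr (-p)) has_integral I) {-R..-0}"
    using 1 by (subst has_integral_reflect_real) auto
  hence 2: "((\<lambda>u. (\<bar>u\<bar> + y) powr (-p)) has_integral I) {-R..0}" by simp
  show ?thesis using has_integral_combine[OF _ _ 2 1] assms by (simp add: I_def)
qed

lemma has_integral_cis_period:
  fixes w :: real and k :: int
  assumes "w > 0"
  shows "((\<lambda>u. cis (w * of_int k * u)) has_integral (if k = 0 then of_real (2 * pi / w) else 0)) {-pi/w..pi/w}"
proof (cases "k = 0")
  case True
  thus ?thesis using has_integral_const_real[of "1::complex" "-pi/w" "pi/w"] assms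
    by (simp add: scaleR_conv_of_real)
next
  case False
  define F where "F u = cis (w * of_int k * u) / (\<i> * of_real (w * of_int k))" for u
  have nz: "\<i> * complex_of_real (w * of_int k) \<noteq> 0" using assms False by simp
  have der: "(F has_vector_derivative cis (w * of_int k * u)) (at u within S)" for u S
  proof -
    define G where "G = (\<lambda>z. exp (\<i> * of_real (w * of_int k) * z) / (\<i> * of_real (w * of_int k)))"
    have "(G has_field_derivative exp (\<i> * of_real (w * of_int k) * z)) (at z)" for z
      unfolding G_def using nz by (auto intro!: derivative_eq_intros)
    from has_vector_derivative_real_field[OF this]
    have "((\<lambda>u. G (of_real u)) has_vector_derivative exp (\<i> * of_real (w * of_int k) * of_real u)) (at u within S)" .
    moreover have "(\<lambda>u. G (of_real u)) = F" by (simp add: G_def F_def cis_conv_exp fun_eq_iff mult_ac)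
    ultimately show ?thesis by (simp add: cis_conv_exp mult_ac)
  qed
  have "((\<lambda>u. cis (w * of_int k * u)) has_integral (F (pi/w) - F (-pi/w))) {-pi/w..pi/w}"
    using assms by (intro fundamental_theorem_of_calculus der) (auto simp: field_simps)
  moreover have "F (pi/w) = F (-pi/w)"
  proof -
    have "w * of_int k * (pi / w) = pi * of_int k" "w * of_int k * (- pi / w) = - (pi * of_int k)"
      using assms by auto
    moreover have "cis (pi * of_int k) = cis (- (pi * of_int k))"
      by (simp add: complex_eq_iff sin_times_pi_eq_0[of "of_int k"] mult.commute[of pi])
    ultimately show ?thesis by (simp add: F_def)
  qed
  ultimately show ?thesis using False by simp
qed

text \<open>Uniform convergence permits termwise integration over a period, and orthogonality leaves
  at most the term \<open>k\<close>. Allowing \<open>d k\<close> to be nonzero as well lets one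
  statement cover the case where nothing survives.\<close>

lemma has_integral_cis_series:
  fixes w :: real and d :: "nat \<Rightarrow> int" and q :: "nat \<Rightarrow> complex"
  assumes "w > 0" and d: "\<And>n. n \<noteq> k \<Longrightarrow> d n \<noteq> 0"
    and ul: "uniform_limit {-pi/w..pi/w} (\<lambda>N u. \<Sum>n<N. q n * cis (w * of_int (d n) * u)) F sequentially"
  shows "(F has_integral (if d k = 0 then of_real (2 * pi / w) * q k else 0)) {-pi/w..pi/w}"
proof -
  define V where "V = (if d k = 0 then of_real (2 * pi / w) * q k else 0)"
  obtain I J where I: "\<And>N. ((\<lambda>u. \<Sum>n<N. q n * cis (w * of_int (d n) * u)) has_integral I N) {-pi/w..pi/w}"
    and J: "(F has_integral J) {-pi/w..pi/w}" and IJ: "I \<longlonglongrightarrow> J"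
    by (rule uniform_limit_integral[OF ul]) (auto intro!: continuous_intros)
  have single: "((\<lambda>u. q n * cis (w * of_int (d n) * u)) has_integral (if n = k then V else 0)) {-pi/w..pi/w}" for n
    using has_integral_mult_right[OF has_integral_cis_period[OF assms(1), of "d n"], of "q n"] d[of n]
    by (auto simp: V_def mult.commute split: if_splits)
  have "I N = (\<Sum>n<N. if n = k then V else 0)" for N
    by (rule has_integral_unique[OF I]) (intro has_integral_sum single, auto)
  \<comment> \<open>Once N exceeds k, further terms contribute nothing, so the integrals of the
    partial sums are eventually constant.\<close>
  hence "\<forall>\<^sub>F N in sequentially. I N = V"
    by (intro eventually_sequentiallyI[of "Suc k"]) auto
  hence "J = V" using IJ LIMSEQ_unique tendsto_eventually by blast
  with J show ?thesis by (simp add: V_def)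
qed

section \<open>The damped Dirichlet kernel and the truncations of H\<close>

context half_plane_series
begin

definition kernel :: "nat \<Rightarrow> real \<Rightarrow> real \<Rightarrow> complex" where
  "kernel N t u = (\<Sum>n<N. of_real (exp (- \<omega> * (real n + \<kappa>) * t)) * cis (\<omega> * (real n + \<kappa>) * u))"

lemma uniform_limit_modes:
  assumes "t > 0"
  shows "uniform_limit UNIV (\<lambda>N x. \<Sum>n<N. mode x t n) (\<lambda>x. H x t) sequentially"
  unfolding H_def using summable_coeff[OF assms]
  by (intro Weierstrass_m_test) (auto simp: norm_mode)

text \<open>Convolution over a period adds heights, hence \<open>2 * t\<close> on the right. The
  shift \<kappa> cancels in the difference of two frequencies, so the products have honest period 2
  pi / \<omega> and distinct frequencies are orthogonal.\<close>

lemma has_integral_mode_kernel: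
  assumes "t > 0"
  shows "((\<lambda>u. H (x - u) t * kernel N t u) has_integral
           of_real (2 * pi / \<omega>) * (\<Sum>n<N. mode x (2 * t) n)) {-pi/\<omega>..pi/\<omega>}"
proof -
  define E where "E k u = complex_of_real (exp (- \<omega> * (real k + \<kappa>) * t)) * cis (\<omega> * (real k + \<kappa>) * u)" for k u
  have E_bd: "norm (E k u) \<le> 1" for k u
    using assms \<omega>_pos \<kappa>_nonneg by (simp add: E_def norm_mult)
  have one: "((\<lambda>u. H (x - u) t * E k u) has_integral of_real (2 * pi / \<omega>) * mode x (2 * t) k) {-pi/\<omega>..pi/\<omega>}" for k
  proof -
    define q where "q n = b n * of_real (exp (- \<omega> * (real n + \<kappa>) * t) * exp (- \<omega> * (real k + \<kappa>) * t)) * cis (\<omega> * (real n + \<kappa>) * x)" for n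
    have eq: "mode (x - u) t n * E k u = q n * cis (\<omega> * of_int (int k - int n) * u)" for n u
    proof -
      have "cis (\<omega> * (real n + \<kappa>) * (x - u)) * cis (\<omega> * (real k + \<kappa>) * u) =
            cis (\<omega> * (real n + \<kappa>) * x) * cis (\<omega> * of_int (int k - int n) * u)"
        unfolding cis_mult by (rule arg_cong[of _ _ cis]) (simp add: algebra_simps)
      thus ?thesis unfolding mode_def E_def q_def by (simp add: mult_ac)
    qed
    have "uniform_limit {-pi/\<omega>..pi/\<omega>} (\<lambda>M u. (\<Sum>n<M. mode (x - u) t n) * E k u) (\<lambda>u. H (x - u) t * E k u) sequentially"
    proof (intro uniform_lim_mult uniform_limit_const)
      show "uniform_limit {-pi/\<omega>..pi/\<omega>} (\<lambda>M u. \<Sum>n<M. mode (x - u) t n) (\<lambda>u. H (x - u) t) sequentially"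
        using uniform_limit_modes[OF assms] unfolding uniform_limit_iff by (auto elim!: eventually_mono)
      show "bounded ((\<lambda>u. H (x - u) t) ` {-pi/\<omega>..pi/\<omega>})"
        using norm_H_le[of t t] assms by (auto simp: bounded_iff intro!: exI[of _ "majorant t"])
      show "bounded (E k ` {-pi/\<omega>..pi/\<omega>})" using E_bd by (auto simp: bounded_iff)
    qed
    hence "((\<lambda>u. H (x - u) t * E k u) has_integral (if int k - int k = 0 then of_real (2 * pi / \<omega>) * q k else 0)) {-pi/\<omega>..pi/\<omega>}"
      unfolding sum_distrib_right eq by (intro has_integral_cis_series \<omega>_pos) auto
    moreover have "q k = mode x (2 * t) k"
      unfolding q_def mode_def exp_add[symmetric] by (simp add: algebra_simps)
    ultimately show ?thesis by simp
  qed
  have "((\<lambda>u. \<Sum>k<N. H (x - u) t * E k u) has_integral (\<Sum>k<N. of_real (2 * pi / \<omega>) * mode x (2 * t) k)) {-pi/\<omega>..pi/\<omega>}"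
    by (intro has_integral_sum one) auto
  thus ?thesis by (simp add: kernel_def E_def sum_distrib_left)
qed

text \<open>A finite geometric sum: its numerator 1 - w^N has modulus at most 2 for every N, which
  makes the bound uniform in the length, and its denominator is bounded below by a multiple of |u| +
  t.\<close>

lemma norm_kernel_le:
  obtains C where "C > 0"
    "\<And>N t u. 0 < t \<Longrightarrow> t \<le> 1 \<Longrightarrow> \<bar>u\<bar> \<le> pi / \<omega> \<Longrightarrow> norm (kernel N t u) \<le> C / (\<bar>u\<bar> + t)"
proof -
  obtain d where d: "d > 0"
    "\<And>\<theta> s. \<bar>\<theta>\<bar> \<le> pi \<Longrightarrow> 0 \<le> s \<Longrightarrow> s \<le> \<omega> \<Longrightarrow> d * (\<bar>\<theta>\<bar> + s) \<le> norm (1 - of_real (exp (- s)) * cis \<theta>)"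
    using norm_one_minus_exp_cis_ge[of \<omega>] \<omega>_pos by (metis less_imp_le)
  have "norm (kernel N t u) \<le> (2 / (d * \<omega>)) / (\<bar>u\<bar> + t)" if t: "0 < t" "t \<le> 1" and u: "\<bar>u\<bar> \<le> pi / \<omega>" for N t u
  proof -
    define w where "w = of_real (exp (- (\<omega> * t))) * cis (\<omega> * u)"
    have w1: "norm w < 1" using t \<omega>_pos by (simp add: w_def norm_mult)
    hence wne: "w \<noteq> 1" by auto
    have geo: "of_real (exp (- \<omega> * (real n + \<kappa>) * t)) * cis (\<omega> * (real n + \<kappa>) * u) =
          (of_real (exp (- \<omega> * \<kappa> * t)) * cis (\<omega> * \<kappa> * u)) * w ^ n" for n
    proof -
      have "w ^ n = of_real (exp (real n * (- (\<omega> * t)))) * cis (real n * (\<omega> * u))"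
        unfolding w_def power_mult_distrib Complex.DeMoivre of_real_power[symmetric] exp_of_nat_mult ..
      thus ?thesis
        by (simp add: cis_mult[symmetric] exp_add[symmetric] algebra_simps flip: of_real_mult)
    qed
    have "kernel N t u = (of_real (exp (- \<omega> * \<kappa> * t)) * cis (\<omega> * \<kappa> * u)) * (\<Sum>n<N. w ^ n)"
      unfolding kernel_def geo sum_distrib_left ..
    also have "(\<Sum>n<N. w ^ n) = (1 - w ^ N) / (1 - w)"
      using sum_gp_strict[of w N] wne by simp
    finally have "norm (kernel N t u) = exp (- \<omega> * \<kappa> * t) * (norm (1 - w ^ N) / norm (1 - w))"
      by (simp add: norm_mult norm_divide)
    also have "\<dots> \<le> 1 * (2 / norm (1 - w))"
    proof (intro mult_mono divide_right_mono)
      have "norm (1 - w ^ N) \<le> norm (1::complex) + norm (w ^ N)" by (rule norm_triangle_ineq4)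
      also have "norm (w ^ N) \<le> 1" using w1 by (simp add: norm_power power_le_one)
      finally show "norm (1 - w ^ N) \<le> 2" by simp
    qed (use t \<omega>_pos \<kappa>_nonneg in auto)
    also have "\<dots> \<le> 2 / (d * (\<omega> * (\<bar>u\<bar> + t)))"
    proof -
      have "d * (\<bar>\<omega> * u\<bar> + \<omega> * t) \<le> norm (1 - w)"
        unfolding w_def using t u \<omega>_pos by (intro d(2)) (auto simp: abs_mult field_simps)
      moreover have "\<bar>\<omega> * u\<bar> + \<omega> * t = \<omega> * (\<bar>u\<bar> + t)" using \<omega>_pos by (simp add: abs_mult algebra_simps)
      moreover have "d * (\<omega> * (\<bar>u\<bar> + t)) > 0" using d(1) \<omega>_pos t by auto
      ultimately show ?thesis by (simp add: frac_le)
    qed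
    finally show ?thesis by (simp add: mult_ac)
  qed
  with d(1) \<omega>_pos show ?thesis by (intro that[of "2 / (d * \<omega>)"]) auto
qed

end

text \<open>The bound is asked at every height, which spares the estimates a case distinction; for
  large t it is supplied by exponential decay.\<close>

locale half_plane_series_growth = half_plane_series +
  fixes \<alpha>\<^sub>0 B :: real
  assumes \<alpha>\<^sub>0_pos: "\<alpha>\<^sub>0 > 0"
    and growth: "t > 0 \<Longrightarrow> norm (H x t) \<le> B * t powr (- \<alpha>\<^sub>0)"
begin

lemma B_nonneg: "B \<ge> 0"
  using order_trans[OF norm_ge_zero growth[of 1 0]] by simp

text \<open>The truncation at height \<open>t\<close> is the convolution of \<open>H\<close> at height \<open>t / 2\<close> with the kernel, whose
  \<open>L\<^sup>1\<close> norm is of logarithmic size in \<open>t\<close>.\<close>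

lemma partial_sum_growth:
  assumes \<epsilon>: "0 < \<epsilon>" "\<epsilon> \<le> 1"
  obtains C where "C \<ge> 0"
    "\<And>N x t. 0 < t \<Longrightarrow> t \<le> 1 \<Longrightarrow> norm (\<Sum>n<N. mode x t n) \<le> C * t powr (- (\<alpha>\<^sub>0 + \<epsilon>))"
proof -
  obtain K where K: "K > 0"
    "\<And>N t u. 0 < t \<Longrightarrow> t \<le> 1 \<Longrightarrow> \<bar>u\<bar> \<le> pi / \<omega> \<Longrightarrow> norm (kernel N t u) \<le> K / (\<bar>u\<bar> + t)"
    using norm_kernel_le by blast
  define R where "R = pi / \<omega>"
  have R: "R > 0" using \<omega>_pos by (simp add: R_def)
  define C where "C = \<omega> / (2 * pi) * (B * K * (2 * ((R + 1) powr \<epsilon> / \<epsilon>))) * 2 powr (\<alpha>\<^sub>0 + \<epsilon>)"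
  have "norm (\<Sum>n<N. mode x t n) \<le> C * t powr (- (\<alpha>\<^sub>0 + \<epsilon>))" if t: "0 < t" "t \<le> 1" for N x t
  proof -
    define s where "s = t / 2"
    have s: "0 < s" "s \<le> 1" using t by (auto simp: s_def)
    have int: "((\<lambda>u. H (x - u) s * kernel N s u) has_integral
           of_real (2 * pi / \<omega>) * (\<Sum>n<N. mode x t n)) {-R..R}"
      using has_integral_mode_kernel[OF s(1), of x N] by (simp add: R_def s_def)
    have int2: "((\<lambda>u. (B * K * s powr (- (\<alpha>\<^sub>0 + \<epsilon>))) * (\<bar>u\<bar> + s) powr (- (1 - \<epsilon>))) has_integral
       (B * K * s powr (- (\<alpha>\<^sub>0 + \<epsilon>))) * (2 * (((R + s) powr (1 - (1 - \<epsilon>)) - s powr (1 - (1 - \<epsilon>))) / (1 - (1 - \<epsilon>))))) {-R..R}"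
      using \<epsilon> s R by (intro has_integral_mult_right has_integral_shifted_abs_powr) auto
    have "norm (integral {-R..R} (\<lambda>u. H (x - u) s * kernel N s u)) \<le>
      integral {-R..R} (\<lambda>u. (B * K * s powr (- (\<alpha>\<^sub>0 + \<epsilon>))) * (\<bar>u\<bar> + s) powr (- (1 - \<epsilon>)))"
    proof (rule Henstock_Kurzweil_Integration.integral_norm_bound_integral)
      fix u assume u: "u \<in> {-R..R}"
      have pos: "\<bar>u\<bar> + s > 0" using s by auto
      have "(\<bar>u\<bar> + s) powr (- \<epsilon>) \<le> s powr (- \<epsilon>)" using s \<epsilon> by (intro powr_mono2') auto
      \<comment> \<open>Sacrificing s^(-\<epsilon>) replaces the kernel by (|u| + s)^(-(1 -
        \<epsilon>)), whose integral is bounded uniformly in s; no logarithm has to be carried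
        along.\<close>
      hence le: "1 / (\<bar>u\<bar> + s) \<le> s powr (- \<epsilon>) * (\<bar>u\<bar> + s) powr (- (1 - \<epsilon>))"
      proof -
        assume *: "(\<bar>u\<bar> + s) powr (- \<epsilon>) \<le> s powr (- \<epsilon>)"
        have "1 / (\<bar>u\<bar> + s) = (\<bar>u\<bar> + s) powr (- \<epsilon> + - (1 - \<epsilon>))"
          using pos by (simp add: powr_minus_divide)
        also have "\<dots> = (\<bar>u\<bar> + s) powr (- \<epsilon>) * (\<bar>u\<bar> + s) powr (- (1 - \<epsilon>))" by (rule powr_add)
        also have "\<dots> \<le> s powr (- \<epsilon>) * (\<bar>u\<bar> + s) powr (- (1 - \<epsilon>))" using * by (intro mult_right_mono) auto
        finally show ?thesis .
      qed
      have "norm (H (x - u) s * kernel N s u) \<le> (B * s powr (- \<alpha>\<^sub>0)) * (K * (1 / (\<bar>u\<bar> + s)))"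
        unfolding norm_mult using growth[OF s(1), of "x - u"] K(2)[OF s, of u N] u B_nonneg
        by (intro mult_mono) (auto simp: R_def)
      also have "\<dots> \<le> (B * s powr (- \<alpha>\<^sub>0)) * (K * (s powr (- \<epsilon>) * (\<bar>u\<bar> + s) powr (- (1 - \<epsilon>))))"
        using le K(1) B_nonneg by (intro mult_left_mono) auto
      also have "\<dots> = (B * K * s powr (- (\<alpha>\<^sub>0 + \<epsilon>))) * (\<bar>u\<bar> + s) powr (- (1 - \<epsilon>))"
        by (simp add: powr_add powr_diff powr_minus field_simps)
      finally show "norm (H (x - u) s * kernel N s u) \<le> (B * K * s powr (- (\<alpha>\<^sub>0 + \<epsilon>))) * (\<bar>u\<bar> + s) powr (- (1 - \<epsilon>))" .
    qed (use int int2 in \<open>auto simp: integrable_on_def\<close>)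
    also have "\<dots> = (B * K * s powr (- (\<alpha>\<^sub>0 + \<epsilon>))) * (2 * (((R + s) powr \<epsilon> - s powr \<epsilon>) / \<epsilon>))"
      using integral_unique[OF int2] by simp
    also have "\<dots> \<le> (B * K * s powr (- (\<alpha>\<^sub>0 + \<epsilon>))) * (2 * ((R + 1) powr \<epsilon> / \<epsilon>))"
    proof (intro mult_left_mono divide_right_mono)
      have "(R + s) powr \<epsilon> \<le> (R + 1) powr \<epsilon>" using s \<epsilon> R by (intro powr_mono2) auto
      thus "(R + s) powr \<epsilon> - s powr \<epsilon> \<le> (R + 1) powr \<epsilon>" using powr_ge_zero[of s \<epsilon>] by linarith
    qed (use \<epsilon> K(1) B_nonneg in auto)
    finally have main: "norm (of_real (2 * pi / \<omega>) * (\<Sum>n<N. mode x t n)) \<le> (B * K * s powr (- (\<alpha>\<^sub>0 + \<epsilon>))) * (2 * ((R + 1) powr \<epsilon> / \<epsilon>))"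
      using integral_unique[OF int] by simp
    have "norm (of_real (2 * pi / \<omega>) * (\<Sum>n<N. mode x t n)) = 2 * pi / \<omega> * norm (\<Sum>n<N. mode x t n)"
      using \<omega>_pos by (simp add: norm_mult norm_divide)
    with main have "\<omega> / (2 * pi) * (2 * pi / \<omega> * norm (\<Sum>n<N. mode x t n)) \<le> \<omega> / (2 * pi) * ((B * K * s powr (- (\<alpha>\<^sub>0 + \<epsilon>))) * (2 * ((R + 1) powr \<epsilon> / \<epsilon>)))"
      using \<omega>_pos by (intro mult_left_mono) auto
    moreover have "\<omega> / (2 * pi) * (2 * pi / \<omega> * norm (\<Sum>n<N. mode x t n)) = norm (\<Sum>n<N. mode x t n)"
      using \<omega>_pos by simp
    moreover have "s powr (- (\<alpha>\<^sub>0 + \<epsilon>)) = 2 powr (\<alpha>\<^sub>0 + \<epsilon>) * t powr (- (\<alpha>\<^sub>0 + \<epsilon>))"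
    proof -
      define p where "p = \<alpha>\<^sub>0 + \<epsilon>"
      show ?thesis unfolding s_def p_def[symmetric] using t
        by (simp add: powr_divide powr_minus field_simps)
    qed
    ultimately show ?thesis by (simp add: C_def mult_ac)
  qed
  moreover have "C \<ge> 0" using \<omega>_pos B_nonneg K(1) \<epsilon> by (simp add: C_def)
  ultimately show ?thesis by (rule that[rotated])
qed

end

section \<open>Fractional integrals: uniform convergence\<close>

lemma exp_decay_le_powr:
  fixes p \<gamma> :: real
  assumes "p > 0" "\<gamma> > 0"
  obtains C where "C > 0" "\<And>t. t > 0 \<Longrightarrow> exp (- p * t) \<le> C * t powr (- \<gamma>)"
proof -
  define D where "D = (\<gamma> / p) powr \<gamma> * exp (- p * (\<gamma> / p))"
  have "exp (- p * t) \<le> D * t powr (- \<gamma>)" if t: "t > 0" for t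
  proof -
    have "t powr \<gamma> * exp (- p * t) \<le> D"
      unfolding D_def using t assms by (intro powr_exp_le_max) auto
    thus ?thesis using t by (simp add: powr_minus field_simps)
  qed
  moreover have "D > 0" using assms by (auto simp: D_def)
  ultimately show ?thesis by (rule that[rotated])
qed

lemma exp_shift: "exp (- p * q * (t - s)) = exp (p * q * s) * exp (- (p * q) * (t :: real))"
  by (simp add: exp_add[symmetric] algebra_simps)

context half_plane_series
begin

lemma has_integral_fterm:
  assumes "\<alpha> > 0"
  shows "((\<lambda>t. t powr (\<alpha> - 1) *\<^sub>R mode x t n) has_integral (Gamma \<alpha> * \<omega> powr (- \<alpha>)) *\<^sub>R fterm \<alpha> x n) {0..}"
proof (cases "b n = 0")
  case False
  define \<nu> where "\<nu> = real n + \<kappa>"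
  have \<nu>: "\<nu> > 0" using freq_pos[OF False] by (simp add: \<nu>_def)
  define q where "q = b n * cis (\<omega> * \<nu> * x)"
  have "((\<lambda>t. t powr (\<alpha> - 1) * exp (- (\<omega> * \<nu>) * t)) has_integral Gamma \<alpha> * (\<omega> * \<nu>) powr (-\<alpha>)) {0..}"
    using assms \<nu> \<omega>_pos by (intro has_integral_Gamma_scaled) auto
  hence "((\<lambda>t. of_real (t powr (\<alpha> - 1) * exp (- (\<omega> * \<nu>) * t)) * q) has_integral of_real (Gamma \<alpha> * (\<omega> * \<nu>) powr (-\<alpha>)) * q) {0..}"
    by (intro has_integral_mult_left has_integral_of_real)
  thus ?thesis using \<nu> \<omega>_pos
    by (simp add: q_def mode_def fterm_def \<nu>_def[symmetric] scaleR_conv_of_real powr_mult mult_ac)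
qed (auto simp: mode_def fterm_def)

text \<open>Normalised so that it agrees with the series of the \<open>fterm\<close>, by
  \<open>\<integral> t\<^bsup>\<alpha>-1\<^esup> e\<^bsup>-\<omega>\<nu>t\<^esup> dt = \<Gamma>(\<alpha>) (\<omega>\<nu>)\<^bsup>-\<alpha>\<^esup>\<close>.\<close>

definition frac_integral :: "real \<Rightarrow> real \<Rightarrow> complex" where
  "frac_integral \<alpha> x = integral {0..} (\<lambda>t. t powr (\<alpha> - 1) *\<^sub>R H x t) /\<^sub>R (Gamma \<alpha> * \<omega> powr (- \<alpha>))"

text \<open>The first factor is the tail of a convergent series at the fixed height \<tau> and does
  not involve x; it is the source of uniformity in x away from t = 0.\<close>

lemma norm_H_diff_partial_le:
  assumes "0 < \<tau>" "\<tau> \<le> s"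
  shows "norm ((\<Sum>n<N. mode x s n) - H x s) \<le>
    (majorant \<tau> - (\<Sum>n<N. norm (b n) * exp (- \<omega> * (real n + \<kappa>) * \<tau>))) * exp (- \<omega> * \<nu>0 * (s - \<tau>))"
proof -
  let ?a = "\<lambda>n. norm (b n) * exp (- \<omega> * (real n + \<kappa>) * \<tau>)"
  have s: "s > 0" using assms by simp
  have "norm ((\<Sum>n<N. mode x s n) - H x s) = norm (\<Sum>n. mode x s (n + N))"
    unfolding H_def suminf_split_initial_segment[OF summable_mode[OF s], of x N]
    by (simp add: norm_minus_commute)
  also have "\<dots> \<le> (\<Sum>n. ?a (n + N) * exp (- \<omega> * \<nu>0 * (s - \<tau>)))"
  proof (rule norm_suminf_le)
    show "norm (mode x s (n + N)) \<le> ?a (n + N) * exp (- \<omega> * \<nu>0 * (s - \<tau>))" for n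
      using coeff_decay[OF assms(2), of "n + N"] by (simp add: norm_mode)
    show "summable (\<lambda>n. ?a (n + N) * exp (- \<omega> * \<nu>0 * (s - \<tau>)))"
      using summable_ignore_initial_segment[OF summable_coeff[OF assms(1)], of N] by (rule summable_mult2)
  qed
  also have "\<dots> = (\<Sum>n. ?a (n + N)) * exp (- \<omega> * \<nu>0 * (s - \<tau>))"
    using summable_ignore_initial_segment[OF summable_coeff[OF assms(1)], of N] by (rule suminf_mult2[symmetric])
  also have "(\<Sum>n. ?a (n + N)) = majorant \<tau> - (\<Sum>n<N. ?a n)"
    unfolding majorant_def suminf_split_initial_segment[OF summable_coeff[OF assms(1)], of N] by simp
  finally show ?thesis .
qed

lemma holomorphic_H: "(\<lambda>z. H (Re z) (Im z)) holomorphic_on {z. Im z > 0}"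
proof (rule holomorphic_uniform_sequence)
  show "open {z. Im z > 0}" by (simp add: open_halfspace_Im_gt)
  have eq: "mode (Re z) (Im z) n = b n * exp (\<i> * of_real (\<omega> * (real n + \<kappa>)) * z)" for z n
  proof -
    have "\<i> * of_real (\<omega> * (real n + \<kappa>)) * z =
          of_real (- \<omega> * (real n + \<kappa>) * Im z) + \<i> * of_real (\<omega> * (real n + \<kappa>) * Re z)"
      by (simp add: complex_eq_iff)
    thus ?thesis unfolding mode_def cis_conv_exp by (simp only: exp_add exp_of_real mult.assoc)
  qed
  show "(\<lambda>z. \<Sum>n<N. mode (Re z) (Im z) n) holomorphic_on {z. Im z > 0}" for N
    unfolding eq by (intro holomorphic_intros)
  fix z assume z: "z \<in> {z. Im z > 0}"
  define d where "d = Im z / 2"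
  have d: "d > 0" using z by (simp add: d_def)
  have Im_ge: "Im w \<ge> d" if "w \<in> cball z d" for w
    using that abs_Im_le_cmod[of "z - w"] by (simp add: dist_norm d_def)
  have "uniform_limit (cball z d) (\<lambda>N z. \<Sum>n<N. mode (Re z) (Im z) n) (\<lambda>z. H (Re z) (Im z)) sequentially"
    unfolding H_def using summable_coeff[OF d]
  proof (rule Weierstrass_m_test[rotated])
    fix n w assume w: "w \<in> cball z d"
    have "norm (b n) * exp (- \<omega> * (real n + \<kappa>) * Im w) \<le> norm (b n) * exp (- \<omega> * (real n + \<kappa>) * d)"
      using Im_ge[OF w] \<omega>_pos \<kappa>_nonneg by (intro mult_left_mono) (auto intro!: mult_left_mono)
    thus "norm (mode (Re w) (Im w) n) \<le> norm (b n) * exp (- \<omega> * (real n + \<kappa>) * d)" by (simp add: norm_mode)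
  qed
  moreover have "cball z d \<subseteq> {z. Im z > 0}" using Im_ge d by fastforce
  ultimately show "\<exists>d>0. cball z d \<subseteq> {z. Im z > 0} \<and>
    uniform_limit (cball z d) (\<lambda>N z. \<Sum>n<N. mode (Re z) (Im z) n) (\<lambda>z. H (Re z) (Im z)) sequentially"
    using d by blast
qed

text \<open>Cauchy's estimate on the disc of radius t / 2, which stays above height t / 2, bounds
  the derivative by 2 M / t; the mean value inequality is then applied along the convex horizontal
  line through height t.\<close>

lemma H_Lipschitz:
  assumes t: "t > 0" and M: "\<And>x s. s \<ge> t / 2 \<Longrightarrow> norm (H x s) \<le> M"
  shows "norm (H x t - H y t) \<le> 2 * M / t * \<bar>x - y\<bar>"
proof -
  define h where "h = (\<lambda>z. H (Re z) (Im z))"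
  have hol: "h holomorphic_on {z. Im z > 0}" unfolding h_def by (rule holomorphic_H)
  have "norm (h (Complex x t) - h (Complex y t)) \<le> 2 * M / t * norm (Complex x t - Complex y t)"
  proof (rule field_differentiable_bound)
    show "convex {z. Im z = t}" unfolding convex_def by (auto simp: distrib_right[symmetric])
    fix z assume "z \<in> {z. Im z = t}"
    hence z: "Im z = t" by simp
    have Im_ge: "Im w \<ge> t / 2" if "w \<in> cball z (t / 2)" for w
      using that abs_Im_le_cmod[of "z - w"] z by (auto simp: dist_norm abs_le_iff)
    have sub: "cball z (t / 2) \<subseteq> {z. Im z > 0}" using Im_ge t by fastforce
    have hol': "h holomorphic_on cball z (t / 2)" by (rule holomorphic_on_subset[OF hol sub])
    have "norm ((deriv ^^ 1) h z) \<le> fact 1 * M / (t / 2) ^ 1"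
    proof (rule Cauchy_inequality)
      show "h holomorphic_on ball z (t / 2)" by (rule holomorphic_on_subset[OF hol']) auto
      show "continuous_on (cball z (t / 2)) h" using hol' by (rule holomorphic_on_imp_continuous_on)
      show "norm (h w) \<le> M" if "norm (z - w) = t / 2" for w
        unfolding h_def using Im_ge[of w] that by (intro M) (auto simp: dist_norm)
    qed (use t in auto)
    thus "norm (deriv h z) \<le> 2 * M / t" by (simp add: mult.commute)
    have "(h has_field_derivative deriv h z) (at z)"
      using hol z t by (intro holomorphic_derivI[OF hol]) (auto simp: open_halfspace_Im_gt)
    thus "(h has_field_derivative deriv h z) (at z within {z. Im z = t})" by (rule has_field_derivative_at_within)
  qed auto
  moreover have "norm (Complex x t - Complex y t) = \<bar>x - y\<bar>"
    by (simp add: cmod_def)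
  ultimately show ?thesis by (simp add: h_def)
qed

end

section \<open>Domination and termwise summation of the integral\<close>

context half_plane_series_growth
begin

text \<open>Strictly between \<open>\<alpha>\<^sub>0\<close> and \<alpha> there is room for an
  exponent \<beta> that absorbs the loss of the truncation bound and still leaves
  t^(\<alpha>-\<beta>-1) integrable at 0.\<close>

lemma mode_integral_bounds:
  assumes "\<alpha> > \<alpha>\<^sub>0"
  obtains C \<beta> where "C \<ge> 0" "\<alpha>\<^sub>0 < \<beta>" "\<beta> < \<alpha>"
    "\<And>N x t. 0 < t \<Longrightarrow> t \<le> 1 \<Longrightarrow> norm (\<Sum>n<N. mode x t n) \<le> C * t powr (- \<beta>)"
    "\<And>x t. 0 < t \<Longrightarrow> t \<le> 1 \<Longrightarrow> norm (H x t) \<le> C * t powr (- \<beta>)"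
proof -
  define \<epsilon> where "\<epsilon> = min 1 ((\<alpha> - \<alpha>\<^sub>0) / 2)"
  have \<epsilon>: "0 < \<epsilon>" "\<epsilon> \<le> 1" "\<alpha>\<^sub>0 + \<epsilon> < \<alpha>" using assms by (auto simp: \<epsilon>_def min_def field_simps)
  obtain C where C: "C \<ge> 0"
    "\<And>N x t. 0 < t \<Longrightarrow> t \<le> 1 \<Longrightarrow> norm (\<Sum>n<N. mode x t n) \<le> C * t powr (- (\<alpha>\<^sub>0 + \<epsilon>))"
    using partial_sum_growth[OF \<epsilon>(1,2)] by blast
  have "norm (H x t) \<le> C * t powr (- (\<alpha>\<^sub>0 + \<epsilon>))" if "0 < t" "t \<le> 1" for x t
    by (rule Lim_norm_ubound[OF _ partial_sums_tendsto_H]) (use C that in auto)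
  with C \<epsilon> show ?thesis by (intro that[of C "\<alpha>\<^sub>0 + \<epsilon>"]) auto
qed

lemma H_integrable:
  assumes "\<alpha> > \<alpha>\<^sub>0"
  shows "(\<lambda>t. t powr (\<alpha> - 1) *\<^sub>R H x t) integrable_on {0..}"
proof -
  obtain C \<beta> where C: "C \<ge> 0" "\<alpha>\<^sub>0 < \<beta>" "\<beta> < \<alpha>"
    "\<And>N x t. 0 < t \<Longrightarrow> t \<le> 1 \<Longrightarrow> norm (\<Sum>n<N. mode x t n) \<le> C * t powr (- \<beta>)"
    using mode_integral_bounds[OF assms] by metis
  define D1 where "D1 t = (if t \<in> {0..1} then C * t powr (\<alpha> - \<beta> - 1) else 0)" for t
  define D2 where "D2 t = (majorant 1 * exp (\<omega> * \<nu>0)) * (t powr (\<alpha> - 1) * exp (- (\<omega> * \<nu>0) * t))" for t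
  have "D1 integrable_on {0..}"
    unfolding D1_def using C(3) by (intro has_integral_integrable[OF has_integral_powr_initial]) auto
  moreover have "D2 integrable_on {0..}"
    unfolding D2_def using \<alpha>\<^sub>0_pos assms \<omega>_pos \<nu>0_pos
    by (intro integrable_on_mult_right has_integral_integrable[OF has_integral_Gamma_scaled]) auto
  ultimately have D: "(\<lambda>t. D1 t + D2 t) integrable_on {0..}" by (rule integrable_add)
  show ?thesis
  proof (rule dominated_convergence(1))
    show "(\<lambda>t. t powr (\<alpha> - 1) *\<^sub>R (\<Sum>n<N. mode x t n)) integrable_on {0..}" for N
      unfolding scaleR_sum_right using assms \<alpha>\<^sub>0_pos
      by (intro integrable_sum has_integral_integrable[OF has_integral_fterm]) auto
    show "(\<lambda>t. D1 t + D2 t) integrable_on {0..}" by (rule D)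
    fix t :: real assume t: "t \<in> {0..}"
    have D_nonneg: "D1 t \<ge> 0" "D2 t \<ge> 0" using C(1) majorant_nonneg[of 1] by (auto simp: D1_def D2_def)
    show "(\<lambda>N. t powr (\<alpha> - 1) *\<^sub>R (\<Sum>n<N. mode x t n)) \<longlonglongrightarrow> t powr (\<alpha> - 1) *\<^sub>R H x t"
      using t by (cases "t = 0") (auto intro!: tendsto_intros partial_sums_tendsto_H)
    fix N
    consider "t = 0" | "0 < t" "t \<le> 1" | "t > 1" using t by fastforce
    thus "norm (t powr (\<alpha> - 1) *\<^sub>R (\<Sum>n<N. mode x t n)) \<le> D1 t + D2 t"
    proof cases
      case 1 thus ?thesis using D_nonneg by simp
    next
      case 2
      have "norm (t powr (\<alpha> - 1) *\<^sub>R (\<Sum>n<N. mode x t n)) \<le> t powr (\<alpha> - 1) * (C * t powr (- \<beta>))"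
        using C(4)[OF 2] by (simp add: mult_left_mono)
      also have "\<dots> = D1 t" using 2 by (simp add: D1_def powr_add[symmetric] algebra_simps)
      finally show ?thesis using D_nonneg by linarith
    next
      case 3
      have "norm (t powr (\<alpha> - 1) *\<^sub>R (\<Sum>n<N. mode x t n)) \<le> t powr (\<alpha> - 1) * (majorant 1 * exp (- \<omega> * \<nu>0 * (t - 1)))"
        using norm_partial_sum_le[of 1 t "{..<N}" x] 3 by (simp add: mult_left_mono)
      also have "\<dots> = D2 t" unfolding exp_shift D2_def by (simp add: mult_ac)
      finally show ?thesis using D_nonneg by linarith
    qed
  qed
qed

text \<open>The integral is split at a small height \<tau>. Below it, truncation and H are both
  O(t^(-\<beta>)), so the error is O(\<tau>^(\<alpha>-\<beta>)) for every N; above it, the error is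
  \<open>Rem N\<close> times a convergent Gamma integral. First \<tau> is fixed, then N is taken
  large, and x plays no part in either choice.\<close>

theorem uniform_convergence:
  assumes "\<alpha> > \<alpha>\<^sub>0"
  shows "uniform_limit UNIV (\<lambda>N x. \<Sum>n<N. fterm \<alpha> x n) (frac_integral \<alpha>) sequentially"
proof (rule uniform_limitI)
  fix e :: real assume e: "e > 0"
  have \<alpha>: "\<alpha> > 0" using assms \<alpha>\<^sub>0_pos by simp
  obtain C \<beta> where C: "C \<ge> 0" "\<alpha>\<^sub>0 < \<beta>" "\<beta> < \<alpha>"
    "\<And>N x t. 0 < t \<Longrightarrow> t \<le> 1 \<Longrightarrow> norm (\<Sum>n<N. mode x t n) \<le> C * t powr (- \<beta>)"
    "\<And>x t. 0 < t \<Longrightarrow> t \<le> 1 \<Longrightarrow> norm (H x t) \<le> C * t powr (- \<beta>)"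
    using mode_integral_bounds[OF assms] by metis
  define G where "G = Gamma \<alpha> * \<omega> powr (- \<alpha>)"
  have G: "G > 0" using \<alpha> \<omega>_pos by (simp add: G_def Gamma_real_pos)
  define p where "p = \<alpha> - \<beta>"
  have p: "p > 0" using C by (simp add: p_def)
  have "((\<lambda>\<tau>. 2 * C * (\<tau> powr p / p)) \<longlongrightarrow> 0) (at_right 0)"
    using powr_tendsto_0_at_right_0[OF p, of "2 * C / p"] by (simp add: mult_ac)
  hence "\<forall>\<^sub>F \<tau> in at_right 0. 2 * C * (\<tau> powr p / p) < e * G / 2"
    using e G by (intro order_tendstoD) auto
  hence "\<forall>\<^sub>F \<tau> in at_right 0. 2 * C * (\<tau> powr p / p) < e * G / 2 \<and> \<tau> \<in> {0<..<1}"
    using eventually_at_right_real[of 0 1] by (intro eventually_conj) auto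
  then obtain \<tau> where \<tau>: "2 * C * (\<tau> powr p / p) < e * G / 2" "0 < \<tau>" "\<tau> < 1"
    using eventually_happens[of _ "at_right (0::real)"] by (auto simp: trivial_limit_at_right_real)
  define Rem where "Rem N = majorant \<tau> - (\<Sum>n<N. norm (b n) * exp (- \<omega> * (real n + \<kappa>) * \<tau>))" for N
  have "(\<lambda>N. \<Sum>n<N. norm (b n) * exp (- \<omega> * (real n + \<kappa>) * \<tau>)) \<longlonglongrightarrow> majorant \<tau>"
    unfolding majorant_def using summable_coeff[OF \<tau>(2)] by (rule summable_LIMSEQ)
  hence Rem0: "Rem \<longlonglongrightarrow> 0"
    unfolding Rem_def by (auto intro!: tendsto_eq_intros)
  have Rem_nonneg: "Rem N \<ge> 0" for N
    unfolding Rem_def majorant_def using sum_le_suminf[OF summable_coeff[OF \<tau>(2)], of "{..<N}"] by simp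
  define Q where "Q = exp (\<omega> * \<nu>0 * \<tau>) * (Gamma \<alpha> * (\<omega> * \<nu>0) powr (- \<alpha>))"
  have "(\<lambda>N. Rem N * Q) \<longlonglongrightarrow> 0 * Q" using Rem0 by (intro tendsto_intros)
  hence ev: "\<forall>\<^sub>F N in sequentially. Rem N * Q < e * G / 2"
    using e G by (intro order_tendstoD) auto
  have main: "norm (G *\<^sub>R ((\<Sum>n<N. fterm \<alpha> x n) - frac_integral \<alpha> x)) \<le> 2 * C * (\<tau> powr p / p) + Rem N * Q" for N x
  proof -
    define D1 where "D1 t = (if t \<in> {0..\<tau>} then 2 * C * t powr (p - 1) else 0)" for t
    define D2 where "D2 t = (Rem N * exp (\<omega> * \<nu>0 * \<tau>)) * (t powr (\<alpha> - 1) * exp (- (\<omega> * \<nu>0) * t))" for t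
    have "(D1 has_integral 2 * C * (\<tau> powr p / p)) {0..}"
      unfolding D1_def using p \<tau> by (intro has_integral_powr_initial) auto
    moreover have "(D2 has_integral (Rem N * exp (\<omega> * \<nu>0 * \<tau>)) * (Gamma \<alpha> * (\<omega> * \<nu>0) powr (- \<alpha>))) {0..}"
      unfolding D2_def using \<alpha> \<omega>_pos \<nu>0_pos
      by (intro has_integral_mult_right has_integral_Gamma_scaled) auto
    ultimately have D: "((\<lambda>t. D1 t + D2 t) has_integral (2 * C * (\<tau> powr p / p) + Rem N * Q)) {0..}"
      using has_integral_add[of D1 _ "{0..}" D2] by (auto simp: Q_def mult_ac)
    have "((\<lambda>t. t powr (\<alpha> - 1) *\<^sub>R (\<Sum>n<N. mode x t n)) has_integral G *\<^sub>R (\<Sum>n<N. fterm \<alpha> x n)) {0..}"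
      unfolding scaleR_sum_right G_def using \<alpha> by (intro has_integral_sum has_integral_fterm) auto
    moreover have "((\<lambda>t. t powr (\<alpha> - 1) *\<^sub>R H x t) has_integral G *\<^sub>R frac_integral \<alpha> x) {0..}"
      using H_integrable[OF assms, of x] G by (auto simp: frac_integral_def G_def[symmetric] has_integral_iff)
    ultimately have diff: "((\<lambda>t. t powr (\<alpha> - 1) *\<^sub>R (\<Sum>n<N. mode x t n) - t powr (\<alpha> - 1) *\<^sub>R H x t) has_integral
        G *\<^sub>R (\<Sum>n<N. fterm \<alpha> x n) - G *\<^sub>R frac_integral \<alpha> x) {0..}"
      by (rule has_integral_diff)
    have "norm (integral {0..} (\<lambda>t. t powr (\<alpha> - 1) *\<^sub>R (\<Sum>n<N. mode x t n) - t powr (\<alpha> - 1) *\<^sub>R H x t)) \<le>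
          integral {0..} (\<lambda>t. D1 t + D2 t)"
    proof (rule Henstock_Kurzweil_Integration.integral_norm_bound_integral)
      fix t :: real assume t: "t \<in> {0..}"
      have D_nonneg: "D1 t \<ge> 0" "D2 t \<ge> 0" using C(1) Rem_nonneg[of N] by (auto simp: D1_def D2_def)
      have eq: "t powr (\<alpha> - 1) *\<^sub>R (\<Sum>n<N. mode x t n) - t powr (\<alpha> - 1) *\<^sub>R H x t = t powr (\<alpha> - 1) *\<^sub>R ((\<Sum>n<N. mode x t n) - H x t)"
        by (simp add: scaleR_diff_right)
      consider "t = 0" | "0 < t" "t \<le> \<tau>" | "t > \<tau>" using t by fastforce
      thus "norm (t powr (\<alpha> - 1) *\<^sub>R (\<Sum>n<N. mode x t n) - t powr (\<alpha> - 1) *\<^sub>R H x t) \<le> D1 t + D2 t"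
      proof cases
        case 1 thus ?thesis using D_nonneg by simp
      next
        case 2
        have "norm ((\<Sum>n<N. mode x t n) - H x t) \<le> 2 * (C * t powr (- \<beta>))"
          using C(4)[of t x N] C(5)[of t x] 2 \<tau> norm_triangle_ineq4[of "\<Sum>n<N. mode x t n" "H x t"] by linarith
        hence "norm (t powr (\<alpha> - 1) *\<^sub>R ((\<Sum>n<N. mode x t n) - H x t)) \<le> t powr (\<alpha> - 1) * (2 * (C * t powr (- \<beta>)))"
          by (simp add: mult_left_mono)
        also have "\<dots> = D1 t" using 2 by (simp add: D1_def p_def powr_add[symmetric] algebra_simps)
        finally show ?thesis using D_nonneg unfolding eq by linarith
      next
        case 3
        have "norm (t powr (\<alpha> - 1) *\<^sub>R ((\<Sum>n<N. mode x t n) - H x t)) \<le> t powr (\<alpha> - 1) * (Rem N * exp (- \<omega> * \<nu>0 * (t - \<tau>)))"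
          using norm_H_diff_partial_le[of \<tau> t x N] 3 \<tau> by (simp add: mult_left_mono Rem_def)
        also have "\<dots> = D2 t" unfolding exp_shift D2_def by (simp add: mult_ac)
        finally show ?thesis using D_nonneg unfolding eq by linarith
      qed
    qed (use D diff in \<open>auto simp: integrable_on_def\<close>)
    thus ?thesis using integral_unique[OF D] integral_unique[OF diff] by (simp add: scaleR_diff_right)
  qed
  show "\<forall>\<^sub>F N in sequentially. \<forall>x\<in>UNIV. dist (\<Sum>n<N. fterm \<alpha> x n) (frac_integral \<alpha> x) < e"
    using ev
  proof eventually_elim
    case (elim N)
    show ?case
    proof
      fix x
      have "norm (G *\<^sub>R ((\<Sum>n<N. fterm \<alpha> x n) - frac_integral \<alpha> x)) < e * G"
        using main[of x N] elim \<tau>(1) by linarith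
      thus "dist (\<Sum>n<N. fterm \<alpha> x n) (frac_integral \<alpha> x) < e"
        using G by (simp add: dist_norm mult.commute[of e])
    qed
  qed
qed

lemma continuous_frac_integral:
  assumes "\<alpha> > \<alpha>\<^sub>0"
  shows "continuous_on S (frac_integral \<alpha>)"
proof -
  have "continuous_on UNIV (frac_integral \<alpha>)"
    by (rule uniform_limit_theorem[OF _ uniform_convergence[OF assms]])
       (auto intro!: always_eventually continuous_intros simp: fterm_def)
  thus ?thesis by (rule continuous_on_subset) auto
qed

end

section \<open>Fractional integrals: regularity\<close>

context half_plane_series_growth
begin

lemma H_diff_le:
  assumes "t > 0"
  shows "norm (H x t - H y t) \<le> 2 * B * t powr (- \<alpha>\<^sub>0)"
  using growth[OF assms, of x] growth[OF assms, of y] norm_triangle_ineq4[of "H x t" "H y t"] by linarith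

lemma H_Lipschitz_small:
  obtains L where "L \<ge> 0" "\<And>x y t. t > 0 \<Longrightarrow> norm (H x t - H y t) \<le> L * \<bar>x - y\<bar> * t powr (- \<alpha>\<^sub>0 - 1)"
proof (rule that[of "2 * B * 2 powr \<alpha>\<^sub>0"])
  show "2 * B * 2 powr \<alpha>\<^sub>0 \<ge> 0" using B_nonneg by simp
  fix x y t :: real assume t: "t > 0"
  have "norm (H x s) \<le> B * (t / 2) powr (- \<alpha>\<^sub>0)" if "s \<ge> t / 2" for x s
  proof -
    have "norm (H x s) \<le> B * s powr (- \<alpha>\<^sub>0)" using that t by (intro growth) auto
    also have "\<dots> \<le> B * (t / 2) powr (- \<alpha>\<^sub>0)"
      using that t \<alpha>\<^sub>0_pos B_nonneg by (intro mult_left_mono powr_mono2') auto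
    finally show ?thesis .
  qed
  hence "norm (H x t - H y t) \<le> 2 * (B * (t / 2) powr (- \<alpha>\<^sub>0)) / t * \<bar>x - y\<bar>"
    by (rule H_Lipschitz[OF t])
  also have "\<dots> = 2 * B * 2 powr \<alpha>\<^sub>0 * \<bar>x - y\<bar> * t powr (- \<alpha>\<^sub>0 - 1)"
    using t by (simp add: powr_divide powr_minus powr_diff field_simps)
  finally show "norm (H x t - H y t) \<le> 2 * B * 2 powr \<alpha>\<^sub>0 * \<bar>x - y\<bar> * t powr (- \<alpha>\<^sub>0 - 1)" .
qed

text \<open>For \<alpha> = \<open>\<alpha>\<^sub>0\<close> + 1 the bound of
  \<open>H_Lipschitz_small\<close> would give the integrand 1 / t at infinity. Exponential decay of
  H buys the extra power of t that makes it integrable.\<close>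

lemma H_Lipschitz_large:
  obtains L where "L \<ge> 0" "\<And>x y t. t \<ge> 1 \<Longrightarrow> norm (H x t - H y t) \<le> L * \<bar>x - y\<bar> * t powr (- \<alpha>\<^sub>0 - 2)"
proof -
  obtain C where C: "C > 0" "\<And>t. t > 0 \<Longrightarrow> exp (- (\<omega> * \<nu>0) * t) \<le> C * t powr (- (\<alpha>\<^sub>0 + 1))"
    using exp_decay_le_powr[of "\<omega> * \<nu>0" "\<alpha>\<^sub>0 + 1"] \<omega>_pos \<nu>0_pos \<alpha>\<^sub>0_pos by (metis add_pos_pos mult_pos_pos zero_less_one)
  define K where "K = majorant (1/2) * exp (\<omega> * \<nu>0 * (1/2)) * C"
  have K: "K \<ge> 0" using C(1) majorant_nonneg[of "1/2"] by (simp add: K_def)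
  have "norm (H x t - H y t) \<le> (2 * K * 2 powr (\<alpha>\<^sub>0 + 1)) * \<bar>x - y\<bar> * t powr (- \<alpha>\<^sub>0 - 2)" if t: "t \<ge> 1" for x y t
  proof -
    have "norm (H x s) \<le> K * (t / 2) powr (- (\<alpha>\<^sub>0 + 1))" if s: "s \<ge> t / 2" for x s
    proof -
      have "norm (H x s) \<le> majorant (1/2) * exp (- \<omega> * \<nu>0 * (s - 1/2))"
        using s t by (intro norm_H_le) auto
      also have "\<dots> = majorant (1/2) * exp (\<omega> * \<nu>0 * (1/2)) * exp (- (\<omega> * \<nu>0) * s)"
        unfolding exp_shift by simp
      also have "\<dots> \<le> majorant (1/2) * exp (\<omega> * \<nu>0 * (1/2)) * (C * s powr (- (\<alpha>\<^sub>0 + 1)))"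
        using s t majorant_nonneg[of "1/2"] by (intro mult_left_mono C) auto
      also have "\<dots> = K * s powr (- (\<alpha>\<^sub>0 + 1))" by (simp add: K_def)
      also have "\<dots> \<le> K * (t / 2) powr (- (\<alpha>\<^sub>0 + 1))"
        using s t \<alpha>\<^sub>0_pos K by (intro mult_left_mono powr_mono2') auto
      finally show ?thesis .
    qed
    hence "norm (H x t - H y t) \<le> 2 * (K * (t / 2) powr (- (\<alpha>\<^sub>0 + 1))) / t * \<bar>x - y\<bar>"
      using t by (intro H_Lipschitz) auto
    also have "(t / 2) powr (- (\<alpha>\<^sub>0 + 1)) = 2 powr (\<alpha>\<^sub>0 + 1) * t powr (- (\<alpha>\<^sub>0 + 1))"
    proof -
      define p where "p = \<alpha>\<^sub>0 + 1"
      show ?thesis unfolding p_def[symmetric] using t by (simp add: powr_divide powr_minus field_simps)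
    qed
    also have "t powr (- (\<alpha>\<^sub>0 + 1)) = t powr (- \<alpha>\<^sub>0 - 2) * t"
      using t powr_add[of t "- \<alpha>\<^sub>0 - 2" 1] by (simp add: algebra_simps)
    finally show ?thesis using t by (simp add: mult_ac)
  qed
  with K show ?thesis by (intro that[of "2 * K * 2 powr (\<alpha>\<^sub>0 + 1)"]) auto
qed

lemma frac_integral_diff_le:
  assumes "\<alpha> > \<alpha>\<^sub>0" and D: "(D has_integral I) {0..}"
    and le: "\<And>t. t > 0 \<Longrightarrow> t powr (\<alpha> - 1) * norm (H x t - H y t) \<le> D t" and D0: "D 0 \<ge> 0"
  shows "norm (frac_integral \<alpha> x - frac_integral \<alpha> y) \<le> I / (Gamma \<alpha> * \<omega> powr (- \<alpha>))"
proof -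
  define G where "G = Gamma \<alpha> * \<omega> powr (- \<alpha>)"
  have G: "G > 0" using assms \<alpha>\<^sub>0_pos \<omega>_pos by (simp add: G_def Gamma_real_pos)
  have int: "(\<lambda>t. t powr (\<alpha> - 1) *\<^sub>R H x t - t powr (\<alpha> - 1) *\<^sub>R H y t) integrable_on {0..}"
    by (intro integrable_diff H_integrable assms)
  have "norm (integral {0..} (\<lambda>t. t powr (\<alpha> - 1) *\<^sub>R H x t - t powr (\<alpha> - 1) *\<^sub>R H y t)) \<le> integral {0..} D"
  proof (rule Henstock_Kurzweil_Integration.integral_norm_bound_integral[OF int])
    show "D integrable_on {0..}" using D by (rule has_integral_integrable)
    fix t :: real assume "t \<in> {0..}"
    thus "norm (t powr (\<alpha> - 1) *\<^sub>R H x t - t powr (\<alpha> - 1) *\<^sub>R H y t) \<le> D t"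
      using le[of t] D0 by (cases "t = 0") (auto simp: scaleR_diff_right[symmetric])
  qed
  also have "integral {0..} (\<lambda>t. t powr (\<alpha> - 1) *\<^sub>R H x t - t powr (\<alpha> - 1) *\<^sub>R H y t) =
      integral {0..} (\<lambda>t. t powr (\<alpha> - 1) *\<^sub>R H x t) - integral {0..} (\<lambda>t. t powr (\<alpha> - 1) *\<^sub>R H y t)"
    by (intro integral_diff H_integrable assms)
  also have "\<dots> = G *\<^sub>R (frac_integral \<alpha> x - frac_integral \<alpha> y)"
    using G by (simp add: frac_integral_def G_def[symmetric] scaleR_diff_right)
  finally have "G * norm (frac_integral \<alpha> x - frac_integral \<alpha> y) \<le> I"
    using G integral_unique[OF D] by simp
  thus ?thesis using G by (simp add: G_def[symmetric] field_simps)
qed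

text \<open>The integral is split at t = |x - y|. Below, the difference is bounded by the sum of two
  growth bounds; above, by the Lipschitz bound. Both pieces scale like |x - y|^s, and they converge
  because 0 < s and s < 1 respectively.\<close>

theorem frac_integral_Holder:
  assumes "\<alpha>\<^sub>0 < \<alpha>" "\<alpha> < \<alpha>\<^sub>0 + 1"
  obtains C where "\<And>x y. norm (frac_integral \<alpha> x - frac_integral \<alpha> y) \<le> C * \<bar>x - y\<bar> powr (\<alpha> - \<alpha>\<^sub>0)"
proof -
  obtain L where L: "L \<ge> 0" "\<And>x y t. t > 0 \<Longrightarrow> norm (H x t - H y t) \<le> L * \<bar>x - y\<bar> * t powr (- \<alpha>\<^sub>0 - 1)"
    using H_Lipschitz_small by blast
  define s where "s = \<alpha> - \<alpha>\<^sub>0"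
  have s: "0 < s" "s < 1" using assms by (auto simp: s_def)
  define G where "G = Gamma \<alpha> * \<omega> powr (- \<alpha>)"
  define C where "C = (2 * B / s + L / (1 - s)) / G"
  have "norm (frac_integral \<alpha> x - frac_integral \<alpha> y) \<le> C * \<bar>x - y\<bar> powr s" for x y
  proof (cases "x = y")
    case False
    define \<delta> where "\<delta> = \<bar>x - y\<bar>"
    have \<delta>: "\<delta> > 0" using False by (simp add: \<delta>_def)
    define D1 where "D1 t = (if t \<in> {0..\<delta>} then 2 * B * t powr (s - 1) else 0)" for t
    define D2 where "D2 t = (if t \<in> {\<delta>..} then L * \<delta> * t powr (s - 1 - 1) else 0)" for t
    have 1: "(D1 has_integral 2 * B * (\<delta> powr s / s)) {0..}"
      unfolding D1_def using s \<delta> by (intro has_integral_powr_initial) auto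
    have 2: "(D2 has_integral L * \<delta> * (\<delta> powr (s - 1) / - (s - 1))) {0..}"
      unfolding D2_def using s \<delta> by (intro has_integral_powr_tail) auto
    have D_nonneg: "D1 t \<ge> 0" "D2 t \<ge> 0" for t using B_nonneg L(1) \<delta> by (auto simp: D1_def D2_def)
    have "norm (frac_integral \<alpha> x - frac_integral \<alpha> y) \<le>
        (2 * B * (\<delta> powr s / s) + L * \<delta> * (\<delta> powr (s - 1) / - (s - 1))) / (Gamma \<alpha> * \<omega> powr (- \<alpha>))"
    proof (rule frac_integral_diff_le[OF assms(1) has_integral_add[OF 1 2]])
      fix t :: real assume t: "t > 0"
      show "t powr (\<alpha> - 1) * norm (H x t - H y t) \<le> D1 t + D2 t"
      proof (cases "t \<le> \<delta>")
        case True
        have "t powr (\<alpha> - 1) * norm (H x t - H y t) \<le> t powr (\<alpha> - 1) * (2 * B * t powr (- \<alpha>\<^sub>0))"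
          by (intro mult_left_mono H_diff_le t) auto
        also have "\<dots> = D1 t" using t True by (simp add: D1_def s_def powr_add[symmetric] algebra_simps)
        finally show ?thesis using D_nonneg(2)[of t] by linarith
      next
        case False
        have "t powr (\<alpha> - 1) * norm (H x t - H y t) \<le> t powr (\<alpha> - 1) * (L * \<delta> * t powr (- \<alpha>\<^sub>0 - 1))"
          unfolding \<delta>_def by (intro mult_left_mono L t) auto
        also have "\<dots> = D2 t" using t False by (simp add: D2_def s_def powr_add[symmetric] algebra_simps)
        finally show ?thesis using D_nonneg(1)[of t] by linarith
      qed
    qed (use D_nonneg in auto)
    also have "2 * B * (\<delta> powr s / s) + L * \<delta> * (\<delta> powr (s - 1) / - (s - 1)) = (2 * B / s + L / (1 - s)) * \<delta> powr s"
    proof -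
      have "\<delta> * \<delta> powr (s - 1) = \<delta> powr s" using \<delta> powr_add[of \<delta> 1 "s - 1"] by simp
      hence "L * \<delta> * (\<delta> powr (s - 1) / - (s - 1)) = L / (1 - s) * \<delta> powr s"
        by (simp add: mult.assoc)
      thus ?thesis by (simp add: algebra_simps)
    qed
    finally show ?thesis by (simp add: C_def G_def \<delta>_def)
  qed auto
  thus ?thesis unfolding s_def by (rule that)
qed

text \<open>At the borderline exponent the Lipschitz part of the integrand becomes |x - y| / t
  between |x - y| and 1, and this is where the logarithm comes from; the ranges on either side
  contribute only a multiple of |x - y|.\<close>

theorem frac_integral_log_Lipschitz:
  assumes "\<alpha> = \<alpha>\<^sub>0 + 1"
  obtains C where "\<And>x y. \<bar>x - y\<bar> \<le> 1 / 2 \<Longrightarrow>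
    norm (frac_integral \<alpha> x - frac_integral \<alpha> y) \<le> C * \<bar>x - y\<bar> * \<bar>ln \<bar>x - y\<bar>\<bar>"
proof -
  have \<alpha>: "\<alpha> > \<alpha>\<^sub>0" using assms by simp
  obtain L where L: "L \<ge> 0" "\<And>x y t. t > 0 \<Longrightarrow> norm (H x t - H y t) \<le> L * \<bar>x - y\<bar> * t powr (- \<alpha>\<^sub>0 - 1)"
    using H_Lipschitz_small by blast
  obtain M where M: "M \<ge> 0" "\<And>x y t. t \<ge> 1 \<Longrightarrow> norm (H x t - H y t) \<le> M * \<bar>x - y\<bar> * t powr (- \<alpha>\<^sub>0 - 2)"
    using H_Lipschitz_large by blast
  define G where "G = Gamma \<alpha> * \<omega> powr (- \<alpha>)"
  have G: "G > 0" using \<alpha> \<alpha>\<^sub>0_pos \<omega>_pos by (simp add: G_def Gamma_real_pos)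
  define C where "C = ((2 * B + M) / ln 2 + L) / G"
  have "norm (frac_integral \<alpha> x - frac_integral \<alpha> y) \<le> C * \<bar>x - y\<bar> * \<bar>ln \<bar>x - y\<bar>\<bar>" if xy: "\<bar>x - y\<bar> \<le> 1 / 2" for x y
  proof (cases "x = y")
    case False
    define \<delta> where "\<delta> = \<bar>x - y\<bar>"
    have \<delta>: "\<delta> > 0" "\<delta> \<le> 1 / 2" using False xy by (auto simp: \<delta>_def)
    define D1 where "D1 t = (if t \<in> {0..\<delta>} then 2 * B else 0)" for t
    define D2 where "D2 t = (if t \<in> {\<delta>..1} then L * \<delta> * (1 / t) else 0)" for t
    define D3 where "D3 t = (if t \<in> {1..} then M * \<delta> * t powr (- 1 - 1) else 0)" for t :: real
    have 1: "(D1 has_integral 2 * B * \<delta>) {0..}"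
    proof -
      have "((\<lambda>t. 2 * B) has_integral 2 * B * \<delta>) {0..\<delta>}"
        using has_integral_const_real[of "2 * B" 0 \<delta>] \<delta> by (simp add: mult.commute)
      thus ?thesis unfolding D1_def by (subst has_integral_restrict) auto
    qed
    have 2: "(D2 has_integral L * \<delta> * (ln 1 - ln \<delta>)) {0..}"
    proof -
      have "((\<lambda>t. 1 / t) has_integral (ln 1 - ln \<delta>)) {\<delta>..1}"
        using \<delta> by (intro fundamental_theorem_of_calculus)
          (auto intro!: derivative_eq_intros simp: has_real_derivative_iff_has_vector_derivative[symmetric])
      hence "((\<lambda>t. L * \<delta> * (1 / t)) has_integral L * \<delta> * (ln 1 - ln \<delta>)) {\<delta>..1}"
        by (rule has_integral_mult_right)
      thus ?thesis unfolding D2_def using \<delta> by (subst has_integral_restrict) auto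
    qed
    have 3: "(D3 has_integral M * \<delta> * (1 powr (- 1) / - (- 1))) {0..}"
      unfolding D3_def by (intro has_integral_powr_tail) auto
    have D_nonneg: "D1 t \<ge> 0" "D2 t \<ge> 0" "D3 t \<ge> 0" for t
      using B_nonneg L(1) M(1) \<delta> by (auto simp: D1_def D2_def D3_def)
    have "norm (frac_integral \<alpha> x - frac_integral \<alpha> y) \<le>
       (2 * B * \<delta> + L * \<delta> * (ln 1 - ln \<delta>) + M * \<delta> * (1 powr (- 1) / - (- 1))) / (Gamma \<alpha> * \<omega> powr (- \<alpha>))"
    proof (rule frac_integral_diff_le[OF \<alpha> has_integral_add[OF has_integral_add[OF 1 2] 3]])
      fix t :: real assume t: "t > 0"
      consider "t \<le> \<delta>" | "\<delta> < t" "t \<le> 1" | "t > 1" by linarith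
      thus "t powr (\<alpha> - 1) * norm (H x t - H y t) \<le> D1 t + D2 t + D3 t"
      proof cases
        case 1
        have "t powr (\<alpha> - 1) * norm (H x t - H y t) \<le> t powr (\<alpha> - 1) * (2 * B * t powr (- \<alpha>\<^sub>0))"
          by (intro mult_left_mono H_diff_le t) auto
        also have "\<dots> = 2 * B * (t powr \<alpha>\<^sub>0 * t powr (- \<alpha>\<^sub>0))" by (simp add: assms)
        also have "\<dots> = D1 t" using t 1 by (simp add: D1_def powr_add[symmetric])
        finally show ?thesis using D_nonneg[of t] by linarith
      next
        case 2
        have "t powr (\<alpha> - 1) * norm (H x t - H y t) \<le> t powr (\<alpha> - 1) * (L * \<delta> * t powr (- \<alpha>\<^sub>0 - 1))"
          unfolding \<delta>_def by (intro mult_left_mono L t) auto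
        also have "\<dots> = L * \<delta> * (t powr \<alpha>\<^sub>0 * t powr (- \<alpha>\<^sub>0 - 1))" by (simp add: assms)
        also have "\<dots> = D2 t" using t 2 by (simp add: D2_def powr_add[symmetric] powr_minus_divide)
        finally show ?thesis using D_nonneg[of t] by linarith
      next
        case 3
        have "t powr (\<alpha> - 1) * norm (H x t - H y t) \<le> t powr (\<alpha> - 1) * (M * \<delta> * t powr (- \<alpha>\<^sub>0 - 2))"
          using 3 unfolding \<delta>_def by (intro mult_left_mono M) auto
        also have "\<dots> = M * \<delta> * (t powr \<alpha>\<^sub>0 * t powr (- \<alpha>\<^sub>0 - 2))" by (simp add: assms)
        also have "\<dots> = D3 t" using t 3 by (simp add: D3_def powr_add[symmetric])
        finally show ?thesis using D_nonneg[of t] by linarith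
      qed
    qed (use D_nonneg in auto)
    also have "2 * B * \<delta> + L * \<delta> * (ln 1 - ln \<delta>) + M * \<delta> * (1 powr (- 1) / - (- 1)) = (2 * B + M) * \<delta> + L * \<delta> * \<bar>ln \<delta>\<bar>"
      using \<delta> by (simp add: algebra_simps)
    also have "\<dots> \<le> ((2 * B + M) / ln 2 + L) * \<delta> * \<bar>ln \<delta>\<bar>"
    proof -
      \<comment> \<open>As \<delta> is at most 1 / 2, |ln \<delta>| is at least ln 2, so the terms
        linear in \<delta> can be absorbed into the logarithmic one.\<close>
      have "ln \<delta> \<le> ln (1 / 2)" using \<delta> by (subst ln_le_cancel_iff) auto
      hence "ln 2 \<le> \<bar>ln \<delta>\<bar>" by (simp add: ln_div)
      hence "1 \<le> \<bar>ln \<delta>\<bar> / ln 2" by (subst le_divide_eq) auto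
      hence "(2 * B + M) * \<delta> * 1 \<le> (2 * B + M) * \<delta> * (\<bar>ln \<delta>\<bar> / ln 2)"
        using B_nonneg M(1) \<delta> by (intro mult_left_mono) auto
      thus ?thesis by (simp add: algebra_simps add_divide_distrib)
    qed
    finally show ?thesis using G by (simp add: C_def G_def[symmetric] \<delta>_def[symmetric] divide_right_mono)
  qed auto
  thus ?thesis using that by blast
qed

text \<open>Differentiating the mode of frequency \<omega> \<nu> multiplies it by i \<omega> \<nu>,
  which lowers \<alpha> by one; \<alpha> - 1 is still above \<open>\<alpha>\<^sub>0\<close>, so the
  differentiated series converges uniformly.\<close>

lemma frac_integral_derivative:
  assumes "\<alpha> > \<alpha>\<^sub>0 + 1"
  shows "(frac_integral \<alpha> has_vector_derivative (\<i> * of_real \<omega> * frac_integral (\<alpha> - 1) x)) (at x)"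
proof -
  have \<alpha>: "\<alpha> > \<alpha>\<^sub>0" "\<alpha> - 1 > \<alpha>\<^sub>0" using assms by auto
  have der1: "((\<lambda>x. fterm \<alpha> x n) has_vector_derivative (\<i> * of_real \<omega> * fterm (\<alpha> - 1) x n)) (at x)" for n x
  proof (cases "b n = 0")
    case False
    define \<nu> where "\<nu> = real n + \<kappa>"
    have \<nu>: "\<nu> > 0" using freq_pos[OF False] by (simp add: \<nu>_def)
    have "((\<lambda>z. b n * of_real (\<nu> powr (- \<alpha>)) * exp (\<i> * (of_real (\<omega> * \<nu>) * z))) has_field_derivative
      (b n * of_real (\<nu> powr (- \<alpha>)) * (exp (\<i> * (of_real (\<omega> * \<nu>) * z)) * (\<i> * of_real (\<omega> * \<nu>))))) (at z)" for z
      by (auto intro!: derivative_eq_intros)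
    from has_vector_derivative_real_field[OF this]
    have "((\<lambda>x. fterm \<alpha> x n) has_vector_derivative
      (b n * of_real (\<nu> powr (- \<alpha>)) * (exp (\<i> * (of_real (\<omega> * \<nu>) * of_real x)) * (\<i> * of_real (\<omega> * \<nu>))))) (at x)"
      by (simp add: fterm_def \<nu>_def cis_conv_exp)
    moreover have "\<nu> powr (- (\<alpha> - 1)) = \<nu> powr (- \<alpha>) * \<nu>"
      using \<nu> powr_add[of \<nu> "-\<alpha>" 1] by simp
    ultimately show ?thesis
      by (simp add: fterm_def \<nu>_def[symmetric] cis_conv_exp mult_ac)
  qed (auto simp: fterm_def)
  have "\<exists>g. \<forall>x\<in>UNIV. (\<lambda>N. \<Sum>n<N. fterm \<alpha> x n) \<longlonglongrightarrow> g x \<and>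
      (g has_derivative (\<lambda>h. h *\<^sub>R (\<i> * of_real \<omega> * frac_integral (\<alpha> - 1) x))) (at x within UNIV)"
  proof (rule has_derivative_sequence)
    show "((\<lambda>x. \<Sum>n<N. fterm \<alpha> x n) has_derivative (\<lambda>h. h *\<^sub>R (\<Sum>n<N. \<i> * of_real \<omega> * fterm (\<alpha> - 1) x n))) (at x within UNIV)" for N x
      using has_vector_derivative_sum[of "{..<N}", OF der1] by (simp add: has_vector_derivative_def)
    show "(\<lambda>N. \<Sum>n<N. fterm \<alpha> 0 n) \<longlonglongrightarrow> frac_integral \<alpha> 0"
      using tendsto_uniform_limitI[OF uniform_convergence[OF \<alpha>(1)]] by simp
    fix e :: real assume e: "e > 0"
    have "\<forall>\<^sub>F N in sequentially. \<forall>x\<in>UNIV. dist (\<Sum>n<N. fterm (\<alpha> - 1) x n) (frac_integral (\<alpha> - 1) x) < e / \<omega>"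
      using e \<omega>_pos by (intro uniform_limitD[OF uniform_convergence[OF \<alpha>(2)]]) auto
    thus "\<forall>\<^sub>F N in sequentially. \<forall>x\<in>UNIV. \<forall>h. norm (h *\<^sub>R (\<Sum>n<N. \<i> * of_real \<omega> * fterm (\<alpha> - 1) x n) -
        h *\<^sub>R (\<i> * of_real \<omega> * frac_integral (\<alpha> - 1) x)) \<le> e * norm h"
    proof eventually_elim
      case (elim N)
      show ?case
      proof (intro ballI allI)
        fix x h :: real
        have "norm (h *\<^sub>R (\<Sum>n<N. \<i> * of_real \<omega> * fterm (\<alpha> - 1) x n) - h *\<^sub>R (\<i> * of_real \<omega> * frac_integral (\<alpha> - 1) x))
          = norm (h *\<^sub>R (\<i> * of_real \<omega> * ((\<Sum>n<N. fterm (\<alpha> - 1) x n) - frac_integral (\<alpha> - 1) x)))"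
          by (simp add: sum_distrib_left[symmetric] scaleR_diff_right[symmetric] right_diff_distrib[symmetric])
        also have "\<dots> = \<bar>h\<bar> * (\<omega> * norm ((\<Sum>n<N. fterm (\<alpha> - 1) x n) - frac_integral (\<alpha> - 1) x))"
          using \<omega>_pos by (simp add: norm_mult)
        also have "\<dots> \<le> \<bar>h\<bar> * (\<omega> * (e / \<omega>))"
          using elim \<omega>_pos by (intro mult_left_mono) (auto simp: dist_norm less_imp_le)
        finally show "norm (h *\<^sub>R (\<Sum>n<N. \<i> * of_real \<omega> * fterm (\<alpha> - 1) x n) - h *\<^sub>R (\<i> * of_real \<omega> * frac_integral (\<alpha> - 1) x)) \<le> e * norm h"
          using \<omega>_pos by (simp add: mult.commute)
      qed
    qed
  qed auto
  then obtain g where g: "\<And>x. (\<lambda>N. \<Sum>n<N. fterm \<alpha> x n) \<longlonglongrightarrow> g x"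
     "\<And>x. (g has_derivative (\<lambda>h. h *\<^sub>R (\<i> * of_real \<omega> * frac_integral (\<alpha> - 1) x))) (at x)" by auto
  have "g = frac_integral \<alpha>"
  proof
    fix x show "g x = frac_integral \<alpha> x"
      using tendsto_uniform_limitI[OF uniform_convergence[OF \<alpha>(1)], of x] g(1)[of x] LIMSEQ_unique by blast
  qed
  with g(2) show ?thesis by (simp add: has_vector_derivative_def)
qed

lemma derivs_upto_frac_integral:
  assumes "\<alpha> - real k > \<alpha>\<^sub>0"
  shows "derivs_upto UNIV k (frac_integral \<alpha>) (\<lambda>j x. (\<i> * of_real \<omega>) ^ j * frac_integral (\<alpha> - real j) x)"
  unfolding derivs_upto_def
proof (intro conjI allI impI ballI)
  fix j x assume j: "j < k"
  hence "\<alpha> - real j > \<alpha>\<^sub>0 + 1" using assms by simp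
  from has_vector_derivative_mult_right[OF frac_integral_derivative[OF this], of "(\<i> * of_real \<omega>) ^ j" x]
  show "((\<lambda>x. (\<i> * of_real \<omega>) ^ j * frac_integral (\<alpha> - real j) x) has_vector_derivative
     (\<i> * of_real \<omega>) ^ Suc j * frac_integral (\<alpha> - real (Suc j)) x) (at x)"
    by (simp add: mult_ac diff_diff_eq add.commute)
qed simp

theorem Ck_frac_integral:
  assumes "\<alpha> > \<alpha>\<^sub>0" "\<alpha> - \<alpha>\<^sub>0 \<notin> \<int>"
  shows "Ck UNIV (nat \<lfloor>\<alpha> - \<alpha>\<^sub>0\<rfloor>) (frac (\<alpha> - \<alpha>\<^sub>0)) (frac_integral \<alpha>)"
proof -
  define k where "k = nat \<lfloor>\<alpha> - \<alpha>\<^sub>0\<rfloor>"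
  have k: "\<alpha> - real k - \<alpha>\<^sub>0 = frac (\<alpha> - \<alpha>\<^sub>0)" using assms(1) by (simp add: k_def frac_def)
  have "frac (\<alpha> - \<alpha>\<^sub>0) > 0" "frac (\<alpha> - \<alpha>\<^sub>0) < 1" using assms(2) by (auto simp: frac_gt_0_iff frac_lt_1)
  with k have k': "\<alpha>\<^sub>0 < \<alpha> - real k" "\<alpha> - real k < \<alpha>\<^sub>0 + 1" by linarith+
  obtain C where C: "\<And>x y. norm (frac_integral (\<alpha> - real k) x - frac_integral (\<alpha> - real k) y) \<le> C * \<bar>x - y\<bar> powr (frac (\<alpha> - \<alpha>\<^sub>0))"
    using frac_integral_Holder[OF k'] unfolding k by blast
  have "Holder K (frac (\<alpha> - \<alpha>\<^sub>0)) (\<lambda>x. (\<i> * of_real \<omega>) ^ k * frac_integral (\<alpha> - real k) x)" for K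
    unfolding Holder_def
  proof (intro conjI exI ballI)
    show "continuous_on K (\<lambda>x. (\<i> * of_real \<omega>) ^ k * frac_integral (\<alpha> - real k) x)"
      by (intro continuous_intros continuous_frac_integral k')
    fix x y
    have "\<omega> ^ k * norm (frac_integral (\<alpha> - real k) x - frac_integral (\<alpha> - real k) y) \<le> \<omega> ^ k * (C * \<bar>x - y\<bar> powr (frac (\<alpha> - \<alpha>\<^sub>0)))"
      using C \<omega>_pos by (intro mult_left_mono) auto
    thus "norm ((\<i> * of_real \<omega>) ^ k * frac_integral (\<alpha> - real k) x - (\<i> * of_real \<omega>) ^ k * frac_integral (\<alpha> - real k) y)
      \<le> (\<omega> ^ k * C) * \<bar>x - y\<bar> powr (frac (\<alpha> - \<alpha>\<^sub>0))"
      using \<omega>_pos by (simp add: right_diff_distrib[symmetric] norm_mult norm_power mult_ac)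
  qed
  thus ?thesis unfolding Ck_def k_def[symmetric]
    using derivs_upto_frac_integral[OF k'(1)] continuous_frac_integral[OF assms(1)] by blast
qed

theorem Ck_log_frac_integral:
  assumes "\<alpha> > \<alpha>\<^sub>0" "\<alpha> - \<alpha>\<^sub>0 \<in> \<int>"
  shows "Ck_log UNIV (nat (\<lfloor>\<alpha> - \<alpha>\<^sub>0\<rfloor> - 1)) 1 (frac_integral \<alpha>)"
proof -
  define k where "k = nat (\<lfloor>\<alpha> - \<alpha>\<^sub>0\<rfloor> - 1)"
  obtain i where i: "\<alpha> - \<alpha>\<^sub>0 = of_int i" using assms(2) by (auto elim: Ints_cases)
  have "i \<ge> 1" using i assms(1) by linarith
  \<comment> \<open>One derivative fewer than the integer \<alpha> -
    \<open>\<alpha>\<^sub>0\<close>, so that exactly the borderline exponent is left for the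
    logarithmic estimate.\<close>
  hence k': "\<alpha> - real k = \<alpha>\<^sub>0 + 1" using i by (simp add: k_def)
  hence k'': "\<alpha> - real k > \<alpha>\<^sub>0" by simp
  obtain C where C: "\<And>x y. \<bar>x - y\<bar> \<le> 1 / 2 \<Longrightarrow>
    norm (frac_integral (\<alpha> - real k) x - frac_integral (\<alpha> - real k) y) \<le> C * \<bar>x - y\<bar> * \<bar>ln \<bar>x - y\<bar>\<bar>"
    using frac_integral_log_Lipschitz[OF k'] by blast
  have "Holder_log K 1 (\<lambda>x. (\<i> * of_real \<omega>) ^ k * frac_integral (\<alpha> - real k) x)" for K
    unfolding Holder_log_def
  proof (intro conjI exI ballI impI)
    show "continuous_on K (\<lambda>x. (\<i> * of_real \<omega>) ^ k * frac_integral (\<alpha> - real k) x)"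
      by (intro continuous_intros continuous_frac_integral k'')
    fix x y :: real assume xy: "\<bar>x - y\<bar> \<le> 1 / 2"
    have "\<omega> ^ k * norm (frac_integral (\<alpha> - real k) x - frac_integral (\<alpha> - real k) y) \<le> \<omega> ^ k * (C * \<bar>x - y\<bar> * \<bar>ln \<bar>x - y\<bar>\<bar>)"
      using C[OF xy] \<omega>_pos by (intro mult_left_mono) auto
    thus "norm ((\<i> * of_real \<omega>) ^ k * frac_integral (\<alpha> - real k) x - (\<i> * of_real \<omega>) ^ k * frac_integral (\<alpha> - real k) y)
      \<le> (\<omega> ^ k * C) * \<bar>x - y\<bar> powr 1 * \<bar>ln \<bar>x - y\<bar>\<bar>"
      using \<omega>_pos by (simp add: right_diff_distrib[symmetric] norm_mult norm_power mult_ac)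
  qed
  thus ?thesis unfolding Ck_log_def k_def[symmetric]
    using derivs_upto_frac_integral[OF k''] continuous_frac_integral[OF assms(1)] by blast
qed

end

section \<open>A one-sided periodic kernel\<close>

text \<open>Newton's binomial series with exponent -(i + 1); negating the upper index makes the
  coefficients ordinary binomials.\<close>

lemma sums_choose_power:
  fixes q :: complex
  assumes "norm q < 1"
  shows "(\<lambda>k. of_nat ((k + i) choose i) * q ^ k) sums (1 / (1 - q) ^ (i + 1))"
proof -
  have ne: "1 - q \<noteq> 0" using assms by auto
  have "(\<lambda>k. ((- of_nat (i + 1)) gchoose k) * (- q) ^ k) sums (1 + (- q)) powr (- of_nat (i + 1))"
    using assms by (intro gen_binomial_complex) auto
  moreover have "((- of_nat (i + 1)) gchoose k) * (- q) ^ k = of_nat ((k + i) choose i) * q ^ k" for k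
  proof -
    have "((- of_nat (i + 1)) gchoose k) = (-1) ^ k * ((of_nat (i + 1) + of_nat k - 1 :: complex) gchoose k)"
      by (rule gbinomial_minus)
    also have "(of_nat (i + 1) + of_nat k - 1 :: complex) = of_nat (k + i)" by simp
    also have "(of_nat (k + i) :: complex) gchoose k = of_nat ((k + i) choose k)"
      by (rule binomial_gbinomial[symmetric])
    also have "(k + i) choose k = (k + i) choose i"
      using binomial_symmetric[of k "k + i"] by simp
    finally have "((- of_nat (i + 1)) gchoose k) = (-1) ^ k * (of_nat ((k + i) choose i) :: complex)" .
    moreover have "(-1) ^ k * (- q) ^ k = q ^ k" by (simp flip: power_mult_distrib)
    ultimately show ?thesis by (metis mult.assoc mult.commute)
  qed
  moreover have "(1 + (- q)) powr (- of_nat (i + 1)) = 1 / (1 - q) ^ (i + 1)"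
    using ne powr_nat'[of "1 - q" "i + 1"] by (simp only: powr_minus) (simp add: divide_inverse)
  ultimately show ?thesis by simp
qed

text \<open>The induction trades a factor \<open>k\<close> for binomials, for which the series is explicit:
  \<open>k (k+i choose i) = (i+1) ((k+i+1 choose i+1) - (k+i choose i))\<close>.\<close>

lemma power_choose_series_bound:
  "\<exists>C\<ge>0. \<forall>q::complex. norm q < 1 \<longrightarrow> summable (\<lambda>k. of_nat (k ^ j * ((k + i) choose i)) * q ^ k) \<and>
     norm (\<Sum>k. of_nat (k ^ j * ((k + i) choose i)) * q ^ k) \<le> C / norm (1 - q) ^ (i + j + 1)"
proof (induction j arbitrary: i)
  case 0
  have "summable (\<lambda>k. of_nat (k ^ 0 * ((k + i) choose i)) * q ^ k) \<and>
     norm (\<Sum>k. of_nat (k ^ 0 * ((k + i) choose i)) * q ^ k) \<le> 1 / norm (1 - q) ^ (i + 0 + 1)"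
    if "norm q < 1" for q :: complex
    using sums_choose_power[OF that, of i] by (auto simp: sums_iff norm_divide norm_power norm_mult)
  thus ?case by (intro exI[of _ 1]) auto
next
  case (Suc j)
  define s where "s i q k = of_nat (k ^ j * ((k + i) choose i)) * q ^ k" for i k and q :: complex
  obtain C1 where "C1 \<ge> 0 \<and> (\<forall>q. norm q < 1 \<longrightarrow> summable (s i q) \<and>
      norm (\<Sum>k. s i q k) \<le> C1 / norm (1 - q) ^ (i + j + 1))"
    using Suc.IH[of i, folded s_def] by (rule exE)
  note C1 = this[THEN conjunct1] this[THEN conjunct2, rule_format, THEN conjunct1]
    this[THEN conjunct2, rule_format, THEN conjunct2]
  obtain C2 where "C2 \<ge> 0 \<and> (\<forall>q. norm q < 1 \<longrightarrow> summable (s (Suc i) q) \<and>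
      norm (\<Sum>k. s (Suc i) q k) \<le> C2 / norm (1 - q) ^ (Suc i + j + 1))"
    using Suc.IH[of "Suc i", folded s_def] by (rule exE)
  note C2 = this[THEN conjunct1] this[THEN conjunct2, rule_format, THEN conjunct1]
    this[THEN conjunct2, rule_format, THEN conjunct2]
  have eq: "of_nat (k ^ Suc j * ((k + i) choose i)) * q ^ k = of_nat (i + 1) * (s (Suc i) q k - s i q k)" for k q
  proof -
    have "k * ((k + i) choose i) + (i + 1) * ((k + i) choose i) = (i + 1) * ((k + Suc i) choose Suc i)"
    proof -
      have "k * X + (i + 1) * X = (i + 1) * Y" if "Suc i * Y = Suc (k + i) * X" for X Y :: nat
        using that by (simp add: algebra_simps)
      moreover have "Suc i * ((k + Suc i) choose Suc i) = Suc (k + i) * ((k + i) choose i)"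
        using Suc_times_binomial[of i "k + i"] by (simp only: add_Suc_right)
      ultimately show ?thesis by blast
    qed
    hence "of_nat k * of_nat ((k + i) choose i) = (of_nat (i + 1) * (of_nat ((k + Suc i) choose Suc i) - of_nat ((k + i) choose i)) :: complex)"
      unfolding right_diff_distrib eq_diff_eq of_nat_mult[symmetric] of_nat_add[symmetric] by (rule arg_cong)
    hence "(of_nat k ^ j * q ^ k) * (of_nat k * of_nat ((k + i) choose i)) = (of_nat k ^ j * q ^ k) * (of_nat (i + 1) * (of_nat ((k + Suc i) choose Suc i) - of_nat ((k + i) choose i)))"
      by (rule arg_cong)
    thus ?thesis unfolding s_def of_nat_mult of_nat_power power_Suc by (simp only: right_diff_distrib mult_ac)
  qed
  have "summable (\<lambda>k. of_nat (k ^ Suc j * ((k + i) choose i)) * q ^ k) \<and>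
     norm (\<Sum>k. of_nat (k ^ Suc j * ((k + i) choose i)) * q ^ k) \<le> (real (i + 1) * (C2 + 2 * C1)) / norm (1 - q) ^ (i + Suc j + 1)"
    if q: "norm q < 1" for q :: complex
  proof
    have sm: "summable (\<lambda>k. s (Suc i) q k - s i q k)" by (intro summable_diff C1 C2 q)
    thus "summable (\<lambda>k. of_nat (k ^ Suc j * ((k + i) choose i)) * q ^ k)" unfolding eq by (rule summable_mult)
    define d where "d = norm (1 - q)"
    have d: "0 < d" "d \<le> 2" using q norm_triangle_ineq4[of 1 q] by (auto simp: d_def)
    have "norm (\<Sum>k. of_nat (k ^ Suc j * ((k + i) choose i)) * q ^ k) = norm (of_nat (i + 1) * ((\<Sum>k. s (Suc i) q k) - (\<Sum>k. s i q k)))"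
      unfolding eq suminf_mult[OF sm] suminf_diff[OF C2(2)[OF q] C1(2)[OF q]] ..
    also have "\<dots> = real (i + 1) * norm ((\<Sum>k. s (Suc i) q k) - (\<Sum>k. s i q k))"
      by (simp only: norm_mult norm_of_nat)
    also have "\<dots> \<le> real (i + 1) * (C2 / d ^ (Suc i + j + 1) + C1 / d ^ (i + j + 1))"
      using C1(3)[OF q] C2(3)[OF q] norm_triangle_ineq4[of "\<Sum>k. s (Suc i) q k" "\<Sum>k. s i q k"]
      by (intro mult_left_mono) (auto simp: d_def)
    \<comment> \<open>The pole of lower order is brought to the common order with |1 - q| at most
      2.\<close>
    also have "C1 / d ^ (i + j + 1) = C1 * d / d ^ (Suc i + j + 1)" using d by simp
    also have "\<dots> \<le> C1 * 2 / d ^ (Suc i + j + 1)"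
      using d C1(1) by (intro divide_right_mono mult_left_mono) auto
    finally show "norm (\<Sum>k. of_nat (k ^ Suc j * ((k + i) choose i)) * q ^ k) \<le> (real (i + 1) * (C2 + 2 * C1)) / norm (1 - q) ^ (i + Suc j + 1)"
      unfolding d_def by (simp add: add_divide_distrib[symmetric] mult.commute mult_left_mono add.commute)
  qed
  thus ?case using C1(1) C2(1) by (intro exI[of _ "real (i + 1) * (C2 + 2 * C1)"]) auto
qed

lemma power_series_bound:
  obtains C where "C \<ge> 0" "\<And>q::complex. norm q < 1 \<Longrightarrow> summable (\<lambda>k. of_nat (k ^ j) * q ^ k)"
    "\<And>q::complex. norm q < 1 \<Longrightarrow> norm (\<Sum>k. of_nat (k ^ j) * q ^ k) \<le> C / norm (1 - q) ^ (j + 1)"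
  using power_choose_series_bound[of j 0] by (auto simp del: of_nat_power)

text \<open>With q = e^(-w (y + i u)), the kernel is the sum of k^j q^k. Because j is at least 1 the
  index k = 0 drops out, so constants integrate to 0 against it; the singularity as q tends to 1 has
  order j + 1.\<close>

locale power_kernel =
  fixes w :: real and j :: nat
  assumes w_pos: "w > 0" and j_pos: "j \<ge> 1"
begin

definition K :: "real \<Rightarrow> real \<Rightarrow> complex" where
  "K y u = (\<Sum>k. of_nat (k ^ j) * (of_real (exp (- (w * y))) * cis (- (w * u))) ^ k)"

lemma K_bound:
  obtains C where "C \<ge> 0"
    "\<And>y u. 0 < y \<Longrightarrow> y \<le> 1 \<Longrightarrow> \<bar>u\<bar> \<le> pi / w \<Longrightarrow> norm (K y u) \<le> C * (\<bar>u\<bar> + y) powr (- real (j + 1))"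
proof -
  obtain C where C: "C \<ge> 0" "\<And>q::complex. norm q < 1 \<Longrightarrow> norm (\<Sum>k. of_nat (k ^ j) * q ^ k) \<le> C / norm (1 - q) ^ (j + 1)"
    using power_series_bound[of j] by metis
  obtain d where d: "d > 0"
    "\<And>\<theta> s. \<bar>\<theta>\<bar> \<le> pi \<Longrightarrow> 0 \<le> s \<Longrightarrow> s \<le> w \<Longrightarrow> d * (\<bar>\<theta>\<bar> + s) \<le> norm (1 - of_real (exp (- s)) * cis \<theta>)"
    using norm_one_minus_exp_cis_ge[of w] w_pos by (metis less_imp_le)
  have "norm (K y u) \<le> (C / (d * w) ^ (j + 1)) * (\<bar>u\<bar> + y) powr (- real (j + 1))" if y: "0 < y" "y \<le> 1" and u: "\<bar>u\<bar> \<le> pi / w" for y u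
  proof -
    define q where "q = of_real (exp (- (w * y))) * cis (- (w * u))"
    have q: "norm q < 1" using y w_pos by (simp add: q_def norm_mult)
    have "d * (\<bar>- (w * u)\<bar> + w * y) \<le> norm (1 - q)"
      unfolding q_def using y u w_pos by (intro d(2)) (auto simp: abs_mult field_simps)
    moreover have "\<bar>- (w * u)\<bar> + w * y = w * (\<bar>u\<bar> + y)" using w_pos by (simp add: abs_mult algebra_simps)
    ultimately have le: "d * w * (\<bar>u\<bar> + y) \<le> norm (1 - q)" by (simp add: mult_ac)
    have pos: "d * w * (\<bar>u\<bar> + y) > 0" using d(1) w_pos y by (intro mult_pos_pos) auto
    have "norm (K y u) \<le> C / norm (1 - q) ^ (j + 1)" unfolding K_def q_def[symmetric] by (rule C(2)[OF q])
    also have "\<dots> \<le> C / (d * w * (\<bar>u\<bar> + y)) ^ (j + 1)"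
      using le pos C(1) by (intro divide_left_mono power_mono zero_less_power mult_pos_pos[of "_ ^ _" "_ ^ _"]) auto
    also have "\<dots> = (C / (d * w) ^ (j + 1)) * (1 / (\<bar>u\<bar> + y) ^ (j + 1))" by (simp add: power_mult_distrib)
    also have "1 / (\<bar>u\<bar> + y) ^ (j + 1) = (\<bar>u\<bar> + y) powr (- real (j + 1))"
      using y by (subst powr_minus, subst powr_realpow) (auto simp: inverse_eq_divide)
    finally show ?thesis .
  qed
  thus ?thesis using C(1) d(1) w_pos by (intro that[of "C / (d * w) ^ (j + 1)"]) auto
qed

lemma uniform_limit_K:
  assumes "y > 0"
  shows "uniform_limit UNIV (\<lambda>N u. \<Sum>k<N. of_nat (k ^ j) * (of_real (exp (- (w * y))) * cis (- (w * u))) ^ k) (K y) sequentially"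
  unfolding K_def
proof (rule Weierstrass_m_test)
  fix k u
  show "norm (of_nat (k ^ j) * (of_real (exp (- (w * y))) * cis (- (w * u))) ^ k) \<le> norm (of_nat (k ^ j) * of_real (exp (- (w * y))) ^ k :: complex)"
    by (simp add: norm_mult norm_power)
next
  have "norm (of_real (exp (- (w * y))) :: complex) < norm (of_real (exp (- (w * y / 2))) :: complex)"
    using assms w_pos by simp
  moreover have "summable (\<lambda>k. of_nat (k ^ j) * of_real (exp (- (w * y / 2))) ^ k :: complex)"
  proof -
    have "norm (of_real (exp (- (w * y / 2))) :: complex) < 1" using assms w_pos by simp
    thus ?thesis using power_series_bound[of j] by metis
  qed
  ultimately show "summable (\<lambda>k. norm (of_nat (k ^ j) * of_real (exp (- (w * y))) ^ k :: complex))"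
    by (intro powser_insidea)
qed

lemma continuous_K:
  assumes "y > 0"
  shows "continuous_on S (K y)"
proof -
  have "continuous_on UNIV (K y)"
    by (rule uniform_limit_theorem[OF _ uniform_limit_K[OF assms]])
       (auto intro!: always_eventually continuous_intros)
  thus ?thesis by (rule continuous_on_subset) auto
qed

lemma bounded_K:
  assumes "y > 0"
  shows "bounded (K y ` {-pi/w..pi/w})"
  by (intro compact_imp_bounded compact_continuous_image continuous_K assms) auto

text \<open>The kernel contains only the frequencies -w k with k \<ge> 0, so a mode of negative
  frequency finds no partner. This is what later annihilates the conjugated series.\<close>

lemma has_integral_cis_K:
  fixes l :: int
  assumes "y > 0"
  shows "((\<lambda>u. cis (w * of_int l * u) * K y u) has_integral
     (if l \<ge> 0 then of_real (2 * pi / w) * of_nat (nat l ^ j) * of_real (exp (- w * of_int l * y)) else 0)) {-pi/w..pi/w}"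
proof -
  define E where "E k u = of_nat (k ^ j) * (of_real (exp (- (w * y))) * cis (- (w * u))) ^ k" for k u
  define v where "v k = (of_nat (k ^ j) * of_real (exp (- w * real k * y)) :: complex)" for k
  have E_eq: "cis (w * of_int l * u) * E k u = v k * cis (w * of_int (l - int k) * u)" for k u
  proof -
    have "(of_real (exp (- (w * y))) * cis (- (w * u))) ^ k = of_real (exp (real k * - (w * y))) * cis (real k * - (w * u))"
      unfolding power_mult_distrib Complex.DeMoivre of_real_power[symmetric] exp_of_nat_mult ..
    moreover have "cis (w * of_int l * u) * cis (real k * - (w * u)) = cis (w * of_int (l - int k) * u)"
      unfolding cis_mult by (rule arg_cong[of _ _ cis]) (simp add: algebra_simps)
    ultimately show ?thesis unfolding E_def v_def by (simp add: mult_ac)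
  qed
  have "uniform_limit {-pi/w..pi/w} (\<lambda>N u. cis (w * of_int l * u) * (\<Sum>k<N. E k u)) (\<lambda>u. cis (w * of_int l * u) * K y u) sequentially"
  proof (intro uniform_lim_mult uniform_limit_const)
    show "uniform_limit {-pi/w..pi/w} (\<lambda>N u. \<Sum>k<N. E k u) (K y) sequentially"
      using uniform_limit_K[OF assms] unfolding E_def by (rule uniform_limit_on_subset) auto
    show "bounded (K y ` {-pi/w..pi/w})" by (rule bounded_K[OF assms])
    show "bounded ((\<lambda>u. cis (w * of_int l * u)) ` {-pi/w..pi/w})" by (auto simp: bounded_iff intro!: exI[of _ 1])
  qed
  \<comment> \<open>For negative l, \<open>nat l\<close> is 0 and l - 0 is not 0, so the one
    condition separates both cases.\<close>
  hence "((\<lambda>u. cis (w * of_int l * u) * K y u) has_integral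
      (if l - int (nat l) = 0 then of_real (2 * pi / w) * v (nat l) else 0)) {-pi/w..pi/w}"
    unfolding sum_distrib_left E_eq by (intro has_integral_cis_series w_pos) auto
  thus ?thesis by (auto simp: v_def mult.assoc split: if_splits)
qed

text \<open>One subtracts \<open>G(0) + G'(0) sin(wu) / w\<close> rather than the linear Taylor polynomial: it is periodic,
  and its integral against the kernel is bounded.\<close>

lemma differentiable_kernel_bound:
  fixes G :: "real \<Rightarrow> complex"
  assumes cont: "continuous_on {-pi/w..pi/w} G" and der: "(G has_vector_derivative G') (at 0)" and j: "j \<ge> 2"
    and e: "e > 0"
  obtains \<eta> where "\<eta> > 0" "\<eta> \<le> 1" "\<And>y. 0 < y \<Longrightarrow> y < \<eta> \<Longrightarrow>
     norm (integral {-pi/w..pi/w} (\<lambda>u. G u * K y u)) \<le> e * y powr (- real (j - 1))"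
proof -
  define R where "R = pi / w"
  have R: "R > 0" using w_pos by (simp add: R_def)
  have Rset: "{-pi/w..pi/w} = {-R..R}" by (simp add: R_def)
  obtain C where C: "C \<ge> 0"
    "\<And>y u. 0 < y \<Longrightarrow> y \<le> 1 \<Longrightarrow> \<bar>u\<bar> \<le> R \<Longrightarrow> norm (K y u) \<le> C * (\<bar>u\<bar> + y) powr (- real (j + 1))"
    using K_bound unfolding R_def by blast
  define r where "r u = G u - G 0 - of_real (sin (w * u) / w) * G'" for u
  have r_cont: "continuous_on {-R..R} r"
    using cont unfolding r_def Rset using w_pos by (intro continuous_intros) auto
  have "bounded (r ` {-R..R})" by (intro compact_imp_bounded compact_continuous_image r_cont) auto
  then obtain M where M: "M > 0" "\<And>u. u \<in> {-R..R} \<Longrightarrow> norm (r u) \<le> M"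
    unfolding bounded_pos by auto
  have r_der: "(r has_vector_derivative 0) (at 0)"
  proof -
    have "((\<lambda>u. sin (w * u) / w) has_real_derivative 1) (at 0)"
      using w_pos by (auto intro!: derivative_eq_intros)
    hence "((\<lambda>u. complex_of_real (sin (w * u) / w)) has_vector_derivative of_real 1) (at 0)"
      by (rule has_vector_derivative_of_real)
    from has_vector_derivative_mult_left[OF this, of G']
    have "((\<lambda>u. of_real (sin (w * u) / w) * G') has_vector_derivative G') (at 0)" by simp
    from has_vector_derivative_diff[OF has_vector_derivative_diff[OF der has_vector_derivative_const[of "G 0"]] this]
    show ?thesis unfolding r_def by simp
  qed
  \<comment> \<open>The integral of \<epsilon> C (|u| + y)^(-j) is at most 2 \<epsilon> C y^(1-j) /
    (j - 1), which this choice makes at most e / 2 times y^(1-j); C + 1 guards against C =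
    0.\<close>
  define \<epsilon> where "\<epsilon> = e * (real j - 1) / (4 * (C + 1))"
  have \<epsilon>: "\<epsilon> > 0" using e j C(1) by (simp add: \<epsilon>_def)
  have "\<exists>d>0. \<forall>u. norm (u - 0) < d \<longrightarrow> norm (r u - r 0 - (u - 0) *\<^sub>R 0) \<le> \<epsilon> * norm (u - 0)"
    using r_der \<epsilon> unfolding has_vector_derivative_def has_derivative_at_alt by blast
  then obtain d where d: "d > 0" "\<And>u. \<bar>u\<bar> < d \<Longrightarrow> norm (r u) \<le> \<epsilon> * \<bar>u\<bar>"
    by (auto simp: r_def)
  \<comment> \<open>Collects what stays bounded as y tends to 0: the part of the period away from
    the origin, where the kernel is bounded, and the integral of the sine term.\<close>
  define Q where "Q = 2 * R * (M * C * d powr (- real (j + 1))) + 2 * R * (norm G' / w)"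
  have Q: "Q \<ge> 0" using R M C w_pos by (simp add: Q_def)
  have bound: "norm (integral {-R..R} (\<lambda>u. G u * K y u)) \<le> e / 2 * y powr (- real (j - 1)) + Q" if y: "0 < y" "y \<le> 1" for y
  proof -
    have int0: "((\<lambda>u. K y u) has_integral 0) {-R..R}"
      using has_integral_cis_K[OF y(1), of 0] j_pos by (simp add: R_def power_0_left)
    define Z where "Z = of_real (2 * pi / w) * of_real (exp (- (w * y))) / (2 * \<i>)"
    have int1: "((\<lambda>u. of_real (sin (w * u)) * K y u) has_integral Z) {-R..R}"
    proof -
      have "((\<lambda>u. (cis (w * of_int 1 * u) * K y u - cis (w * of_int (-1) * u) * K y u) / (2 * \<i>)) has_integral
         ((of_real (2 * pi / w) * of_nat (nat 1 ^ j) * of_real (exp (- w * of_int 1 * y)) - 0) / (2 * \<i>))) {-R..R}"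
        using has_integral_cis_K[OF y(1), of 1] has_integral_cis_K[OF y(1), of "-1"]
        unfolding R_def by (intro has_integral_divide has_integral_diff) auto
      moreover have "(cis (w * of_int 1 * u) * K y u - cis (w * of_int (-1) * u) * K y u) / (2 * \<i>) = of_real (sin (w * u)) * K y u" for u
        by (simp add: left_diff_distrib[symmetric]) (simp add: complex_eq_iff cis.code Complex_eq)
      ultimately show ?thesis by (simp add: Z_def)
    qed
    have G_eq: "G u * K y u = r u * K y u + G 0 * K y u + (G' / of_real w) * (of_real (sin (w * u)) * K y u)" for u
      by (simp add: r_def algebra_simps)
    have rint: "(\<lambda>u. r u * K y u) integrable_on {-R..R}"
      by (intro integrable_continuous_real continuous_intros r_cont continuous_K y)
    have "((\<lambda>u. G u * K y u) has_integral (integral {-R..R} (\<lambda>u. r u * K y u) + G 0 * 0 + (G' / of_real w) * Z)) {-R..R}"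
      unfolding G_eq by (intro has_integral_add has_integral_mult_right int0 int1 integrable_integral rint)
    hence I_eq: "integral {-R..R} (\<lambda>u. G u * K y u) = integral {-R..R} (\<lambda>u. r u * K y u) + (G' / of_real w) * Z"
      by (simp add: integral_unique)
    have Zle: "norm ((G' / of_real w) * Z) \<le> 2 * R * (norm G' / w)"
    proof -
      have "norm Z = pi / w * exp (- (w * y))" using w_pos by (simp add: Z_def norm_mult norm_divide)
      also have "\<dots> \<le> pi / w * 1" using w_pos y by (intro mult_left_mono) auto
      finally have "norm Z \<le> R" by (simp add: R_def)
      hence "norm G' / w * norm Z \<le> norm G' / w * (2 * R)" using w_pos R by (intro mult_left_mono) auto
      thus ?thesis using w_pos by (simp add: norm_mult norm_divide mult_ac)
    qed
    have jeq: "1 - real j = - real (j - 1)" using j by simp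
    have "norm (integral {-R..R} (\<lambda>u. r u * K y u)) \<le> integral {-R..R} (\<lambda>u. \<epsilon> * C * (\<bar>u\<bar> + y) powr (- real j) + M * C * d powr (- real (j + 1)))"
    proof (rule Henstock_Kurzweil_Integration.integral_norm_bound_integral[OF rint])
      show "(\<lambda>u. \<epsilon> * C * (\<bar>u\<bar> + y) powr (- real j) + M * C * d powr (- real (j + 1))) integrable_on {-R..R}"
        using y by (intro integrable_continuous_real continuous_intros) auto
      fix u assume u: "u \<in> {-R..R}"
      hence u': "\<bar>u\<bar> \<le> R" by auto
      show "norm (r u * K y u) \<le> \<epsilon> * C * (\<bar>u\<bar> + y) powr (- real j) + M * C * d powr (- real (j + 1))"
      proof (cases "\<bar>u\<bar> < d")
        case True
        \<comment> \<open>Enlarging |u| to |u| + y lets the first order smallness of the remainder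
          cancel exactly one power of the kernel bound.\<close>
        have "norm (r u * K y u) \<le> (\<epsilon> * (\<bar>u\<bar> + y)) * (C * (\<bar>u\<bar> + y) powr (- real (j + 1)))"
        proof -
          have "norm (r u) \<le> \<epsilon> * (\<bar>u\<bar> + y)"
            using d(2)[OF True] \<epsilon> y by (intro order_trans[OF d(2)[OF True]] mult_left_mono) auto
          thus ?thesis unfolding norm_mult using C(2)[OF y u'] \<epsilon> y by (intro mult_mono) auto
        qed
        also have "\<dots> = \<epsilon> * C * ((\<bar>u\<bar> + y) powr 1 * (\<bar>u\<bar> + y) powr (- real (j + 1)))"
          using y by simp
        also have "(\<bar>u\<bar> + y) powr 1 * (\<bar>u\<bar> + y) powr (- real (j + 1)) = (\<bar>u\<bar> + y) powr (- real j)"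
          unfolding powr_add[symmetric] by simp
        finally show ?thesis using M(1) C(1) by (simp add: add_increasing2)
      next
        case False
        have "norm (r u * K y u) \<le> M * (C * (\<bar>u\<bar> + y) powr (- real (j + 1)))"
          unfolding norm_mult using M(1) M(2)[OF u] C(2)[OF y u'] by (intro mult_mono) auto
        also have "\<dots> \<le> M * (C * d powr (- real (j + 1)))"
          using False d(1) y M(1) C(1) by (intro mult_left_mono powr_mono2') auto
        finally show ?thesis using \<epsilon> C(1) by (simp add: add_increasing mult.assoc)
      qed
    qed
    also have "\<dots> = \<epsilon> * C * (2 * (((R + y) powr (1 - real j) - y powr (1 - real j)) / (1 - real j))) + 2 * R * (M * C * d powr (- real (j + 1)))"
    proof (rule integral_unique, rule has_integral_add)
      show "((\<lambda>u. \<epsilon> * C * (\<bar>u\<bar> + y) powr (- real j)) has_integral \<epsilon> * C * (2 * (((R + y) powr (1 - real j) - y powr (1 - real j)) / (1 - real j)))) {-R..R}"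
        using y R j by (intro has_integral_mult_right has_integral_shifted_abs_powr) auto
      show "((\<lambda>u. M * C * d powr (- real (j + 1))) has_integral 2 * R * (M * C * d powr (- real (j + 1)))) {-R..R}"
        using has_integral_const_real[of "M * C * d powr (- real (j + 1))" "-R" R] R by simp
    qed
    also have "((R + y) powr (1 - real j) - y powr (1 - real j)) / (1 - real j) \<le> y powr (1 - real j) / (real j - 1)"
    proof -
      have "((R + y) powr (1 - real j) - y powr (1 - real j)) / (1 - real j) = (y powr (1 - real j) - (R + y) powr (1 - real j)) / (real j - 1)"
        using j by (simp add: field_simps)
      also have "\<dots> \<le> y powr (1 - real j) / (real j - 1)" using j by (intro divide_right_mono) auto
      finally show ?thesis .
    qed
    also have "\<epsilon> * C * (2 * (y powr (1 - real j) / (real j - 1))) \<le> e / 2 * y powr (1 - real j)"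
    proof -
      have "\<epsilon> * C \<le> \<epsilon> * (C + 1)" using \<epsilon> by (intro mult_left_mono) auto
      also have "\<dots> = e * (real j - 1) / 4" using C(1) unfolding \<epsilon>_def by (simp add: field_simps add_nonneg_eq_0_iff)
      finally have "\<epsilon> * C * (2 * (y powr (1 - real j) / (real j - 1))) \<le> e * (real j - 1) / 4 * (2 * (y powr (1 - real j) / (real j - 1)))"
        using j by (intro mult_right_mono) auto
      also have "\<dots> = e / 2 * y powr (1 - real j)"
      proof -
        have "e * d / 4 * (2 * (Y / d)) = e / 2 * Y" if "d \<noteq> 0" for d Y :: real
          using that by simp
        moreover have "real j - 1 \<noteq> 0" using j by simp
        ultimately show ?thesis by blast
      qed
      finally show ?thesis .
    qed
    finally have "norm (integral {-R..R} (\<lambda>u. r u * K y u)) \<le> e / 2 * y powr (- real (j - 1)) + 2 * R * (M * C * d powr (- real (j + 1)))"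
      using \<epsilon> C(1) by (simp add: jeq mult_left_mono)
    thus ?thesis unfolding I_eq Q_def using Zle norm_triangle_ineq[of "integral {-R..R} (\<lambda>u. r u * K y u)" "(G' / of_real w) * Z"] by linarith
  qed
  \<comment> \<open>Below \<eta> the bounded part Q is at most e / (2 y), and 1 / y is at most
    y^(-(j-1)) because j is at least 2 and y at most 1.\<close>
  define \<eta> where "\<eta> = min 1 (e / (2 * (Q + 1)))"
  have "\<eta> > 0" "\<eta> \<le> 1" using e Q by (auto simp: \<eta>_def)
  moreover have "norm (integral {-R..R} (\<lambda>u. G u * K y u)) \<le> e * y powr (- real (j - 1))" if y: "0 < y" "y < \<eta>" for y
  proof -
    have y1: "y \<le> 1" "y < e / (2 * (Q + 1))" using y by (auto simp: \<eta>_def)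
    have "y powr (- 1) \<le> y powr (- real (j - 1))"
      using y y1 j by (intro powr_mono') auto
    hence "e / 2 * (1 / y) \<le> e / 2 * y powr (- real (j - 1))"
      using e y by (intro mult_left_mono) (auto simp: powr_minus_divide)
    moreover have "Q \<le> e / 2 * (1 / y)"
    proof -
      have "y * (2 * (Q + 1)) < e" using y1(2) Q by (simp add: field_simps)
      moreover have "y * (2 * (Q + 1)) \<ge> 2 * (Q * y)" using y Q by (simp add: algebra_simps)
      ultimately show ?thesis using y by (simp add: field_simps)
    qed
    ultimately show ?thesis using bound[OF y(1) y1(1)] by linarith
  qed
  ultimately show ?thesis by (rule that[unfolded Rset])
qed

end

section \<open>Differentiability and growth in the half-plane\<close>

context half_plane_series
begin

text \<open>Half of the exponential decay absorbs the power of the frequency; the other half is the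
  convergence already known at height t / 2.\<close>

lemma half_plane_series_weighted:
  assumes "\<beta> > 0"
  shows "half_plane_series (\<lambda>n. of_real ((real n + \<kappa>) powr \<beta>) * b n) \<kappa> \<omega>"
proof
  fix t :: real assume t: "t > 0"
  define M where "M = (\<beta> / (\<omega> * (t / 2))) powr \<beta> * exp (- (\<omega> * (t / 2)) * (\<beta> / (\<omega> * (t / 2))))"
  show "summable (\<lambda>n. norm (of_real ((real n + \<kappa>) powr \<beta>) * b n) * exp (- \<omega> * (real n + \<kappa>) * t))"
  proof (rule summable_comparison_test)
    show "summable (\<lambda>n. M * (norm (b n) * exp (- \<omega> * (real n + \<kappa>) * (t / 2))))"
      using t by (intro summable_mult summable_coeff) auto
    show "\<exists>N. \<forall>n\<ge>N. norm (norm (of_real ((real n + \<kappa>) powr \<beta>) * b n) * exp (- \<omega> * (real n + \<kappa>) * t))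
       \<le> M * (norm (b n) * exp (- \<omega> * (real n + \<kappa>) * (t / 2)))"
    proof (intro exI allI impI)
      fix n
      define \<nu> where "\<nu> = real n + \<kappa>"
      have "\<nu> powr \<beta> * exp (- (\<omega> * (t / 2)) * \<nu>) \<le> M"
        unfolding M_def using assms t \<omega>_pos \<kappa>_nonneg by (intro powr_exp_le_max) (auto simp: \<nu>_def)
      hence "(\<nu> powr \<beta> * exp (- (\<omega> * (t / 2)) * \<nu>)) * (norm (b n) * exp (- \<omega> * \<nu> * (t / 2))) \<le> M * (norm (b n) * exp (- \<omega> * \<nu> * (t / 2)))"
        by (intro mult_right_mono) auto
      moreover have "exp (- (\<omega> * (t / 2)) * \<nu>) * exp (- \<omega> * \<nu> * (t / 2)) = exp (- \<omega> * \<nu> * t)"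
        unfolding exp_add[symmetric] by (simp add: algebra_simps)
      ultimately have "\<nu> powr \<beta> * norm (b n) * exp (- \<omega> * \<nu> * t) \<le> M * (norm (b n) * exp (- \<omega> * \<nu> * (t / 2)))"
        by (metis (no_types, lifting) mult.assoc mult.left_commute)
      thus "norm (norm (of_real ((real n + \<kappa>) powr \<beta>) * b n) * exp (- \<omega> * (real n + \<kappa>) * t))
       \<le> M * (norm (b n) * exp (- \<omega> * (real n + \<kappa>) * (t / 2)))"
        by (simp add: norm_mult \<nu>_def)
    qed
  qed
qed (use \<omega>_pos \<kappa>_nonneg zero_freq in auto)

text \<open>On each mode the Gamma integral in the height produces (\<omega> \<nu>)^(-\<beta>) and
  so undoes the weight. All heights involved are at least y > 0, so a single majorant at height y
  dominates the truncations.\<close>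

lemma has_integral_weighted_H:
  assumes "\<beta> > 0" "y > 0"
  shows "((\<lambda>t. t powr (\<beta> - 1) *\<^sub>R half_plane_series.H (\<lambda>n. of_real ((real n + \<kappa>) powr \<beta>) * b n) \<kappa> \<omega> x (y + t))
           has_integral (Gamma \<beta> * \<omega> powr (- \<beta>)) *\<^sub>R H x y) {0..}"
proof -
  interpret W: half_plane_series "\<lambda>n. of_real ((real n + \<kappa>) powr \<beta>) * b n" \<kappa> \<omega>
    by (rule half_plane_series_weighted[OF assms(1)])
  define F where "F N t = t powr (\<beta> - 1) *\<^sub>R (\<Sum>n<N. W.mode x (y + t) n)" for N and t :: real
  define G where "G = Gamma \<beta> * \<omega> powr (- \<beta>)"
  have one: "((\<lambda>t. t powr (\<beta> - 1) *\<^sub>R W.mode x (y + t) n) has_integral G *\<^sub>R mode x y n) {0..}" for n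
  proof (cases "b n = 0")
    case False
    define \<nu> where "\<nu> = real n + \<kappa>"
    have \<nu>: "\<nu> > 0" using freq_pos[OF False] by (simp add: \<nu>_def)
    have "((\<lambda>t. t powr (\<beta> - 1) * exp (- (\<omega> * \<nu>) * t)) has_integral Gamma \<beta> * (\<omega> * \<nu>) powr (-\<beta>)) {0..}"
      using assms \<nu> \<omega>_pos by (intro has_integral_Gamma_scaled) auto
    hence "((\<lambda>t. (t powr (\<beta> - 1) * exp (- (\<omega> * \<nu>) * t)) *\<^sub>R (of_real (\<nu> powr \<beta>) * mode x y n)) has_integral (Gamma \<beta> * (\<omega> * \<nu>) powr (-\<beta>)) *\<^sub>R (of_real (\<nu> powr \<beta>) * mode x y n)) {0..}"
      by (rule has_integral_scaleR_left)
    moreover have "(t powr (\<beta> - 1) * exp (- (\<omega> * \<nu>) * t)) *\<^sub>R (of_real (\<nu> powr \<beta>) * mode x y n) = t powr (\<beta> - 1) *\<^sub>R W.mode x (y + t) n" for t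
    proof -
      have "exp (- \<omega> * \<nu> * (y + t)) = exp (- \<omega> * \<nu> * y) * exp (- (\<omega> * \<nu>) * t)"
        unfolding exp_add[symmetric] by (simp add: algebra_simps)
      thus ?thesis unfolding mode_def W.mode_def \<nu>_def[symmetric] by (simp add: scaleR_conv_of_real mult_ac)
    qed
    moreover have "(Gamma \<beta> * (\<omega> * \<nu>) powr (-\<beta>)) *\<^sub>R (of_real (\<nu> powr \<beta>) * mode x y n) = G *\<^sub>R mode x y n"
      using \<nu> \<omega>_pos by (simp add: G_def powr_mult powr_minus scaleR_conv_of_real field_simps)
    ultimately show ?thesis by simp
  qed (auto simp: mode_def W.mode_def)
  have F_int: "(F N has_integral G *\<^sub>R (\<Sum>n<N. mode x y n)) {0..}" for N
    unfolding F_def scaleR_sum_right by (intro has_integral_sum one) auto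
  have dom: "(\<lambda>t. W.majorant y * (t powr (\<beta> - 1) * exp (- (\<omega> * \<nu>0) * t))) integrable_on {0..}"
    using assms \<omega>_pos \<nu>0_pos
    by (intro integrable_on_mult_right has_integral_integrable[OF has_integral_Gamma_scaled]) auto
  have le: "norm (F N t) \<le> W.majorant y * (t powr (\<beta> - 1) * exp (- (\<omega> * \<nu>0) * t))" if "t \<in> {0..}" for N t
  proof -
    have "norm (\<Sum>n<N. W.mode x (y + t) n) \<le> W.majorant y * exp (- \<omega> * \<nu>0 * (y + t - y))"
      using W.norm_partial_sum_le[of y "y + t" "{..<N}" x] assms that by simp
    hence "t powr (\<beta> - 1) * norm (\<Sum>n<N. W.mode x (y + t) n) \<le> t powr (\<beta> - 1) * (W.majorant y * exp (- \<omega> * \<nu>0 * (y + t - y)))"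
      by (intro mult_left_mono) auto
    thus ?thesis by (simp add: F_def mult_ac)
  qed
  have lim: "(\<lambda>N. F N t) \<longlonglongrightarrow> t powr (\<beta> - 1) *\<^sub>R W.H x (y + t)" if "t \<in> {0..}" for t
    unfolding F_def using that assms by (intro tendsto_intros W.partial_sums_tendsto_H) auto
  have "(\<lambda>t. t powr (\<beta> - 1) *\<^sub>R W.H x (y + t)) integrable_on {0..}"
    by (rule dominated_convergence(1)[OF _ dom le lim]) (use F_int in \<open>auto simp: integrable_on_def\<close>)
  moreover have "integral {0..} (\<lambda>t. t powr (\<beta> - 1) *\<^sub>R W.H x (y + t)) = G *\<^sub>R H x y"
  proof (rule LIMSEQ_unique)
    show "(\<lambda>N. integral {0..} (F N)) \<longlonglongrightarrow> integral {0..} (\<lambda>t. t powr (\<beta> - 1) *\<^sub>R W.H x (y + t))"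
      by (rule dominated_convergence(2)[OF _ dom le lim]) (use F_int in \<open>auto simp: integrable_on_def\<close>)
    show "(\<lambda>N. integral {0..} (F N)) \<longlonglongrightarrow> G *\<^sub>R H x y"
      unfolding integral_unique[OF F_int] using assms by (intro tendsto_intros partial_sums_tendsto_H)
  qed
  ultimately show ?thesis by (simp add: has_integral_iff G_def)
qed

text \<open>The assumed bound at height y + t is integrated against t^(\<beta>-1). The range t \<le>
  y yields y^(-\<gamma>) / \<beta> and the range above it y^(-\<gamma>) / \<gamma>, whence the sum 1
  / \<beta> + 1 / \<gamma> in \<epsilon>; heights beyond \<eta> contribute a bounded amount, which
  y^\<gamma> sends to 0.\<close>

lemma small_growth_from_weighted:
  assumes \<beta>: "\<beta> > 0" and \<gamma>: "\<gamma> > 0"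
    and small: "\<And>e. e > 0 \<Longrightarrow> \<exists>\<eta>>0. \<forall>s. 0 < s \<and> s < \<eta> \<longrightarrow>
       norm (half_plane_series.H (\<lambda>n. of_real ((real n + \<kappa>) powr \<beta>) * b n) \<kappa> \<omega> x s) \<le> e * s powr (- (\<beta> + \<gamma>))"
  shows "((\<lambda>t. t powr \<gamma> * norm (H x t)) \<longlongrightarrow> 0) (at_right 0)"
proof (rule tendsto_0_at_right_0I)
  interpret W: half_plane_series "\<lambda>n. of_real ((real n + \<kappa>) powr \<beta>) * b n" \<kappa> \<omega>
    by (rule half_plane_series_weighted[OF \<beta>])
  define G where "G = Gamma \<beta> * \<omega> powr (- \<beta>)"
  have G: "G > 0" using \<beta> \<omega>_pos by (simp add: G_def Gamma_real_pos)
  fix e :: real assume e: "e > 0"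
  define \<epsilon> where "\<epsilon> = e * G / (2 * (1 / \<beta> + 1 / \<gamma>))"
  have bg: "1 / \<beta> + 1 / \<gamma> > 0" using \<beta> \<gamma> by (intro add_pos_pos) auto
  have \<epsilon>: "\<epsilon> > 0" using e G bg by (simp add: \<epsilon>_def)
  have \<epsilon>_eq: "\<epsilon> * (1 / \<beta> + 1 / \<gamma>) = e * G / 2"
  proof -
    have "e * G / (2 * d) * d = e * G / 2" if "d > 0" for d using that by simp
    from this[OF bg] show ?thesis by (simp only: \<epsilon>_def)
  qed
  obtain \<eta> where \<eta>: "\<eta> > 0" "\<And>s. 0 < s \<Longrightarrow> s < \<eta> \<Longrightarrow> norm (W.H x s) \<le> \<epsilon> * s powr (- (\<beta> + \<gamma>))"
    using small[OF \<epsilon>] by blast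
  define M where "M = W.majorant \<eta> * exp (\<omega> * \<nu>0 * \<eta>)"
  have M: "M \<ge> 0" using W.majorant_nonneg[OF \<eta>(1)] by (simp add: M_def)
  define Q where "Q = M * (Gamma \<beta> * (\<omega> * \<nu>0) powr (- \<beta>))"
  have Q: "Q \<ge> 0" unfolding Q_def using M \<beta> Gamma_real_pos[of \<beta>] by simp
  have main: "G * (y powr \<gamma> * norm (H x y)) \<le> e * G / 2 + y powr \<gamma> * Q" if y: "y > 0" for y
  proof -
    define D1 where "D1 t = (if t \<in> {0..y} then \<epsilon> * y powr (- (\<beta> + \<gamma>)) * t powr (\<beta> - 1) else 0)" for t
    define D2 where "D2 t = (if t \<in> {y..} then \<epsilon> * t powr (- \<gamma> - 1) else 0)" for t
    define D3 where "D3 t = M * (t powr (\<beta> - 1) * exp (- (\<omega> * \<nu>0) * t))" for t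
    have 1: "(D1 has_integral \<epsilon> * y powr (- (\<beta> + \<gamma>)) * (y powr \<beta> / \<beta>)) {0..}"
      unfolding D1_def using y \<beta> by (intro has_integral_powr_initial) auto
    have 2: "(D2 has_integral \<epsilon> * (y powr (- \<gamma>) / - (- \<gamma>))) {0..}"
      unfolding D2_def using y \<gamma> by (intro has_integral_powr_tail) auto
    have 3: "(D3 has_integral Q) {0..}"
      unfolding D3_def Q_def using \<beta> \<omega>_pos \<nu>0_pos
      by (intro has_integral_mult_right has_integral_Gamma_scaled) auto
    note D = has_integral_add[OF has_integral_add[OF 1 2] 3]
    note I = has_integral_weighted_H[OF \<beta> y, of x, folded G_def]
    have D_nonneg: "D1 t \<ge> 0" "D2 t \<ge> 0" "D3 t \<ge> 0" for t
      using \<epsilon> M by (auto simp: D1_def D2_def D3_def)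
    have "norm (integral {0..} (\<lambda>t. t powr (\<beta> - 1) *\<^sub>R W.H x (y + t))) \<le> integral {0..} (\<lambda>t. D1 t + D2 t + D3 t)"
    proof (rule Henstock_Kurzweil_Integration.integral_norm_bound_integral)
      show "(\<lambda>t. t powr (\<beta> - 1) *\<^sub>R W.H x (y + t)) integrable_on {0..}" using I by (rule has_integral_integrable)
      show "(\<lambda>t. D1 t + D2 t + D3 t) integrable_on {0..}" using D by (rule has_integral_integrable)
      fix t :: real assume t: "t \<in> {0..}"
      show "norm (t powr (\<beta> - 1) *\<^sub>R W.H x (y + t)) \<le> D1 t + D2 t + D3 t"
      proof (cases "y + t < \<eta>")
        case True
        have *: "norm (t powr (\<beta> - 1) *\<^sub>R W.H x (y + t)) \<le> t powr (\<beta> - 1) * (\<epsilon> * (y + t) powr (- (\<beta> + \<gamma>)))"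
          using \<eta>(2)[of "y + t"] True y t by (simp add: mult_left_mono)
        show ?thesis
        proof (cases "t \<le> y")
          case True
          have "t powr (\<beta> - 1) * (\<epsilon> * (y + t) powr (- (\<beta> + \<gamma>))) \<le> t powr (\<beta> - 1) * (\<epsilon> * y powr (- (\<beta> + \<gamma>)))"
            using y t \<beta> \<gamma> \<epsilon> by (intro mult_left_mono powr_mono2') auto
          also have "\<dots> = D1 t" using True t by (simp add: D1_def mult_ac)
          finally show ?thesis using * D_nonneg[of t] by linarith
        next
          case False
          have "t powr (\<beta> - 1) * (\<epsilon> * (y + t) powr (- (\<beta> + \<gamma>))) \<le> t powr (\<beta> - 1) * (\<epsilon> * t powr (- (\<beta> + \<gamma>)))"
            using y t \<beta> \<gamma> \<epsilon> False by (intro mult_left_mono powr_mono2') auto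
          also have "\<dots> = \<epsilon> * t powr ((\<beta> - 1) + (- (\<beta> + \<gamma>)))" unfolding powr_add by (simp add: mult_ac)
          also have "(\<beta> - 1) + (- (\<beta> + \<gamma>)) = - \<gamma> - 1" by simp
          also have "\<epsilon> * t powr (- \<gamma> - 1) = D2 t" using False by (simp add: D2_def)
          finally show ?thesis using * D_nonneg[of t] by linarith
        qed
      next
        case False
        have "norm (W.H x (y + t)) \<le> W.majorant \<eta> * exp (- \<omega> * \<nu>0 * (y + t - \<eta>))"
          using W.norm_H_le[of \<eta> "y + t" x] False \<eta>(1) by simp
        also have "\<dots> \<le> W.majorant \<eta> * exp (- \<omega> * \<nu>0 * (t - \<eta>))"
          using y \<omega>_pos \<nu>0_pos W.majorant_nonneg[OF \<eta>(1)] by (intro mult_left_mono) auto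
        also have "\<dots> = M * exp (- (\<omega> * \<nu>0) * t)" unfolding exp_shift M_def by simp
        finally have "t powr (\<beta> - 1) * norm (W.H x (y + t)) \<le> t powr (\<beta> - 1) * (M * exp (- (\<omega> * \<nu>0) * t))"
          by (intro mult_left_mono) auto
        also have "\<dots> = D3 t" by (simp add: D3_def mult_ac)
        finally show ?thesis using D_nonneg[of t] by simp
      qed
    qed
    hence "G * norm (H x y) \<le> \<epsilon> * y powr (- (\<beta> + \<gamma>)) * (y powr \<beta> / \<beta>) + \<epsilon> * (y powr (- \<gamma>) / - (- \<gamma>)) + Q"
      unfolding integral_unique[OF I] integral_unique[OF D] using G by simp
    also have "\<dots> = \<epsilon> * (1 / \<beta> + 1 / \<gamma>) * y powr (- \<gamma>) + Q"
    proof -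
      have "y powr (- (\<beta> + \<gamma>)) * y powr \<beta> = y powr (- \<gamma>)" unfolding powr_add[symmetric] by simp
      hence "\<epsilon> * y powr (- (\<beta> + \<gamma>)) * (y powr \<beta> / \<beta>) = \<epsilon> * (y powr (- \<gamma>) / \<beta>)"
        by (simp add: mult.assoc)
      thus ?thesis by (simp add: algebra_simps)
    qed
    finally have "y powr \<gamma> * (G * norm (H x y)) \<le> y powr \<gamma> * (\<epsilon> * (1 / \<beta> + 1 / \<gamma>) * y powr (- \<gamma>) + Q)"
      by (intro mult_left_mono) auto
    also have "\<dots> = \<epsilon> * (1 / \<beta> + 1 / \<gamma>) * (y powr \<gamma> * y powr (- \<gamma>)) + y powr \<gamma> * Q"
      by (simp add: algebra_simps)
    also have "y powr \<gamma> * y powr (- \<gamma>) = 1" using y by (simp add: powr_add[symmetric])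
    finally show ?thesis unfolding \<epsilon>_eq by (simp add: mult_ac)
  qed
  have "\<forall>\<^sub>F y in at_right 0. y powr \<gamma> * Q < e * G / 2"
    using e G \<gamma> by (intro order_tendstoD(2)[OF powr_tendsto_0_at_right_0]) auto
  then obtain d where d: "d > 0" "\<And>y. 0 < y \<Longrightarrow> y < d \<Longrightarrow> y powr \<gamma> * Q < e * G / 2"
    unfolding eventually_at_right_field by auto
  have "y powr \<gamma> * norm (H x y) < e" if "0 < y" "y < d" for y
  proof -
    have "G * (y powr \<gamma> * norm (H x y)) < G * e"
      using main[OF that(1)] d(2)[OF that] by (simp add: mult.commute[of e])
    thus ?thesis using G by simp
  qed
  thus "\<exists>d>0. \<forall>y. 0 < y \<and> y < d \<longrightarrow> y powr \<gamma> * norm (H x y) < e" using d(1) by blast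
qed auto

end

context half_plane_series_growth
begin

text \<open>The kernel annihilates the conjugate of the fractional integral, so the combination below
  treats \<open>f\<^sub>\<alpha>\<close> together with its real and imaginary parts.\<close>

theorem differentiable_imp_small_growth:
  fixes P Q :: complex and qd p :: nat
  assumes \<alpha>: "\<alpha>\<^sub>0 < \<alpha>" "\<alpha> \<le> \<alpha>\<^sub>0 + 1"
    and \<kappa>: "qd > 0" "\<kappa> * real qd = real p"
    and P: "P \<noteq> 0"
    and der: "((\<lambda>u. P * frac_integral \<alpha> u + Q * cnj (frac_integral \<alpha> u)) has_vector_derivative G') (at x)"
  shows "((\<lambda>t. t powr \<alpha>\<^sub>0 * norm (H x t)) \<longlongrightarrow> 0) (at_right 0)"
proof -
  \<comment> \<open>Above \<alpha>, so that the leftover weight \<beta> is positive, and at least 2,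
    as the kernel estimate requires.\<close>
  define j where "j = nat \<lceil>\<alpha>\<rceil> + 2"
  have j: "j \<ge> 2" "real j > \<alpha>" unfolding j_def by linarith+
  define \<beta> where "\<beta> = real j - \<alpha>"
  have \<beta>: "\<beta> > 0" using j by (simp add: \<beta>_def)
  interpret W: half_plane_series "\<lambda>n. of_real ((real n + \<kappa>) powr \<beta>) * b n" \<kappa> \<omega>
    by (rule half_plane_series_weighted[OF \<beta>])
  \<comment> \<open>With \<kappa> = p / qd every frequency \<omega> (n + \<kappa>) is the integer
    multiple \<open>k n\<close> of w, so the fractional integral has period 2 pi / w and the kernel
    with base frequency w applies.\<close>
  define w where "w = \<omega> / real qd"
  have w: "w > 0" using \<omega>_pos \<kappa> by (simp add: w_def)
  interpret power_kernel w j by unfold_locales (use w j in auto)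
  define k where "k n = n * qd + p" for n
  have k_eq: "\<omega> * (real n + \<kappa>) = w * real (k n)" "real (k n) = real qd * (real n + \<kappa>)" for n
  proof -
    show 2: "real (k n) = real qd * (real n + \<kappa>)" using \<kappa> by (simp add: k_def algebra_simps)
    show "\<omega> * (real n + \<kappa>) = w * real (k n)" unfolding 2 using \<kappa> by (simp add: w_def)
  qed
  have k_pos: "k n > 0" if "b n \<noteq> 0" for n
  proof -
    have "real (k n) > 0" unfolding k_eq(2) using freq_pos[OF that] \<kappa> by simp
    thus ?thesis by simp
  qed
  define G where "G u = P * frac_integral \<alpha> (x + u) + Q * cnj (frac_integral \<alpha> (x + u))" for u
  have G_cont: "continuous_on S G" for S
  proof -
    have "continuous_on S (\<lambda>u. frac_integral \<alpha> (x + u))"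
      by (rule continuous_on_compose2[OF continuous_frac_integral[OF \<alpha>(1), of UNIV]]) (auto intro!: continuous_intros)
    thus ?thesis unfolding G_def by (intro continuous_intros)
  qed
  have G_der: "(G has_vector_derivative G') (at 0)"
  proof -
    have "((\<lambda>u. P * frac_integral \<alpha> u + Q * cnj (frac_integral \<alpha> u)) \<circ> (\<lambda>u. x + u) has_vector_derivative 1 *\<^sub>R G') (at 0)"
      by (rule vector_diff_chain_at) (use der in \<open>auto intro!: derivative_eq_intros\<close>)
    moreover have "G = (\<lambda>u. P * frac_integral \<alpha> u + Q * cnj (frac_integral \<alpha> u)) \<circ> (\<lambda>u. x + u)"
      by (simp add: fun_eq_iff G_def)
    ultimately show ?thesis by simp
  qed
  define R where "R = pi / w"
  have R: "R > 0" using w by (simp add: R_def)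
  have T: "integral {-pi/w..pi/w} (\<lambda>u. G u * K y u) = of_real (2 * R) * P * (of_real (real qd ^ j) * W.H x y)" if y: "y > 0" for y
  proof -
    define g where "g N u = P * (\<Sum>n<N. fterm \<alpha> (x + u) n) + Q * cnj (\<Sum>n<N. fterm \<alpha> (x + u) n)" for N u
    have f_eq: "fterm \<alpha> (x + u) n = fterm \<alpha> x n * cis (w * of_int (int (k n)) * u)" for n u
      using k_eq(1)[of n] unfolding fterm_def by (simp add: algebra_simps cis_mult)
    have ul: "uniform_limit {-pi/w..pi/w} (\<lambda>N u. g N u * K y u) (\<lambda>u. G u * K y u) sequentially"
    proof (intro uniform_lim_mult uniform_limit_const bounded_K y)
      have 1: "uniform_limit {-pi/w..pi/w} (\<lambda>N u. \<Sum>n<N. fterm \<alpha> (x + u) n) (\<lambda>u. frac_integral \<alpha> (x + u)) sequentially"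
        using uniform_convergence[OF \<alpha>(1)] unfolding uniform_limit_iff by (auto elim!: eventually_mono)
      have 2: "uniform_limit {-pi/w..pi/w} (\<lambda>N u. cnj (\<Sum>n<N. fterm \<alpha> (x + u) n)) (\<lambda>u. cnj (frac_integral \<alpha> (x + u))) sequentially"
        using bounded_linear.uniform_limit[OF bounded_linear_cnj 1] .
      show "uniform_limit {-pi/w..pi/w} g G sequentially"
        unfolding g_def G_def
        by (intro uniform_limit_add bounded_linear.uniform_limit[OF bounded_linear_mult_right] 1 2)
      show "bounded (G ` {-pi/w..pi/w})"
        by (intro compact_imp_bounded compact_continuous_image G_cont) auto
    qed
    have gc: "continuous_on {-pi/w..pi/w} (\<lambda>u. g N u * K y u)" for N
      unfolding g_def fterm_def by (intro continuous_intros continuous_K y)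
    obtain I J where I: "\<And>N. ((\<lambda>u. g N u * K y u) has_integral I N) {-pi/w..pi/w}"
      and J: "((\<lambda>u. G u * K y u) has_integral J) {-pi/w..pi/w}" and IJ: "I \<longlonglongrightarrow> J"
      using uniform_limit_integral[OF ul gc] by auto
    have single: "((\<lambda>u. (P * fterm \<alpha> (x + u) n + Q * cnj (fterm \<alpha> (x + u) n)) * K y u) has_integral
        of_real (2 * R) * P * (of_real (real qd ^ j) * W.mode x y n)) {-pi/w..pi/w}" for n
    proof (cases "b n = 0")
      case False
      define \<nu> where "\<nu> = real n + \<kappa>"
      have \<nu>: "\<nu> > 0" using freq_pos[OF False] by (simp add: \<nu>_def)
      have "((\<lambda>u. P * fterm \<alpha> x n * (cis (w * of_int (int (k n)) * u) * K y u) + Q * cnj (fterm \<alpha> x n) * (cis (w * of_int (- int (k n)) * u) * K y u)) has_integral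
        P * fterm \<alpha> x n * (of_real (2 * pi / w) * of_nat (nat (int (k n)) ^ j) * of_real (exp (- w * of_int (int (k n)) * y))) + Q * cnj (fterm \<alpha> x n) * 0) {-pi/w..pi/w}"
        using has_integral_cis_K[OF y, of "int (k n)"] has_integral_cis_K[OF y, of "- int (k n)"] k_pos[OF False]
        by (intro has_integral_add has_integral_mult_right) auto
      moreover have "P * fterm \<alpha> x n * (cis (w * of_int (int (k n)) * u) * K y u) + Q * cnj (fterm \<alpha> x n) * (cis (w * of_int (- int (k n)) * u) * K y u)
         = (P * fterm \<alpha> (x + u) n + Q * cnj (fterm \<alpha> (x + u) n)) * K y u" for u
        unfolding f_eq by (simp add: cis_cnj algebra_simps)
      \<comment> \<open>The multiplier (k n)^j equals qd^j \<nu>^j and turns \<nu>^(-\<alpha>) into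
        \<nu>^\<beta>, so the result is a mode of the weighted series at height y.\<close>
      moreover have "fterm \<alpha> x n * (of_nat (k n ^ j) * of_real (exp (- w * real (k n) * y))) = of_real (real qd ^ j) * W.mode x y n"
      proof -
        have f1: "of_nat (k n ^ j) = complex_of_real (real qd ^ j * \<nu> ^ j)"
        proof -
          have "of_nat (k n ^ j) = complex_of_real (real (k n) ^ j)" by simp
          also have "real (k n) ^ j = real qd ^ j * \<nu> ^ j" by (simp only: k_eq(2) \<nu>_def power_mult_distrib)
          finally show ?thesis .
        qed
        have f2: "\<nu> ^ j * \<nu> powr (- \<alpha>) = \<nu> powr \<beta>"
        proof -
          have "\<nu> ^ j = \<nu> powr real j" using \<nu> by (simp add: powr_realpow)
          thus ?thesis by (simp only: powr_add[symmetric]) (simp add: \<beta>_def)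
        qed
        have f3: "- w * real (k n) * y = - \<omega> * \<nu> * y" using k_eq(1)[of n] by (simp add: \<nu>_def)
        have f4: "fterm \<alpha> x n = b n * of_real (\<nu> powr (- \<alpha>)) * cis (\<omega> * \<nu> * x)"
          by (simp add: fterm_def \<nu>_def)
        have f5: "W.mode x y n = of_real (\<nu> powr \<beta>) * b n * of_real (exp (- \<omega> * \<nu> * y)) * cis (\<omega> * \<nu> * x)"
          by (simp add: W.mode_def \<nu>_def)
        show ?thesis unfolding f1 f3 f4 f5 f2[symmetric] by (simp only: of_real_mult mult_ac)
      qed
      ultimately show ?thesis by (simp add: R_def mult_ac)
    qed (auto simp: fterm_def W.mode_def)
    have "((\<lambda>u. g N u * K y u) has_integral (\<Sum>n<N. of_real (2 * R) * P * (of_real (real qd ^ j) * W.mode x y n))) {-pi/w..pi/w}" for N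
    proof -
      have "g N u * K y u = (\<Sum>n<N. (P * fterm \<alpha> (x + u) n + Q * cnj (fterm \<alpha> (x + u) n)) * K y u)" for u
        unfolding g_def by (simp add: sum_distrib_left sum_distrib_right sum.distrib cnj_sum algebra_simps)
      thus ?thesis by (simp only:) (intro has_integral_sum single, auto)
    qed
    hence "I N = of_real (2 * R) * P * (of_real (real qd ^ j) * (\<Sum>n<N. W.mode x y n))" for N
      using has_integral_unique[OF I] by (simp add: sum_distrib_left)
    hence "I = (\<lambda>N. of_real (2 * R) * P * (of_real (real qd ^ j) * (\<Sum>n<N. W.mode x y n)))" by auto
    hence "I \<longlonglongrightarrow> of_real (2 * R) * P * (of_real (real qd ^ j) * W.H x y)"
      using W.partial_sums_tendsto_H[OF y] by (auto intro!: tendsto_intros)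
    with IJ have "J = of_real (2 * R) * P * (of_real (real qd ^ j) * W.H x y)" using LIMSEQ_unique by blast
    with J show ?thesis by (simp add: integral_unique)
  qed
  show ?thesis
  proof (rule small_growth_from_weighted[OF \<beta> \<alpha>\<^sub>0_pos])
    fix e :: real assume e: "e > 0"
    define c where "c = 2 * R * norm P * real qd ^ j"
    have c: "c > 0" using R P \<kappa> by (simp add: c_def)
    obtain \<eta> where \<eta>: "\<eta> > 0" "\<eta> \<le> 1" "\<And>y. 0 < y \<Longrightarrow> y < \<eta> \<Longrightarrow>
       norm (integral {-pi/w..pi/w} (\<lambda>u. G u * K y u)) \<le> (e * c) * y powr (- real (j - 1))"
      using differentiable_kernel_bound[OF G_cont G_der j(1), of "e * c"] e c by auto
    have "norm (W.H x s) \<le> e * s powr (- (\<beta> + \<alpha>\<^sub>0))" if s: "0 < s" "s < \<eta>" for s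
    proof -
      have "c * norm (W.H x s) \<le> (e * c) * s powr (- real (j - 1))"
        using \<eta>(3)[OF s] R unfolding T[OF s(1)] by (simp add: norm_mult c_def norm_power mult_ac)
      hence "norm (W.H x s) \<le> e * s powr (- real (j - 1))" using c by simp
      \<comment> \<open>Here \<alpha> \<le> \<open>\<alpha>\<^sub>0\<close> + 1 enters: it says j -
        1 \<le> \<beta> + \<open>\<alpha>\<^sub>0\<close>, and s < 1.\<close>
      also have "\<dots> \<le> e * s powr (- (\<beta> + \<alpha>\<^sub>0))"
        using s \<eta>(2) e j \<alpha> by (intro mult_left_mono powr_mono') (auto simp: \<beta>_def)
      finally show ?thesis .
    qed
    thus "\<exists>\<eta>>0. \<forall>s. 0 < s \<and> s < \<eta> \<longrightarrow> norm (W.H x s) \<le> e * s powr (- (\<beta> + \<alpha>\<^sub>0))"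
      using \<eta>(1) by blast
  qed
qed

end

section \<open>The modular group\<close>

lemma jfac_nonzero:
  assumes "g \<in> SL2Z" "Im z > 0"
  shows "jfac g z \<noteq> 0"
proof
  obtain a b c d where g: "g = (a,b,c,d)" by (cases g) auto
  assume "jfac g z = 0"
  hence "of_int c * z + of_int d = 0" by (simp add: g)
  hence "of_int c * Im z = 0" "of_int c * Re z + of_int d = 0" by (auto simp: complex_eq_iff)
  thus False using assms by (auto simp: g SL2Z_def)
qed

lemma mmul_SL2Z:
  assumes "g \<in> SL2Z" "h \<in> SL2Z"
  shows "mmul g h \<in> SL2Z"
proof -
  obtain a b c d where g: "g = (a,b,c,d)" by (cases g) auto
  obtain a' b' c' d' where h: "h = (a',b',c',d')" by (cases h) auto
  have "(a*a'+b*c') * (c*b'+d*d') - (a*b'+b*d') * (c*a'+d*c') = (a*d - b*c) * (a'*d' - b'*c')"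
    by (simp add: algebra_simps)
  also have "\<dots> = 1" using assms by (simp add: g h SL2Z_def)
  finally show ?thesis by (simp add: g h SL2Z_def)
qed

lemma minv_SL2Z: "g \<in> SL2Z \<Longrightarrow> minv g \<in> SL2Z"
  by (cases g) (auto simp: SL2Z_def algebra_simps)

lemma mmul_assoc: "mmul (mmul g h) k = mmul g (mmul h k)"
  by (cases g; cases h; cases k) (auto simp: algebra_simps)

lemma minv_left: "g \<in> SL2Z \<Longrightarrow> mmul (minv g) g = (1,0,0,1)"
  by (cases g) (auto simp: SL2Z_def algebra_simps)

lemma minv_right: "g \<in> SL2Z \<Longrightarrow> mmul g (minv g) = (1,0,0,1)"
  by (cases g) (auto simp: SL2Z_def algebra_simps)

lemma mmul_id [simp]: "mmul g (1,0,0,1) = g" "mmul (1,0,0,1) g = g"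
  by (cases g; simp)+

lemma minv_minv [simp]: "minv (minv g) = g"
  by (cases g) auto

lemma Im_moeb:
  assumes "g \<in> SL2Z" "Im z > 0"
  shows "Im (moeb g z) = Im z / (norm (jfac g z))\<^sup>2"
proof -
  obtain a b c d where g: "g = (a,b,c,d)" by (cases g) auto
  have "a * d - b * c = 1" using assms by (simp add: g SL2Z_def)
  hence det: "real_of_int a * of_int d - of_int b * of_int c = 1" by (metis of_int_1 of_int_diff of_int_mult)
  have "Im (moeb g z) = (real_of_int a * of_int d - of_int b * of_int c) * Im z / (norm (jfac g z))\<^sup>2"
    unfolding cmod_power2 g by (simp add: Im_divide) (simp add: algebra_simps)
  thus ?thesis unfolding det by simp
qed

lemma Im_moeb_pos: "g \<in> SL2Z \<Longrightarrow> Im z > 0 \<Longrightarrow> Im (moeb g z) > 0"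
  using jfac_nonzero[of g z] by (simp add: Im_moeb)

lemma jfac_mmul:
  assumes "h \<in> SL2Z" "Im z > 0"
  shows "jfac (mmul g h) z = jfac g (moeb h z) * jfac h z"
proof -
  obtain a b c d where g: "g = (a,b,c,d)" by (cases g) auto
  obtain a' b' c' d' where h: "h = (a',b',c',d')" by (cases h) auto
  have "of_int c' * z + of_int d' \<noteq> 0" using jfac_nonzero[OF assms] by (simp add: h)
  thus ?thesis by (simp add: g h field_simps)
qed

lemma moeb_mmul:
  assumes "g \<in> SL2Z" "h \<in> SL2Z" "Im z > 0"
  shows "moeb (mmul g h) z = moeb g (moeb h z)"
proof -
  obtain a b c d where g: "g = (a,b,c,d)" by (cases g) auto
  obtain a' b' c' d' where h: "h = (a',b',c',d')" by (cases h) auto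
  have nz: "of_int c' * z + of_int d' \<noteq> 0" using jfac_nonzero[OF assms(2,3)] by (simp add: h)
  have num: "of_int a * moeb h z + of_int b = (of_int (a*a'+b*c') * z + of_int (a*b'+b*d')) / (of_int c' * z + of_int d')"
    using nz by (simp add: h field_simps)
  have den: "of_int c * moeb h z + of_int d = (of_int (c*a'+d*c') * z + of_int (c*b'+d*d')) / (of_int c' * z + of_int d')"
    using nz by (simp add: h field_simps)
  have "moeb g (moeb h z) = (of_int a * moeb h z + of_int b) / (of_int c * moeb h z + of_int d)"
    by (simp only: g moeb.simps)
  also have "\<dots> = (of_int (a*a'+b*c') * z + of_int (a*b'+b*d')) / (of_int (c*a'+d*c') * z + of_int (c*b'+d*d'))"
    unfolding num den using nz by simp
  finally show ?thesis by (simp only: g h mmul.simps moeb.simps)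
qed

lemma norm_jfac_inverse:
  assumes "g \<in> SL2Z" "Im z > 0"
  shows "norm (jfac (minv g) (moeb g z)) = 1 / norm (jfac g z)"
proof -
  have "jfac (mmul (minv g) g) z = jfac (minv g) (moeb g z) * jfac g z" by (rule jfac_mmul[OF assms])
  hence "norm (jfac (minv g) (moeb g z)) * norm (jfac g z) = 1"
    using assms by (simp add: minv_left norm_mult[symmetric])
  thus ?thesis using jfac_nonzero[OF assms] by (simp add: field_simps)
qed

text \<open>The parabolic elements fixing \<^term>\<open>p / q\<close>; they are \<open>\<gamma> T\<^sup>t \<gamma>\<inverse>\<close>
  for any \<open>\<gamma>\<close> with first column \<open>(p, q)\<close>.\<close>

definition parab :: "int \<Rightarrow> int \<Rightarrow> int \<Rightarrow> mat2" where
  "parab p q t = (1 - p * q * t, p\<^sup>2 * t, - (q\<^sup>2 * t), 1 + p * q * t)"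

lemma parab_SL2Z: "parab p q t \<in> SL2Z"
  by (simp add: parab_def SL2Z_def algebra_simps power2_eq_square)

lemma parab_add: "mmul (parab p q s) (parab p q t) = parab p q (s + t)"
  by (simp add: parab_def algebra_simps power2_eq_square)

lemma minv_parab: "minv (parab p q t) = parab p q (- t)"
  by (simp add: parab_def)

lemma conj_translation:
  assumes "(a,b,c,d) \<in> SL2Z"
  shows "mmul (mmul (a,b,c,d) (1, t, 0, 1)) (minv (a,b,c,d)) = parab a c t"
proof -
  have "a * d = 1 + b * c" using assms by (simp add: SL2Z_def)
  hence "a * d = 1 + b * c" "d * a = 1 + b * c" by (auto simp: mult.commute)
  thus ?thesis by (simp add: parab_def power2_eq_square algebra_simps)
qed

section \<open>Finite index: parabolic elements, coset representatives and cusp widths\<close>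

locale finite_index =
  fixes \<Gamma> :: "mat2 set"
  assumes finite_index: "finite_index_subgroup \<Gamma>"
begin

lemma sub: "\<Gamma> \<subseteq> SL2Z" and one: "(1,0,0,1) \<in> \<Gamma>"
  and mult: "\<And>g h. g \<in> \<Gamma> \<Longrightarrow> h \<in> \<Gamma> \<Longrightarrow> mmul g h \<in> \<Gamma>"
  and inv: "\<And>g. g \<in> \<Gamma> \<Longrightarrow> minv g \<in> \<Gamma>"
  and cosets: "finite {(\<lambda>h. mmul g h) ` \<Gamma> | g. g \<in> SL2Z}"
  using finite_index by (auto simp: finite_index_subgroup_def)

lemma same_coset:
  assumes "g \<in> SL2Z" "(\<lambda>h. mmul g h) ` \<Gamma> = (\<lambda>h. mmul g' h) ` \<Gamma>"
  shows "mmul (minv g) g' \<in> \<Gamma>"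
proof -
  have "mmul g' (1,0,0,1) \<in> (\<lambda>h. mmul g' h) ` \<Gamma>" using one by (rule imageI)
  hence "g' \<in> (\<lambda>h. mmul g h) ` \<Gamma>" unfolding assms(2) by (simp only: mmul_id)
  then obtain h where h: "h \<in> \<Gamma>" "g' = mmul g h" by (rule imageE)
  have "mmul (minv g) g' = h" using assms(1) by (simp add: h(2) mmul_assoc[symmetric] minv_left)
  thus ?thesis using h(1) by simp
qed

text \<open>Pigeonhole: the parabolic elements at p / q meet only finitely many cosets, so the
  quotient of two of them lies in \<Gamma>, and with it all its powers.\<close>

lemma parab_period:
  obtains M :: nat where "M > 0" "\<And>k::nat. parab p q (int (M * k)) \<in> \<Gamma>"
proof -
  let ?F = "\<lambda>t::nat. (\<lambda>h. mmul (parab p q (int t)) h) ` \<Gamma>"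
  have "range ?F \<subseteq> {(\<lambda>h. mmul g h) ` \<Gamma> | g. g \<in> SL2Z}" using parab_SL2Z by blast
  hence "finite (range ?F)" using cosets by (rule finite_subset)
  hence "\<not> inj ?F" using finite_imageD[of ?F UNIV] by auto
  then obtain i j :: nat where ij: "i < j" "?F i = ?F j" unfolding inj_def by (metis linorder_neqE_nat)
  have "mmul (minv (parab p q (int i))) (parab p q (int j)) \<in> \<Gamma>"
    by (rule same_coset[OF parab_SL2Z ij(2)])
  hence M: "parab p q (int (j - i)) \<in> \<Gamma>" using ij(1) by (simp add: minv_parab parab_add of_nat_diff)
  have "parab p q (int ((j - i) * k)) \<in> \<Gamma>" for k
  proof (induction k)
    case 0
    thus ?case using one by (simp add: parab_def)
  next
    case (Suc k)
    have "int (j - i) + int ((j - i) * k) = int ((j - i) * Suc k)" by (simp only: mult_Suc_right of_nat_add)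
    with mult[OF M Suc] show ?case by (simp only: parab_add)
  qed
  thus ?thesis using ij(1) by (intro that[of "j - i"]) auto
qed

text \<open>Finite index is given for cosets g \<Gamma>, whereas the transformation law strips an
  element of \<Gamma> from the left. Inverting representatives passes from one kind to the
  other.\<close>

lemma right_cosets:
  obtains R where "finite R" "R \<subseteq> SL2Z" "\<And>g. g \<in> SL2Z \<Longrightarrow> \<exists>\<rho>\<in>R. \<exists>\<gamma>\<in>\<Gamma>. g = mmul \<gamma> \<rho>"
proof -
  define C where "C = {(\<lambda>h. mmul g h) ` \<Gamma> | g. g \<in> SL2Z}"
  have "\<forall>X\<in>C. \<exists>g. g \<in> SL2Z \<and> X = (\<lambda>h. mmul g h) ` \<Gamma>" by (auto simp: C_def)
  then obtain rep where rep: "\<And>X. X \<in> C \<Longrightarrow> rep X \<in> SL2Z \<and> X = (\<lambda>h. mmul (rep X) h) ` \<Gamma>" by metis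
  define R where "R = (\<lambda>X. minv (rep X)) ` C"
  have "finite R" using cosets by (simp add: R_def C_def)
  moreover have "R \<subseteq> SL2Z" unfolding R_def by (intro image_subsetI minv_SL2Z) (use rep in blast)
  moreover have "\<exists>\<rho>\<in>R. \<exists>\<gamma>\<in>\<Gamma>. g = mmul \<gamma> \<rho>" if g: "g \<in> SL2Z" for g
  proof -
    define X where "X = (\<lambda>h. mmul (minv g) h) ` \<Gamma>"
    have X: "X \<in> C" unfolding C_def X_def using minv_SL2Z[OF g] by blast
    have "mmul (minv (minv g)) (rep X) \<in> \<Gamma>"
      using rep[OF X] by (intro same_coset minv_SL2Z g) (simp add: X_def[symmetric])
    hence "mmul g (rep X) \<in> \<Gamma>" by simp
    moreover have "g = mmul (mmul g (rep X)) (minv (rep X))"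
      using rep[OF X] by (simp add: mmul_assoc minv_right)
    ultimately show ?thesis using X unfolding R_def by blast
  qed
  ultimately show ?thesis by (rule that)
qed

text \<open>\<open>parab_period\<close> makes the set of candidate widths nonempty, so
  \<open>LEAST\<close> is attained. The sign \<epsilon> is carried along because the conjugated
  translation may lie in \<Gamma> only after multiplication by -1.\<close>

lemma cusp_width_props:
  assumes "\<gamma> \<in> SL2Z"
  shows "cusp_width \<Gamma> \<gamma> > 0"
    and "\<exists>g\<in>\<Gamma>. \<exists>\<epsilon>\<in>{1,-1}. mmul g \<gamma> = mmul \<gamma> (\<epsilon>, \<epsilon> * int (cusp_width \<Gamma> \<gamma>), 0, \<epsilon>)"
proof -
  obtain a b c d where \<gamma>: "\<gamma> = (a,b,c,d)" by (cases \<gamma>) auto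
  define P where "P m \<longleftrightarrow> m > 0 \<and>
      (mmul (mmul \<gamma> (1, int m, 0, 1)) (minv \<gamma>) \<in> \<Gamma> \<or>
       mmul (mmul \<gamma> (-1, - int m, 0, -1)) (minv \<gamma>) \<in> \<Gamma>)" for m
  obtain M :: nat where M: "M > 0" "\<And>k::nat. parab a c (int (M * k)) \<in> \<Gamma>"
    using parab_period[of a c] by blast
  have "P M" unfolding P_def using M(1) M(2)[of 1] conj_translation[of a b c d] assms by (simp add: \<gamma>)
  hence P: "P (cusp_width \<Gamma> \<gamma>)"
    unfolding cusp_width_def P_def[symmetric] by (rule LeastI)
  thus "cusp_width \<Gamma> \<gamma> > 0" by (simp add: P_def)
  have canc: "mmul (mmul (mmul \<gamma> t) (minv \<gamma>)) \<gamma> = mmul \<gamma> t" for t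
    using assms by (simp add: mmul_assoc minv_left)
  show "\<exists>g\<in>\<Gamma>. \<exists>\<epsilon>\<in>{1,-1}. mmul g \<gamma> = mmul \<gamma> (\<epsilon>, \<epsilon> * int (cusp_width \<Gamma> \<gamma>), 0, \<epsilon>)"
    using P canc unfolding P_def by fastforce
qed

end

section \<open>Fourier expansions\<close>

text \<open>Dividing by e^(2 pi i \<kappa> z) makes S invariant under z + 1, hence a function G of q
  = e^(2 pi i z). Polynomial growth together with \<kappa> < 1 forces q G(q) to tend to 0, so the
  singularity at q = 0 is removable and the Taylor series is the expansion.\<close>

lemma fourier_expansion:
  fixes S :: "complex \<Rightarrow> complex"
  assumes hol: "S holomorphic_on {z. Im z > 0}"
    and per: "\<And>z. Im z > 0 \<Longrightarrow> S (z + 1) = exp (2 * of_real pi * \<i> * of_real \<kappa>) * S z"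
    and \<kappa>: "0 \<le> \<kappa>" "\<kappa> < 1" and M: "M > 0"
    and growth: "\<And>z. Im z > 1 \<Longrightarrow> \<bar>Re z\<bar> \<le> 1 \<Longrightarrow> norm (S z) \<le> C * Im z powr M"
  obtains a where "has_expansion S \<kappa> a"
proof -
  define e where "e = 2 * complex_of_real pi * \<i>"
  have e0: "e \<noteq> 0" by (simp add: e_def)
  define h where "h z = S z * exp (- (e * of_real \<kappa> * z))" for z
  have h_hol: "h holomorphic_on {z. Im z > 0}" unfolding h_def by (intro holomorphic_intros hol)
  have h1: "h (z + 1) = h z" if "Im z > 0" for z
  proof -
    have "- (e * of_real \<kappa> * (z + 1)) = - (2 * of_real pi * \<i> * of_real \<kappa>) + - (e * of_real \<kappa> * z)"
      by (simp add: e_def algebra_simps)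
    hence "exp (2 * of_real pi * \<i> * of_real \<kappa>) * exp (- (e * of_real \<kappa> * (z + 1))) = exp (- (e * of_real \<kappa> * z))"
      by (simp only: exp_add[symmetric]) simp
    thus ?thesis unfolding h_def per[OF that] by (simp add: mult_ac)
  qed
  have hn: "h (z + of_nat n) = h z" if "Im z > 0" for z n
  proof (induction n)
    case (Suc n)
    have "h (z + of_nat n + 1) = h (z + of_nat n)" using that by (intro h1) simp
    thus ?case using Suc by (simp add: algebra_simps)
  qed simp
  have hk: "h (z + of_int k) = h z" if z: "Im z > 0" for z k
  proof (cases "k \<ge> 0")
    case True thus ?thesis using hn[OF z, of "nat k"] by simp
  next
    case False
    have "h (z + of_int k + of_nat (nat (- k))) = h (z + of_int k)" using z by (intro hn) simp
    thus ?thesis using False by simp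
  qed
  have h_eq: "h z = h w" if "exp (e * z) = exp (e * w)" "Im w > 0" for z w
  proof -
    obtain k :: int where "e * z = e * w + (of_int (2 * k) * pi) * \<i>"
      using \<open>exp (e * z) = exp (e * w)\<close> unfolding exp_eq by blast
    hence "e * z = e * (w + of_int k)" by (simp add: e_def algebra_simps)
    hence "z = w + of_int k" using e0 by simp
    thus ?thesis using hk[OF that(2)] by simp
  qed
  \<comment> \<open>Any logarithm would do, since periodicity makes the value independent of the
    choice; holomorphy across the cut of \<open>Ln\<close> rests on this.\<close>
  define G where "G q = h (Ln q / e)" for q
  have Im_e: "Im (w / e) = - Re w / (2 * pi)" for w
    by (simp add: e_def Im_divide power2_eq_square)
  have Re_e: "Re (w / e) = Im w / (2 * pi)" for w
    by (simp add: e_def Re_divide power2_eq_square)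
  have G_eq: "G (exp (e * z)) = h z" if "Im z > 0" for z
    unfolding G_def by (rule h_eq) (use that e0 in auto)
  have G_hol: "G holomorphic_on (ball 0 1 - {0})"
  proof (rule holomorphic_onI)
    fix q0 :: complex assume q0: "q0 \<in> ball 0 1 - {0}"
    hence n0: "q0 \<noteq> 0" "norm q0 < 1" by auto
    \<comment> \<open>On this half-disc q / q0 avoids the cut, so Ln (q / q0) + Ln q0 is a
      holomorphic logarithm even when q0 itself lies on the cut.\<close>
    define U where "U = {q \<in> ball 0 1. Re (q / q0) > 0}"
    have "open {q. Re (q / q0) > 0}"
      by (intro open_Collect_less continuous_intros) (use n0 in auto)
    moreover have "U = ball 0 1 \<inter> {q. Re (q / q0) > 0}" by (auto simp: U_def)
    ultimately have U: "open U" by auto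
    have q0U: "q0 \<in> U" using n0 by (simp add: U_def)
    define k where "k q = h ((Ln (q / q0) + Ln q0) / e)" for q
    have notneg: "q / q0 \<notin> \<real>\<^sub>\<le>\<^sub>0" if "q \<in> U" for q
      using that by (auto simp: U_def complex_nonpos_Reals_iff)
    have qn0: "q \<noteq> 0" if "q \<in> U" for q using that by (auto simp: U_def)
    have expk: "exp (Ln (q / q0) + Ln q0) = q" if "q \<in> U" for q
      using qn0[OF that] n0 by (simp add: exp_add)
    have Im_pos: "Im ((Ln (q / q0) + Ln q0) / e) > 0" if "q \<in> U" for q
    proof -
      have "norm q = exp (Re (Ln (q / q0) + Ln q0))" using arg_cong[OF expk[OF that], of norm] by simp
      moreover have "norm q < 1" using that by (simp add: U_def)
      ultimately have "Re (Ln (q / q0) + Ln q0) < 0" by (metis exp_less_one_iff)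
      thus ?thesis unfolding Im_e by (simp add: divide_neg_pos del: Re_Ln)
    qed
    have "k holomorphic_on U"
    proof -
      have "(\<lambda>q. (Ln (q / q0) + Ln q0) / e) holomorphic_on U"
        using n0 e0 notneg by (intro holomorphic_intros) auto
      hence "(h \<circ> (\<lambda>q. (Ln (q / q0) + Ln q0) / e)) holomorphic_on U"
        by (rule holomorphic_on_compose_gen[OF _ h_hol]) (use Im_pos in auto)
      thus ?thesis by (simp add: o_def k_def[abs_def])
    qed
    hence "k field_differentiable (at q0)" using U q0U by (rule holomorphic_on_imp_differentiable_at)
    moreover have "\<forall>\<^sub>F q in nhds q0. k q = G q"
      using eventually_nhds_in_open[OF U q0U]
    proof eventually_elim
      case (elim q)
      show ?case unfolding k_def G_def
        by (rule h_eq[symmetric]) (use Im_pos[OF elim] expk[OF elim] qn0[OF elim] e0 in auto)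
    qed
    ultimately have "G field_differentiable (at q0)"
      unfolding field_differentiable_def by (metis DERIV_cong_ev)
    thus "G field_differentiable at q0 within ball 0 1 - {0}"
      by (rule field_differentiable_at_within)
  qed
  \<comment> \<open>Half of the available decay rate 2 pi (1 - \<kappa>): one half absorbs y^M, the
    other survives as a positive power of |q|.\<close>
  define p where "p = pi * (1 - \<kappa>)"
  have p: "p > 0" using \<kappa> by (simp add: p_def)
  define D where "D = \<bar>C\<bar> * ((M / p) powr M * exp (- p * (M / p)))"
  have qG: "norm (q * G q) \<le> D * norm q powr ((1 - \<kappa>) / 2)" if q: "q \<noteq> 0" "norm q < exp (- (2 * pi))" for q
  proof -
    define z where "z = Ln q / e"
    define y where "y = Im z"
    have y_eq: "y = - ln (norm q) / (2 * pi)" using q(1) by (simp add: y_def z_def Im_e)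
    have "ln (norm q) < - (2 * pi)" using q by (metis ln_less_cancel_iff ln_exp exp_gt_zero zero_less_norm_iff)
    hence y: "y > 1" by (simp add: y_eq field_simps)
    have nq: "norm q = exp (- (2 * pi * y))" using q(1) by (simp add: y_eq)
    have "\<bar>Re z\<bar> \<le> 1"
      using mpi_less_Im_Ln[OF q(1)] Im_Ln_le_pi[OF q(1)] by (simp add: z_def Re_e abs_le_iff field_simps)
    hence "norm (S z) \<le> \<bar>C\<bar> * y powr M"
      using growth[of z] y unfolding y_def by (smt (verit) mult_right_mono powr_ge_zero)
    moreover have "norm (exp (- (e * of_real \<kappa> * z))) = exp (2 * pi * \<kappa> * y)"
      by (simp add: e_def y_def)
    ultimately have "norm (q * G q) \<le> exp (- (2 * pi * y)) * (\<bar>C\<bar> * y powr M * exp (2 * pi * \<kappa> * y))"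
      unfolding G_def z_def[symmetric] h_def norm_mult nq by (intro mult_left_mono mult_mono) auto
    also have "\<dots> = \<bar>C\<bar> * (y powr M * (exp (- (2 * pi * y)) * exp (2 * pi * \<kappa> * y)))" by simp
    also have "exp (- (2 * pi * y)) * exp (2 * pi * \<kappa> * y) = exp (- p * y) * exp (- p * y)"
      unfolding exp_add[symmetric] by (rule arg_cong[of _ _ exp]) (simp add: p_def algebra_simps)
    also have "\<bar>C\<bar> * (y powr M * (exp (- p * y) * exp (- p * y))) \<le> D * exp (- p * y)"
    proof -
      have "y powr M * exp (- p * y) \<le> (M / p) powr M * exp (- p * (M / p))"
        using M p y by (intro powr_exp_le_max) auto
      hence "\<bar>C\<bar> * (y powr M * exp (- p * y)) * exp (- p * y) \<le> D * exp (- p * y)"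
        unfolding D_def by (intro mult_right_mono mult_left_mono) auto
      thus ?thesis by (simp add: mult_ac)
    qed
    also have "exp (- p * y) = norm q powr ((1 - \<kappa>) / 2)"
      unfolding nq by (simp add: powr_def p_def)
    finally show ?thesis .
  qed
  have "((\<lambda>q. (q - 0) * G q) \<longlongrightarrow> 0) (at 0)"
  proof (rule Lim_null_comparison)
    show "\<forall>\<^sub>F q in at 0. norm ((q - 0) * G q) \<le> D * norm q powr ((1 - \<kappa>) / 2)"
      unfolding eventually_at using qG by (intro exI[of _ "exp (- (2 * pi))"]) (auto simp: dist_norm)
    have "((\<lambda>q::complex. D * norm q powr ((1 - \<kappa>) / 2)) \<longlongrightarrow> D * (0 powr ((1 - \<kappa>) / 2))) (at 0)"
      using \<kappa> by (intro tendsto_intros tendsto_powr' tendsto_norm_zero tendsto_ident_at) auto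
    thus "((\<lambda>q::complex. D * norm q powr ((1 - \<kappa>) / 2)) \<longlongrightarrow> 0) (at 0)" by simp
  qed
  then obtain F where F: "F holomorphic_on ball 0 1" "\<And>q. q \<in> ball 0 1 - {0} \<Longrightarrow> F q = G q"
    using holomorphic_on_extend_lim[OF G_hol] by auto
  define a where "a n = (deriv ^^ n) F 0 / fact n" for n
  have "has_expansion S \<kappa> a"
    unfolding has_expansion_def
  proof (intro conjI \<kappa> allI impI)
    fix z assume z: "Im z > 0"
    define q where "q = exp (e * z)"
    have q: "q \<in> ball 0 1 - {0}" using z by (simp add: q_def e_def)
    have "(\<lambda>n. a n * (q - 0) ^ n) sums F q"
      unfolding a_def using q by (intro holomorphic_power_series[OF F(1)]) auto
    moreover have "F q = h z" using F(2)[OF q] G_eq[OF z] by (simp add: q_def)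
    ultimately have "(\<lambda>n. a n * q ^ n * exp (e * of_real \<kappa> * z)) sums (h z * exp (e * of_real \<kappa> * z))"
      by (intro sums_mult2) simp
    moreover have "h z * exp (e * of_real \<kappa> * z) = S z" by (simp add: h_def exp_minus)
    moreover have "a n * q ^ n * exp (e * of_real \<kappa> * z) = a n * exp (2 * of_real pi * \<i> * of_real (real n + \<kappa>) * z)" for n
    proof -
      have "q ^ n * exp (e * of_real \<kappa> * z) = exp (of_nat n * (e * z) + e * of_real \<kappa> * z)"
        unfolding q_def exp_of_nat_mult[symmetric] exp_add ..
      also have "of_nat n * (e * z) + e * of_real \<kappa> * z = 2 * of_real pi * \<i> * of_real (real n + \<kappa>) * z"
        by (simp add: e_def algebra_simps)
      finally show ?thesis by (simp add: mult.assoc)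
    qed
    ultimately show "(\<lambda>n. a n * exp (2 * of_real pi * \<i> * of_real (real n + \<kappa>) * z)) sums S z" by simp
  qed
  thus ?thesis by (rule that)
qed

text \<open>In the variable q the expansion is a power series; convergence at height t / 2 therefore
  gives absolute convergence at height t. Only the term n = 0 with \<kappa> = 0 separates f from
  H.\<close>

lemma half_plane_series_of_expansion:
  fixes f :: "complex \<Rightarrow> complex" and m :: real
  assumes exp: "has_expansion (\<lambda>z. f (of_real m * z)) \<kappa> a" and m: "m > 0"
  defines "b \<equiv> (\<lambda>n. if real n + \<kappa> > 0 then a n else 0)"
  shows "half_plane_series b \<kappa> (2 * pi / m)"
    and "\<And>x t. t > 0 \<Longrightarrow> f (Complex x t) = half_plane_series.H b \<kappa> (2 * pi / m) x t + (if \<kappa> = 0 then a 0 else 0)"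
proof -
  have \<kappa>: "0 \<le> \<kappa>" "\<kappa> < 1" using exp by (auto simp: has_expansion_def)
  have sums: "(\<lambda>n. a n * exp (2 * of_real pi * \<i> * of_real (real n + \<kappa>) * z)) sums f (of_real m * z)" if "Im z > 0" for z
    using exp that by (auto simp: has_expansion_def)
  show hps: "half_plane_series b \<kappa> (2 * pi / m)"
  proof
    fix t :: real assume t: "t > 0"
    define q where "q s = complex_of_real (exp (- (2 * pi * (s / m))))" for s
    have modes: "exp (2 * of_real pi * \<i> * of_real (real n + \<kappa>) * (\<i> * of_real (s / m))) = q s ^ n * of_real (exp (- (2 * pi * \<kappa> * (s / m))))" for n s
    proof -
      have "2 * of_real pi * \<i> * of_real (real n + \<kappa>) * (\<i> * of_real (s / m)) = of_real (real n * (- (2 * pi * (s / m))) + (- (2 * pi * \<kappa> * (s / m))))"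
        by (simp add: complex_eq_iff algebra_simps)
      thus ?thesis unfolding q_def by (simp only: exp_of_real exp_add exp_of_nat_mult of_real_mult of_real_power)
    qed
    have "summable (\<lambda>n. a n * (q (t / 2) ^ n * of_real (exp (- (2 * pi * \<kappa> * ((t / 2) / m))))))"
      using sums_summable[OF sums[of "\<i> * of_real ((t / 2) / m)"]] t m unfolding modes by simp
    hence "summable (\<lambda>n. of_real (exp (- (2 * pi * \<kappa> * ((t / 2) / m)))) * (a n * q (t / 2) ^ n))"
      by (simp only: mult_ac)
    hence "summable (\<lambda>n. a n * q (t / 2) ^ n)" by (subst (asm) summable_cmult_iff) auto
    hence "summable (\<lambda>n. norm (a n * q t ^ n))"
      by (rule powser_insidea) (use t m in \<open>simp add: q_def field_simps\<close>)
    hence "summable (\<lambda>n. norm (a n * q t ^ n) * exp (- (2 * pi * \<kappa> * (t / m))))" by (rule summable_mult2)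
    hence sm: "summable (\<lambda>n. norm (a n) * exp (- (2 * pi / m) * (real n + \<kappa>) * t))"
    proof -
      have "norm (a n * q t ^ n) * exp (- (2 * pi * \<kappa> * (t / m))) = norm (a n) * exp (- (2 * pi / m) * (real n + \<kappa>) * t)" for n
      proof -
        have "norm (q t ^ n) * exp (- (2 * pi * \<kappa> * (t / m))) = exp (real n * (- (2 * pi * (t / m))) + (- (2 * pi * \<kappa> * (t / m))))"
          unfolding exp_add exp_of_nat_mult by (simp add: q_def norm_power)
        also have "real n * (- (2 * pi * (t / m))) + (- (2 * pi * \<kappa> * (t / m))) = - (2 * pi / m) * (real n + \<kappa>) * t"
          using m by (simp add: field_simps)
        finally show ?thesis by (simp only: norm_mult mult.assoc)
      qed
      thus ?thesis using \<open>summable (\<lambda>n. norm (a n * q t ^ n) * exp (- (2 * pi * \<kappa> * (t / m))))\<close> by simp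
    qed
    show "summable (\<lambda>n. norm (b n) * exp (- (2 * pi / m) * (real n + \<kappa>) * t))"
      by (rule summable_comparison_test'[OF sm, of 0]) (simp add: b_def)
  qed (use m \<kappa> in \<open>auto simp: b_def\<close>)
  interpret half_plane_series b \<kappa> "2 * pi / m" by (rule hps)
  fix x t :: real assume t: "t > 0"
  define z where "z = Complex x t / of_real m"
  have z: "Im z > 0" using t m by (simp add: z_def Im_divide_of_real)
  have mz: "of_real m * z = Complex x t" using m by (simp add: z_def)
  have mode_eq: "mode x t n = b n * exp (2 * of_real pi * \<i> * of_real (real n + \<kappa>) * z)" for n
  proof -
    have "2 * of_real pi * \<i> * of_real (real n + \<kappa>) * z =
       of_real (- (2 * pi / m) * (real n + \<kappa>) * t) + \<i> * of_real ((2 * pi / m) * (real n + \<kappa>) * x)"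
      using m by (simp add: complex_eq_iff z_def Re_divide_of_real Im_divide_of_real field_simps)
    thus ?thesis unfolding mode_def cis_conv_exp by (simp only: exp_add exp_of_real mult.assoc)
  qed
  have "(\<lambda>n. a n * exp (2 * of_real pi * \<i> * of_real (real n + \<kappa>) * z) - mode x t n) sums (f (Complex x t) - H x t)"
    unfolding H_def using sums[OF z] summable_sums[OF summable_mode[OF t]] mz by (intro sums_diff) simp_all
  moreover have "(\<lambda>n. a n * exp (2 * of_real pi * \<i> * of_real (real n + \<kappa>) * z) - mode x t n) = (\<lambda>n. if n = 0 then (if \<kappa> = 0 then a 0 else 0) else 0)"
  proof
    fix n
    have bn: "b n = (if real n + \<kappa> > 0 then a n else 0)" by (simp add: b_def)
    show "a n * exp (2 * of_real pi * \<i> * of_real (real n + \<kappa>) * z) - mode x t n = (if n = 0 then (if \<kappa> = 0 then a 0 else 0) else 0)"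
      unfolding mode_eq bn using \<kappa> by auto
  qed
  ultimately have "f (Complex x t) - H x t = (if \<kappa> = 0 then a 0 else 0)"
    using sums_unique2[OF _ sums_single[of 0 "\<lambda>_. if \<kappa> = 0 then a 0 else 0"]] by simp
  thus "f (Complex x t) = H x t + (if \<kappa> = 0 then a 0 else 0)" by (simp add: algebra_simps)
qed

lemma expansion_decay:
  assumes "has_expansion S \<kappa> a" "y0 > 0"
  obtains C c where "C \<ge> 0" "c > 0"
    "\<And>z. Im z \<ge> y0 \<Longrightarrow> norm (S z - (if \<kappa> = 0 then a 0 else 0)) \<le> C * exp (- c * Im z)"
proof -
  have exp: "has_expansion (\<lambda>z. S (of_real 1 * z)) \<kappa> a" using assms(1) by simp
  interpret half_plane_series "\<lambda>n. if real n + \<kappa> > 0 then a n else 0" \<kappa> "2 * pi / 1"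
    by (rule half_plane_series_of_expansion(1)[OF exp]) simp
  define \<omega> where "\<omega> = 2 * pi / (1::real)"
  define C where "C = majorant y0 * exp (\<omega> * \<nu>0 * y0)"
  have "norm (S z - (if \<kappa> = 0 then a 0 else 0)) \<le> C * exp (- (\<omega> * \<nu>0) * Im z)" if z: "Im z \<ge> y0" for z
  proof -
    have "S z = H (Re z) (Im z) + (if \<kappa> = 0 then a 0 else 0)"
      using half_plane_series_of_expansion(2)[OF exp, of "Im z" "Re z"] z assms(2) by simp
    hence "norm (S z - (if \<kappa> = 0 then a 0 else 0)) = norm (H (Re z) (Im z))" by simp
    also have "\<dots> \<le> majorant y0 * exp (- \<omega> * \<nu>0 * (Im z - y0))"
      unfolding \<omega>_def using z assms(2) by (intro norm_H_le) auto
    finally show ?thesis unfolding exp_shift C_def by simp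
  qed
  moreover have "C \<ge> 0" using majorant_nonneg[OF assms(2)] by (simp add: C_def)
  moreover have "\<omega> * \<nu>0 > 0" using \<nu>0_pos by (simp add: \<omega>_def)
  ultimately show ?thesis by (intro that)
qed

lemma holomorphic_moeb:
  assumes "g \<in> SL2Z" "\<phi> holomorphic_on A" "\<And>z. z \<in> A \<Longrightarrow> Im (\<phi> z) > 0"
  shows "(\<lambda>z. moeb g (\<phi> z)) holomorphic_on A"
proof -
  obtain a b c d where g: "g = (a,b,c,d)" by (cases g) auto
  have "of_int c * \<phi> z + of_int d \<noteq> 0" if "z \<in> A" for z
    using jfac_nonzero[OF assms(1) assms(3)[OF that]] by (simp add: g)
  thus ?thesis unfolding g moeb.simps by (intro holomorphic_intros assms(2)) auto
qed

text \<open>For c \<noteq> 0 the automorphy factor is never real and so misses the cut. For c = 0 it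
  may be a negative constant on the cut, where only its constancy helps; hence the case
  distinction.\<close>

lemma holomorphic_jfac_powr:
  assumes "\<phi> holomorphic_on A" "\<And>z. z \<in> A \<Longrightarrow> Im (\<phi> z) > 0"
  shows "(\<lambda>z. jfac g (\<phi> z) powr s) holomorphic_on A"
proof -
  obtain a b c d where g: "g = (a,b,c,d)" by (cases g) auto
  show ?thesis
  proof (cases "c = 0")
    case True
    thus ?thesis by (simp add: g)
  next
    case False
    have "of_int c * \<phi> z + of_int d \<notin> \<real>\<^sub>\<le>\<^sub>0" if "z \<in> A" for z
      using assms(2)[OF that] False by (auto simp: complex_nonpos_Reals_iff)
    thus ?thesis unfolding g jfac.simps by (intro holomorphic_intros assms(1)) auto
  qed
qed

section \<open>Expansions at the cusps\<close>

locale modular_setting = finite_index +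
  fixes \<mu> :: "mat2 \<Rightarrow> complex" and r \<kappa> :: real and f :: "complex \<Rightarrow> complex"
    and a :: "nat \<Rightarrow> complex" and m :: nat
  assumes r_pos: "r > 0" and modular: "modular_form \<Gamma> \<mu> r f"
    and m_def: "m = cusp_width \<Gamma> (1,0,0,1)"
    and expansion: "has_expansion (\<lambda>z. f (of_nat m * z)) \<kappa> a"
begin

lemma f_holomorphic: "f holomorphic_on {z. Im z > 0}"
  using modular by (simp add: modular_form_def)

lemma norm_\<mu>: "\<gamma> \<in> \<Gamma> \<Longrightarrow> norm (\<mu> \<gamma>) = 1"
  using modular by (simp add: modular_form_def)

lemma f_transform: "\<gamma> \<in> \<Gamma> \<Longrightarrow> Im z > 0 \<Longrightarrow> f (moeb \<gamma> z) = \<mu> \<gamma> * jfac \<gamma> z powr of_real r * f z"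
  using modular by (simp add: modular_form_def)

lemma norm_f_transform: "\<gamma> \<in> \<Gamma> \<Longrightarrow> Im z > 0 \<Longrightarrow> norm (f (moeb \<gamma> z)) = norm (jfac \<gamma> z) powr r * norm (f z)"
  by (simp add: f_transform norm_mult norm_\<mu> norm_powr_real_powr')

lemma m_pos: "m > 0"
  using cusp_width_props(1)[of "(1,0,0,1)"] by (simp add: m_def SL2Z_def)

text \<open>The absolute value of \<open>f|g\<close>; it does not depend on the branch of the power.\<close>

definition slash_norm :: "mat2 \<Rightarrow> complex \<Rightarrow> real" where
  "slash_norm g z = norm (f (moeb g z)) * norm (jfac g z) powr (- r)"

lemma slash_norm_nonneg: "slash_norm g z \<ge> 0" by (simp add: slash_norm_def)

lemma slash_norm_transform:
  assumes "\<gamma> \<in> \<Gamma>" "g \<in> SL2Z" "Im z > 0"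
  shows "slash_norm (mmul \<gamma> g) z = slash_norm g z"
proof -
  have \<gamma>: "\<gamma> \<in> SL2Z" using assms sub by auto
  have Im: "Im (moeb g z) > 0" using assms by (intro Im_moeb_pos)
  have "norm (jfac \<gamma> (moeb g z)) > 0" using jfac_nonzero[OF \<gamma> Im] by simp
  thus ?thesis
    unfolding slash_norm_def moeb_mmul[OF \<gamma> assms(2,3)] jfac_mmul[OF assms(2,3)] norm_mult
      norm_f_transform[OF assms(1) Im]
    by (simp add: powr_mult powr_minus)
qed

text \<open>Im (g z) / Im z is the inverse square of the automorphy factor's modulus. The formula
  transports a bound at the point g z, chosen high up, back to z.\<close>

lemma norm_f_eq_slash_norm:
  assumes "g \<in> SL2Z" "Im z > 0"
  shows "norm (f z) = slash_norm (minv g) (moeb g z) * (Im (moeb g z) / Im z) powr (r / 2)"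
proof -
  define j where "j = norm (jfac g z)"
  have j: "j > 0" using jfac_nonzero[OF assms] by (simp add: j_def)
  have "moeb (minv g) (moeb g z) = z"
    using moeb_mmul[OF minv_SL2Z[OF assms(1)] assms] assms by (simp add: minv_left)
  hence 1: "slash_norm (minv g) (moeb g z) = norm (f z) * (1 / j) powr (- r)"
    unfolding slash_norm_def norm_jfac_inverse[OF assms] j_def by simp
  have "Im (moeb g z) / Im z = 1 / j\<^sup>2" using assms by (simp add: Im_moeb j_def)
  also have "(1 / j\<^sup>2) powr (r / 2) = (1 / j) powr r"
  proof -
    have "1 / j\<^sup>2 = (1 / j) powr 2" using j by (simp add: power_one_over)
    thus ?thesis by (simp only: powr_powr) simp
  qed
  finally have "slash_norm (minv g) (moeb g z) * (Im (moeb g z) / Im z) powr (r / 2) = norm (f z) * ((1 / j) powr (- r) * (1 / j) powr r)"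
    unfolding 1 by simp
  also have "(1 / j) powr (- r) * (1 / j) powr r = 1" using j by (simp add: powr_add[symmetric])
  finally show ?thesis by simp
qed

text \<open>g and -g act alike and have automorphy factors of equal modulus, so the sign of the
  bottom row may be normalised; for c = 0 the determinant leaves d = 1 or d = -1.\<close>

lemma exists_admissible:
  assumes "g \<in> SL2Z"
  obtains \<delta> where "admissible_scaling \<delta>" "\<delta> \<in> SL2Z" "\<And>z. slash_norm \<delta> z = slash_norm g z"
proof -
  obtain a b c d where g: "g = (a,b,c,d)" by (cases g) auto
  have neg: "slash_norm (-a,-b,-c,-d) z = slash_norm (a,b,c,d) z" for z
  proof -
    have "moeb (-a,-b,-c,-d) z = (- (of_int a * z + of_int b)) / (- (of_int c * z + of_int d))" by simp
    moreover have "(- A) / (- B) = A / B" for A B :: complex by simp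
    ultimately have 1: "moeb (-a,-b,-c,-d) z = moeb (a,b,c,d) z" by (simp only: moeb.simps)
    have "jfac (-a,-b,-c,-d) z = - jfac (a,b,c,d) z" by simp
    hence "norm (jfac (-a,-b,-c,-d) z) = norm (jfac (a,b,c,d) z)" by (simp only: norm_minus_cancel)
    with 1 show ?thesis by (simp only: slash_norm_def)
  qed
  have neg_mem: "(-a,-b,-c,-d) \<in> SL2Z" using assms by (simp add: g SL2Z_def)
  have c0: "d = 1 \<or> d = -1" if "c = 0"
    using assms that by (auto simp: g SL2Z_def zmult_eq_1_iff)
  show ?thesis
  proof (cases "c < 0 \<or> (c = 0 \<and> d = 1)")
    case True
    thus ?thesis using assms by (intro that[of g]) (auto simp: g)
  next
    case False
    hence "- c < 0 \<or> (- c = 0 \<and> - d = 1)" using c0 by auto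
    thus ?thesis using neg neg_mem by (intro that[of "(-a,-b,-c,-d)"]) (auto simp: g)
  qed
qed

lemma slash_factor:
  assumes "M > 0"
  shows "complex_of_real (of_int c * sqrt (real M)) * z + of_real (of_int d / sqrt (real M)) = jfac (a',b,c,d) (of_nat M * z) / of_real (sqrt (real M))"
proof -
  have "complex_of_real (sqrt (real M)) * of_real (sqrt (real M)) = of_nat M"
    by (simp flip: of_real_mult)
  thus ?thesis using assms by (simp add: field_simps)
qed

lemma norm_slash_scaled:
  assumes "M > 0"
  shows "norm (slash_scaled f r \<gamma> M z) = slash_norm \<gamma> (of_nat M * z) * real M powr (r / 2)"
proof -
  obtain a b c d where \<gamma>: "\<gamma> = (a,b,c,d)" by (cases \<gamma>) auto
  have "norm (slash_scaled f r \<gamma> M z) = norm (f (moeb \<gamma> (of_nat M * z))) / (norm (jfac \<gamma> (of_nat M * z)) / sqrt (real M)) powr r"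
    unfolding \<gamma> slash_scaled.simps slash_factor[OF assms, of c z d a b]
    by (simp only: norm_divide norm_powr_real_powr'[OF Reals_of_real] Re_complex_of_real norm_of_real abs_of_nonneg[OF real_sqrt_ge_zero[OF of_nat_0_le_iff]])
  also have "(norm (jfac \<gamma> (of_nat M * z)) / sqrt (real M)) powr r = norm (jfac \<gamma> (of_nat M * z)) powr r / real M powr (r / 2)"
  proof -
    have "sqrt (real M) powr r = real M powr (r / 2)"
      using assms by (subst powr_half_sqrt[symmetric]) (auto simp: powr_powr)
    thus ?thesis by (simp add: powr_divide)
  qed
  finally show ?thesis unfolding slash_norm_def powr_minus[of _ r] by simp (simp only: inverse_eq_divide times_divide_eq_right times_divide_eq_left mult_1_right)
qed

text \<open>The automorphy factor of the translation is holomorphic of modulus one, hence constant; no cocycle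
  identity for \<open>\<mu>\<close> is needed.\<close>

lemma slash_scaled_periodic:
  assumes "(a0,b,c,d) \<in> SL2Z" "c < 0"
  defines "\<gamma> \<equiv> (a0,b,c,d)"
  defines "M \<equiv> cusp_width \<Gamma> \<gamma>"
  shows "slash_scaled f r \<gamma> M holomorphic_on {z. Im z > 0}"
    and "\<exists>\<nu>. norm \<nu> = 1 \<and> (\<forall>z. Im z > 0 \<longrightarrow> slash_scaled f r \<gamma> M (z + 1) = \<nu> * slash_scaled f r \<gamma> M z)"
proof -
  have \<gamma>: "\<gamma> \<in> SL2Z" using assms by simp
  have M: "M > 0" using cusp_width_props(1)[OF \<gamma>] by (simp add: M_def)
  define J where "J z = complex_of_real (of_int c * sqrt (real M)) * z + of_real (of_int d / sqrt (real M))" for z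
  have S: "slash_scaled f r \<gamma> M z = f (moeb \<gamma> (of_nat M * z)) / J z powr of_real r" for z
    by (simp add: \<gamma>_def J_def)
  \<comment> \<open>As c < 0, J maps the upper half-plane into the lower one, away from the cut, so
    its power is holomorphic.\<close>
  have Im_J: "Im (J z) < 0" if "Im z > 0" for z
    using that assms(2) M by (simp add: J_def mult_neg_pos)
  have J0: "J z \<noteq> 0" if "Im z > 0" for z using Im_J[OF that] by auto
  have J_np: "J z \<notin> \<real>\<^sub>\<le>\<^sub>0" if "Im z > 0" for z using Im_J[OF that] by (auto simp: complex_nonpos_Reals_iff)
  have J_powr: "(\<lambda>z. J z powr of_real r) holomorphic_on {z. Im z > 0}"
    unfolding J_def by (intro holomorphic_intros) (use J_np in \<open>auto simp: J_def\<close>)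
  have Im_M: "Im (of_nat M * z) > 0" if "Im z > 0" for z using that M by simp
  have moebM: "(\<lambda>z. moeb \<gamma> (of_nat M * z)) holomorphic_on {z. Im z > 0}"
    by (intro holomorphic_moeb \<gamma> holomorphic_intros) (use Im_M in auto)
  have fM: "(\<lambda>z. f (moeb \<gamma> (of_nat M * z))) holomorphic_on {z. Im z > 0}"
  proof -
    have "(f \<circ> (\<lambda>z. moeb \<gamma> (of_nat M * z))) holomorphic_on {z. Im z > 0}"
      by (rule holomorphic_on_compose_gen[OF moebM f_holomorphic]) (use Im_moeb_pos[OF \<gamma> Im_M] in auto)
    thus ?thesis by (simp add: o_def)
  qed
  have "(\<lambda>z. f (moeb \<gamma> (of_nat M * z)) / J z powr of_real r) holomorphic_on {z. Im z > 0}"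
    by (intro holomorphic_on_divide fM J_powr) (use J0 in auto)
  thus "slash_scaled f r \<gamma> M holomorphic_on {z. Im z > 0}" by (simp add: S cong: holomorphic_cong)
  obtain g \<epsilon> where g: "g \<in> \<Gamma>" "\<epsilon> \<in> {1,-1}" "mmul g \<gamma> = mmul \<gamma> (\<epsilon>, \<epsilon> * int M, 0, \<epsilon>)"
    using cusp_width_props(2)[OF \<gamma>] unfolding M_def by blast
  have gS: "g \<in> SL2Z" using g sub by auto
  define T :: mat2 where "T = (\<epsilon>, \<epsilon> * int M, 0, \<epsilon>)"
  have TS: "T \<in> SL2Z" using g(2) by (auto simp: T_def SL2Z_def)
  have moebT: "moeb T w = w + of_nat M" for w using g(2) by (auto simp: T_def)
  have jT: "norm (jfac T w) = 1" for w using g(2) by (auto simp: T_def)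
  have shift: "moeb g (moeb \<gamma> w) = moeb \<gamma> (w + of_nat M)" if "Im w > 0" for w
    using moeb_mmul[OF gS \<gamma> that] moeb_mmul[OF \<gamma> TS that] g(3) by (simp add: T_def[symmetric] moebT)
  have jshift: "norm (jfac g (moeb \<gamma> w)) * norm (jfac \<gamma> w) = norm (jfac \<gamma> (w + of_nat M))" if "Im w > 0" for w
  proof -
    have "jfac (mmul g \<gamma>) w = jfac g (moeb \<gamma> w) * jfac \<gamma> w" by (rule jfac_mmul[OF \<gamma> that])
    moreover have "jfac (mmul \<gamma> T) w = jfac \<gamma> (moeb T w) * jfac T w" by (rule jfac_mmul[OF TS that])
    ultimately have "norm (jfac g (moeb \<gamma> w) * jfac \<gamma> w) = norm (jfac \<gamma> (moeb T w) * jfac T w)"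
      using g(3) by (simp add: T_def)
    thus ?thesis by (simp add: norm_mult jT moebT)
  qed
  define \<nu> where "\<nu> z = \<mu> g * jfac g (moeb \<gamma> (of_nat M * z)) powr of_real r * J z powr of_real r / J (z + 1) powr of_real r" for z
  have S1: "slash_scaled f r \<gamma> M (z + 1) = \<nu> z * slash_scaled f r \<gamma> M z" if z: "Im z > 0" for z
  proof -
    have "f (moeb \<gamma> (of_nat M * (z + 1))) = f (moeb g (moeb \<gamma> (of_nat M * z)))"
      using shift[OF Im_M[OF z]] by (simp add: algebra_simps)
    also have "\<dots> = \<mu> g * jfac g (moeb \<gamma> (of_nat M * z)) powr of_real r * f (moeb \<gamma> (of_nat M * z))"
      by (rule f_transform[OF g(1) Im_moeb_pos[OF \<gamma> Im_M[OF z]]])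
    finally show ?thesis unfolding S \<nu>_def using J0[OF z] by simp
  qed
  have J_jfac: "norm (J z) = norm (jfac \<gamma> (of_nat M * z)) / sqrt (real M)" for z
    unfolding J_def \<gamma>_def slash_factor[OF M, of c z d a0 b] by (simp only: norm_divide) simp
  have norm_\<nu>: "norm (\<nu> z) = 1" if z: "Im z > 0" for z
  proof -
    have "norm (J (z + 1)) = norm (jfac g (moeb \<gamma> (of_nat M * z))) * norm (J z)"
      using jshift[OF Im_M[OF z]] unfolding J_jfac by (simp add: algebra_simps)
    hence "norm (J (z + 1)) powr r = norm (jfac g (moeb \<gamma> (of_nat M * z))) powr r * norm (J z) powr r"
      by (simp add: powr_mult)
    moreover have "jfac g (moeb \<gamma> (of_nat M * z)) \<noteq> 0" "J z \<noteq> 0"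
      using jfac_nonzero[OF gS Im_moeb_pos[OF \<gamma> Im_M[OF z]]] J0[OF z] by auto
    ultimately show ?thesis
      by (simp add: \<nu>_def norm_mult norm_divide norm_\<mu>[OF g(1)] norm_powr_real_powr')
  qed
  have \<nu>_hol: "\<nu> holomorphic_on {z. Im z > 0}"
  proof -
    have J1: "(\<lambda>z. J (z + 1) powr of_real r) holomorphic_on {z. Im z > 0}"
    proof -
      have "((\<lambda>z. J z powr of_real r) \<circ> (\<lambda>z. z + 1)) holomorphic_on {z. Im z > 0}"
        by (rule holomorphic_on_compose_gen[OF _ J_powr]) (auto intro!: holomorphic_intros)
      thus ?thesis by (simp add: o_def)
    qed
    have Jn: "J (z + 1) powr of_real r \<noteq> 0" if "z \<in> {z. Im z > 0}" for z using J0[of "z + 1"] that by simp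
    have jg: "(\<lambda>z. jfac g (moeb \<gamma> (of_nat M * z)) powr of_real r) holomorphic_on {z. Im z > 0}"
      by (rule holomorphic_jfac_powr[OF moebM]) (use Im_moeb_pos[OF \<gamma> Im_M] in auto)
    show ?thesis unfolding \<nu>_def
      by (rule holomorphic_on_divide[OF holomorphic_on_mult[OF holomorphic_on_mult[OF holomorphic_on_const jg] J_powr] J1 Jn])
  qed
  have "\<nu> constant_on {z. Im z > 0}"
    by (rule maximum_modulus_principle[OF \<nu>_hol, where U = "{z. Im z > 0}" and \<xi> = \<i>])
       (use norm_\<nu> in \<open>auto simp: open_halfspace_Im_gt\<close>)
  then obtain c0 where "\<And>z. Im z > 0 \<Longrightarrow> \<nu> z = c0" unfolding constant_on_def by auto
  thus "\<exists>\<nu>. norm \<nu> = 1 \<and> (\<forall>z. Im z > 0 \<longrightarrow> slash_scaled f r \<gamma> M (z + 1) = \<nu> * slash_scaled f r \<gamma> M z)"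
    using S1 norm_\<nu>[of \<i>] by (intro exI[of _ c0]) auto
qed

text \<open>For c \<noteq> 0 the automorphy factor has modulus between y and D y, with y = Im w. So
  the image of w has height y / |j|^2 < 1, where the moderate growth of f applies, and that height
  is bounded below by a negative power of y.\<close>

lemma slash_norm_polynomial_growth:
  assumes "(a0,b,c,d) \<in> SL2Z" "c \<noteq> 0"
  obtains C N where "N > 0" "\<And>w. Im w > 1 \<Longrightarrow> \<bar>Re w\<bar> \<le> R * Im w \<Longrightarrow> slash_norm (a0,b,c,d) w \<le> C * Im w powr N"
proof -
  obtain C0 N0 where g0: "\<And>z. 0 < Im z \<Longrightarrow> Im z < 1 \<Longrightarrow> norm (f z) \<le> C0 * Im z powr (- N0)"
    using modular unfolding modular_form_def by blast
  \<comment> \<open>At heights below 1 a larger exponent only weakens the growth bound, and a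
    positive one is needed for the monotonicity of powers.\<close>
  define N where "N = max N0 1"
  have N: "N > 0" by (simp add: N_def)
  define \<gamma> where "\<gamma> = (a0,b,c,d)"
  have \<gamma>: "\<gamma> \<in> SL2Z" using assms by (simp add: \<gamma>_def)
  have c1: "\<bar>real_of_int c\<bar> \<ge> 1" using assms(2) by linarith
  define D where "D = \<bar>real_of_int c\<bar> * (\<bar>R\<bar> + 1) + \<bar>real_of_int d\<bar>"
  have "slash_norm \<gamma> w \<le> (\<bar>C0\<bar> * D powr (2 * N)) * Im w powr (2 * N)" if w: "Im w > 1" "\<bar>Re w\<bar> \<le> R * Im w" for w
  proof -
    define j where "j = norm (jfac \<gamma> w)"
    define y where "y = Im w"
    have y: "y > 1" using w by (simp add: y_def)
    have "\<bar>Im (jfac \<gamma> w)\<bar> \<le> j" unfolding j_def by (rule abs_Im_le_cmod)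
    hence "\<bar>real_of_int c\<bar> * y \<le> j" using y by (simp add: \<gamma>_def y_def abs_mult)
    moreover have "1 * y \<le> \<bar>real_of_int c\<bar> * y" using c1 y by (intro mult_right_mono) auto
    ultimately have j_ge: "j \<ge> y" by linarith
    have j_le: "j \<le> D * y"
    proof -
      have "\<bar>Re w\<bar> \<le> \<bar>R\<bar> * y" using w(2) y unfolding y_def by (smt (verit) mult_right_mono)
      hence nw: "norm w \<le> (\<bar>R\<bar> + 1) * y" using cmod_le[of w] y by (simp add: y_def algebra_simps)
      have "j \<le> norm (of_int c * w) + norm (of_int d :: complex)" unfolding j_def \<gamma>_def jfac.simps by (rule norm_triangle_ineq)
      also have "\<dots> = \<bar>real_of_int c\<bar> * norm w + \<bar>real_of_int d\<bar> * 1" by (simp add: norm_mult)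
      also have "\<dots> \<le> \<bar>real_of_int c\<bar> * ((\<bar>R\<bar> + 1) * y) + \<bar>real_of_int d\<bar> * y"
        using nw y by (intro add_mono mult_left_mono) auto
      finally show ?thesis by (simp add: D_def algebra_simps)
    qed
    have wy: "Im w > 0" using w by simp
    have Im_eq: "Im (moeb \<gamma> w) = y / j\<^sup>2" using Im_moeb[OF \<gamma> wy] by (simp add: y_def j_def)
    have Im_lt: "0 < y / j\<^sup>2" "y / j\<^sup>2 < 1"
    proof -
      have "y * 1 < y * y" using y by (intro mult_strict_left_mono) auto
      also have "y * y \<le> j * j" using j_ge y by (intro mult_mono) auto
      finally have "y < j\<^sup>2" by (simp add: power2_eq_square)
      thus "y / j\<^sup>2 < 1" "0 < y / j\<^sup>2" using y j_ge by auto
    qed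
    have "norm (f (moeb \<gamma> w)) \<le> C0 * (y / j\<^sup>2) powr (- N0)"
      using g0[of "moeb \<gamma> w"] Im_lt Im_eq by simp
    also have "\<dots> \<le> \<bar>C0\<bar> * (y / j\<^sup>2) powr (- N)"
      using Im_lt by (intro mult_mono powr_mono') (auto simp: N_def)
    also have "(y / j\<^sup>2) powr (- N) \<le> (D * y) powr (2 * N)"
    proof -
      have "(y / j\<^sup>2) powr (- N) = (j\<^sup>2 / y) powr N"
        using y j_ge by (simp add: powr_minus powr_divide)
      also have "\<dots> \<le> (j\<^sup>2) powr N"
      proof -
        have "j\<^sup>2 / y \<le> j\<^sup>2 / 1" using y by (intro divide_left_mono) auto
        thus ?thesis using y N by (intro powr_mono2) auto
      qed
      also have "\<dots> \<le> ((D * y)\<^sup>2) powr N"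
        using j_le j_ge y N by (intro powr_mono2 power_mono) auto
      also have "\<dots> = (D * y) powr (2 * N)"
      proof -
        have "D * y > 0" using j_le j_ge y by linarith
        hence "(D * y)\<^sup>2 = (D * y) powr 2" by simp
        thus ?thesis by (simp only: powr_powr)
      qed
      finally show ?thesis .
    qed
    also have "(D * y) powr (2 * N) = D powr (2 * N) * y powr (2 * N)"
      by (rule powr_mult)
    finally have *: "norm (f (moeb \<gamma> w)) \<le> \<bar>C0\<bar> * (D powr (2 * N) * y powr (2 * N))"
      by (simp add: mult_left_mono)
    have "j powr (- r) \<le> 1 powr (- r)" using j_ge y r_pos by (intro powr_mono2') auto
    hence "slash_norm \<gamma> w \<le> (\<bar>C0\<bar> * (D powr (2 * N) * y powr (2 * N))) * 1"
      unfolding slash_norm_def j_def[symmetric] using * by (intro mult_mono) auto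
    thus ?thesis by (simp add: y_def)
  qed
  thus ?thesis using N unfolding \<gamma>_def by (intro that[of "2 * N" "\<bar>C0\<bar> * D powr (2 * N)"]) auto
qed

text \<open>For c < 0 the multiplier of the translation has modulus one, and its argument supplies
  \<kappa>'. For c = 0 the matrix is a translation, and the given expansion at infinity is shifted,
  which only changes the phases of the coefficients.\<close>

lemma expansions_exist:
  assumes "admissible_scaling \<gamma>"
  obtains \<kappa>' a' where "has_expansion (slash_scaled f r \<gamma> (cusp_width \<Gamma> \<gamma>)) \<kappa>' a'"
proof -
  obtain a0 b c d where \<gamma>: "\<gamma> = (a0,b,c,d)" by (cases \<gamma>) auto
  have \<gamma>S: "\<gamma> \<in> SL2Z" and cd: "c < 0 \<or> (c = 0 \<and> d = 1)" using assms by (auto simp: \<gamma>)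
  define M where "M = cusp_width \<Gamma> \<gamma>"
  have M: "M > 0" using cusp_width_props(1)[OF \<gamma>S] by (simp add: M_def)
  show ?thesis
  proof (cases "c < 0")
    case True
    have hol: "slash_scaled f r \<gamma> M holomorphic_on {z. Im z > 0}"
      using slash_scaled_periodic(1)[OF \<gamma>S[unfolded \<gamma>] True] unfolding M_def \<gamma> .
    obtain \<nu> where \<nu>: "norm \<nu> = 1" "\<And>z. Im z > 0 \<Longrightarrow> slash_scaled f r \<gamma> M (z + 1) = \<nu> * slash_scaled f r \<gamma> M z"
      using slash_scaled_periodic(2)[OF \<gamma>S[unfolded \<gamma>] True] unfolding M_def \<gamma> by blast
    define \<kappa>' where "\<kappa>' = Arg2pi \<nu> / (2 * pi)"
    have \<kappa>': "0 \<le> \<kappa>'" "\<kappa>' < 1" using Arg2pi[of \<nu>] by (auto simp: \<kappa>'_def)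
    have "\<nu> = exp (\<i> * of_real (Arg2pi \<nu>))"
      using Arg2pi[of \<nu>] \<nu>(1) unfolding is_Arg_def by simp
    also have "\<i> * of_real (Arg2pi \<nu>) = 2 * of_real pi * \<i> * of_real \<kappa>'" by (simp add: \<kappa>'_def)
    finally have \<nu>_eq: "\<nu> = exp (2 * of_real pi * \<i> * of_real \<kappa>')" .
    obtain C N where CN: "N > 0" "\<And>w. Im w > 1 \<Longrightarrow> \<bar>Re w\<bar> \<le> 1 * Im w \<Longrightarrow> slash_norm (a0,b,c,d) w \<le> C * Im w powr N"
      using slash_norm_polynomial_growth[OF \<gamma>S[unfolded \<gamma>], of 1] True by (metis less_irrefl)
    have "norm (slash_scaled f r \<gamma> M z) \<le> (C * real M powr N * real M powr (r / 2)) * Im z powr N" if z: "Im z > 1" "\<bar>Re z\<bar> \<le> 1" for z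
    proof -
      have Mz: "real M * Im z > 1" using M z(1) by (smt (verit) less_1_mult' mult_left_mono mult_le_cancel_right1 of_nat_0_less_iff of_nat_1 of_nat_less_iff Suc_leI One_nat_def of_nat_le_iff)
      have "real M * \<bar>Re z\<bar> \<le> real M * Im z" using z M by (intro mult_left_mono) auto
      hence "slash_norm \<gamma> (of_nat M * z) \<le> C * (real M * Im z) powr N"
        using CN(2)[of "of_nat M * z"] Mz by (simp add: \<gamma> abs_mult)
      hence "slash_norm \<gamma> (of_nat M * z) * real M powr (r / 2) \<le> C * (real M * Im z) powr N * real M powr (r / 2)"
        by (intro mult_right_mono) auto
      thus ?thesis unfolding norm_slash_scaled[OF M] using z M by (simp add: powr_mult mult_ac)
    qed
    then obtain a' where "has_expansion (slash_scaled f r \<gamma> M) \<kappa>' a'"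
      using fourier_expansion[OF hol _ \<kappa>' CN(1)] \<nu>(2) unfolding \<nu>_eq by blast
    thus ?thesis using that by (simp add: M_def)
  next
    case False
    hence c0: "c = 0" "d = 1" using cd by auto
    hence a1: "a0 = 1" using \<gamma>S by (simp add: \<gamma> SL2Z_def)
    have Mm: "M = m"
    proof -
      have "mmul (mmul \<gamma> (1, t, 0, 1)) (minv \<gamma>) = (1, t, 0, 1)" "mmul (mmul \<gamma> (-1, - t, 0, -1)) (minv \<gamma>) = (-1, -t, 0, -1)" for t
        by (simp_all add: \<gamma> c0 a1)
      thus ?thesis unfolding M_def m_def cusp_width_def by simp
    qed
    define k where "k = 1 / complex_of_real (1 / sqrt (real m)) powr of_real r"
    define a' where "a' n = a n * exp (2 * of_real pi * \<i> * of_real (real n + \<kappa>) * (of_int b / of_nat m)) * k" for n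
    have "has_expansion (slash_scaled f r \<gamma> M) \<kappa> a'"
      unfolding has_expansion_def
    proof (intro conjI allI impI)
      show "0 \<le> \<kappa>" "\<kappa> < 1" using expansion by (auto simp: has_expansion_def)
      fix z assume z: "Im z > 0"
      have "Im (z + of_int b / of_nat m) > 0" using z by (simp add: Im_divide_of_nat)
      hence "(\<lambda>n. a n * exp (2 * of_real pi * \<i> * of_real (real n + \<kappa>) * (z + of_int b / of_nat m))) sums f (of_nat m * (z + of_int b / of_nat m))"
        using expansion by (auto simp: has_expansion_def)
      hence "(\<lambda>n. a n * exp (2 * of_real pi * \<i> * of_real (real n + \<kappa>) * (z + of_int b / of_nat m)) * k) sums (f (of_nat m * (z + of_int b / of_nat m)) * k)"
        by (rule sums_mult2)
      moreover have "f (of_nat m * (z + of_int b / of_nat m)) * k = slash_scaled f r \<gamma> M z"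
        using m_pos by (simp add: \<gamma> c0 a1 Mm k_def algebra_simps)
      moreover have "a n * exp (2 * of_real pi * \<i> * of_real (real n + \<kappa>) * (z + of_int b / of_nat m)) * k = a' n * exp (2 * of_real pi * \<i> * of_real (real n + \<kappa>) * z)" for n
        unfolding a'_def distrib_left[of _ z] exp_add by (simp only: mult_ac)
      ultimately show "(\<lambda>n. a' n * exp (2 * of_real pi * \<i> * of_real (real n + \<kappa>) * z)) sums slash_scaled f r \<gamma> M z" by simp
    qed
    thus ?thesis using that by (simp add: M_def)
  qed
qed

end

section \<open>Growth of modular forms near the real line\<close>

text \<open>Takes the place of a fundamental domain. Dirichlet approximation of Re z with
  denominators up to about y^(-1/2) gives |k z - h|^2 \<le> y + 4 y, whence the constant 1 /
  5.\<close>

lemma exists_large_Im: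
  assumes "Im z > 0"
  obtains g where "g \<in> SL2Z" "Im (moeb g z) \<ge> 1 / 5"
proof (cases "Im z \<ge> 1 / 5")
  case True
  thus ?thesis by (intro that[of "(1,0,0,1)"]) (auto simp: SL2Z_def)
next
  case False
  define y where "y = Im z"
  have y: "0 < y" "y < 1" using assms False by (auto simp: y_def)
  define s where "s = 1 / sqrt y"
  have s: "s \<ge> 1" using y by (simp add: s_def)
  have s2: "s\<^sup>2 = 1 / y" using y by (simp add: s_def power_divide)
  define N where "N = nat \<lceil>s\<rceil>"
  have N: "real N \<ge> s" "real N \<le> 2 * s" "N > 0" using s unfolding N_def by linarith+
  obtain h k where hk: "coprime h k" "0 < k" "k \<le> int N" "\<bar>of_int k * Re z - of_int h\<bar> < 1 / real N"
    using Dirichlet_approx_coprime[OF N(3), of "Re z"] by blast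
  obtain u v where uv: "u * k + v * h = 1"
    using hk(1) bezout_int[of k h] by (auto simp: gcd.commute coprime_iff_gcd_eq_1)
  have gS: "(- v, - u, k, - h) \<in> SL2Z" using uv by (simp add: SL2Z_def algebra_simps)
  define j where "j = norm (jfac (- v, - u, k, - h) z)"
  have j0: "j > 0" using jfac_nonzero[OF gS assms] by (simp add: j_def)
  have "j\<^sup>2 = (of_int k * Re z - of_int h)\<^sup>2 + (of_int k * y)\<^sup>2"
    by (simp add: j_def cmod_power2 y_def)
  also have "(of_int k * Re z - of_int h)\<^sup>2 \<le> (1 / s)\<^sup>2"
  proof -
    have "1 / real N \<le> 1 / s" using N s by (intro divide_left_mono) auto
    hence "\<bar>of_int k * Re z - of_int h\<bar> \<le> \<bar>1 / s\<bar>" using hk(4) s by simp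
    thus ?thesis by (simp only: abs_le_square_iff)
  qed
  also have "(of_int k * y)\<^sup>2 \<le> (2 * s * y)\<^sup>2"
  proof -
    have "real_of_int k \<le> 2 * s" using hk(3) N(2) by linarith
    thus ?thesis using hk(2) y by (intro power_mono mult_right_mono) auto
  qed
  also have "(1 / s)\<^sup>2 + (2 * s * y)\<^sup>2 = 5 * y"
    using y by (simp add: power_mult_distrib power_divide s2) (simp add: power2_eq_square)
  finally have "j\<^sup>2 \<le> 5 * y" by simp
  hence "y / j\<^sup>2 \<ge> 1 / 5" using j0 by (simp add: field_simps)
  hence "Im (moeb (- v, - u, k, - h) z) \<ge> 1 / 5" using Im_moeb[OF gS assms] by (simp add: j_def y_def)
  with gS show ?thesis by (rule that)
qed

lemma closure_UNIV_I:
  fixes D :: "real set"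
  assumes "\<And>p q e. q > 0 \<Longrightarrow> e > 0 \<Longrightarrow> \<exists>x\<in>D. \<bar>x - of_int p / of_int q\<bar> < e"
  shows "closure D = UNIV"
proof -
  have "\<exists>y\<in>D. dist y x < e" if e: "e > 0" for x e :: real
  proof -
    obtain s where s: "s \<in> \<rat>" "x < s" "s < x + e / 2"
      using Rats_dense_in_real[of x "x + e / 2"] e by auto
    from s(1) obtain p q :: int where pq: "q > 0" "s = of_int p / of_int q" by (rule Rats_cases')
    obtain y where "y \<in> D" "\<bar>y - s\<bar> < e / 2" using assms[OF pq(1), of "e / 2" p] e pq(2) by auto
    moreover from this have "dist y x < e" using s(2,3) unfolding dist_real_def by linarith
    ultimately show ?thesis by blast
  qed
  thus ?thesis by (auto simp: closure_approachable)
qed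

lemma not_tendsto_0_at_rightI:
  fixes \<phi> :: "real \<Rightarrow> real"
  assumes "c > 0" "\<And>d. d > 0 \<Longrightarrow> \<exists>t. 0 < t \<and> t < d \<and> \<phi> t \<ge> c"
  shows "\<not> (\<phi> \<longlongrightarrow> 0) (at_right 0)"
proof
  assume "(\<phi> \<longlongrightarrow> 0) (at_right 0)"
  hence "\<forall>\<^sub>F t in at_right 0. \<phi> t < c" using assms(1) by (rule order_tendstoD)
  then obtain d where "d > 0" "\<And>t. 0 < t \<Longrightarrow> t < d \<Longrightarrow> \<phi> t < c"
    unfolding eventually_at_right_field by auto
  thus False using assms(2)[of d] by fastforce
qed

context modular_setting
begin

text \<open>High up at a cusp the expansion is a constant plus an exponentially small term. For a
  cusp form the constant vanishes, and the exponential beats the factor (Im w)^(r/2).\<close>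

lemma slash_norm_bounded:
  assumes "g \<in> SL2Z" "y0 > 0"
  shows "\<exists>C\<ge>0. \<forall>w. Im w \<ge> y0 \<longrightarrow> slash_norm g w \<le> C \<and> (cusp_form \<Gamma> r f \<longrightarrow> Im w powr (r / 2) * slash_norm g w \<le> C)"
proof -
  obtain \<delta> where \<delta>: "admissible_scaling \<delta>" "\<delta> \<in> SL2Z" "\<And>z. slash_norm \<delta> z = slash_norm g z"
    using exists_admissible[OF assms(1)] by blast
  define M where "M = cusp_width \<Gamma> \<delta>"
  have M: "M > 0" using cusp_width_props(1)[OF \<delta>(2)] by (simp add: M_def)
  obtain \<kappa>' a' where exp: "has_expansion (slash_scaled f r \<delta> M) \<kappa>' a'"
    using expansions_exist[OF \<delta>(1)] unfolding M_def by blast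
  define k where "k = (if \<kappa>' = 0 then a' 0 else 0)"
  have k0: "k = 0" if "cusp_form \<Gamma> r f"
  proof -
    have "\<kappa>' > 0 \<or> a' 0 = 0" using that \<delta>(1) exp unfolding cusp_form_def M_def by blast
    thus ?thesis by (auto simp: k_def)
  qed
  have yM: "y0 / real M > 0" using assms(2) M by simp
  obtain C c where C: "C \<ge> 0" "c > 0" "\<And>z. Im z \<ge> y0 / real M \<Longrightarrow> norm (slash_scaled f r \<delta> M z - k) \<le> C * exp (- c * Im z)"
    using expansion_decay[OF exp yM] unfolding k_def by blast
  define P where "P = real M powr (- (r / 2))"
  have bound: "slash_norm g w \<le> (norm k + C * exp (- (c / real M) * Im w)) * P" if w: "Im w \<ge> y0" for w
  proof -
    define z where "z = w / of_nat M"
    have Mz: "of_nat M * z = w" using M by (simp add: z_def)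
    have Imz: "Im z = Im w / real M" by (simp add: z_def Im_divide_of_nat)
    have "norm (slash_scaled f r \<delta> M z - k) \<le> C * exp (- c * Im z)"
      using w M by (intro C(3)) (simp add: Imz divide_right_mono)
    hence "norm (slash_scaled f r \<delta> M z) \<le> norm k + C * exp (- c * Im z)"
      using norm_triangle_sub[of "slash_scaled f r \<delta> M z" k] by linarith
    hence "slash_norm g w * real M powr (r / 2) \<le> norm k + C * exp (- (c / real M) * Im w)"
      unfolding norm_slash_scaled[OF M] Mz \<delta>(3) by (simp add: Imz)
    hence "(slash_norm g w * real M powr (r / 2)) * P \<le> (norm k + C * exp (- (c / real M) * Im w)) * P"
      by (intro mult_right_mono) (auto simp: P_def)
    thus ?thesis using M by (simp add: P_def mult.assoc powr_add[symmetric])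
  qed
  define L where "L = ((r / 2) / (c / real M)) powr (r / 2) * exp (- (c / real M) * ((r / 2) / (c / real M)))"
  define K where "K = (norm k + C) * P + C * L * P"
  have P: "P \<ge> 0" and L: "L \<ge> 0" by (simp_all add: P_def L_def)
  have K_parts: "(norm k + C) * P \<ge> 0" "C * L * P \<ge> 0" using C(1) P L by auto
  have "K \<ge> 0" unfolding K_def using K_parts by linarith
  moreover have "slash_norm g w \<le> K \<and> (cusp_form \<Gamma> r f \<longrightarrow> Im w powr (r / 2) * slash_norm g w \<le> K)" if w: "Im w \<ge> y0" for w
  proof (intro conjI impI)
    have Im: "Im w > 0" using w assms(2) by simp
    have "exp (- (c / real M) * Im w) \<le> 1" using C(2) M Im by simp
    hence "C * exp (- (c / real M) * Im w) \<le> C" using C(1) by (intro mult_left_le) auto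
    hence "(norm k + C * exp (- (c / real M) * Im w)) * P \<le> (norm k + C) * P"
      using P by (intro mult_right_mono) auto
    thus "slash_norm g w \<le> K" using bound[OF w] K_parts(2) unfolding K_def by linarith
    assume "cusp_form \<Gamma> r f"
    hence "slash_norm g w \<le> C * exp (- (c / real M) * Im w) * P" using bound[OF w] k0 by simp
    hence "Im w powr (r / 2) * slash_norm g w \<le> Im w powr (r / 2) * (C * exp (- (c / real M) * Im w) * P)"
      by (intro mult_left_mono) auto
    also have "\<dots> = C * (Im w powr (r / 2) * exp (- (c / real M) * Im w)) * P" by (simp only: mult_ac)
    also have "\<dots> \<le> C * L * P"
      unfolding L_def using C M Im r_pos P by (intro mult_right_mono mult_left_mono powr_exp_le_max) auto
    finally show "Im w powr (r / 2) * slash_norm g w \<le> K" using K_parts(1) unfolding K_def by linarith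
  qed
  ultimately show ?thesis by blast
qed

text \<open>\<open>slash_norm\<close> depends only on the coset \<Gamma> g, so finitely many
  constants suffice and their sum serves for all.\<close>

lemma slash_norm_uniformly_bounded:
  assumes "y0 > 0"
  obtains C where "C \<ge> 0" "\<And>g w. g \<in> SL2Z \<Longrightarrow> Im w \<ge> y0 \<Longrightarrow> slash_norm g w \<le> C"
    "\<And>g w. g \<in> SL2Z \<Longrightarrow> Im w \<ge> y0 \<Longrightarrow> cusp_form \<Gamma> r f \<Longrightarrow> Im w powr (r / 2) * slash_norm g w \<le> C"
proof -
  obtain R where R: "finite R" "R \<subseteq> SL2Z" "\<And>g. g \<in> SL2Z \<Longrightarrow> \<exists>\<rho>\<in>R. \<exists>\<gamma>\<in>\<Gamma>. g = mmul \<gamma> \<rho>"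
    using right_cosets by blast
  have "\<forall>\<rho>\<in>R. \<exists>C\<ge>0. \<forall>w. Im w \<ge> y0 \<longrightarrow> slash_norm \<rho> w \<le> C \<and> (cusp_form \<Gamma> r f \<longrightarrow> Im w powr (r / 2) * slash_norm \<rho> w \<le> C)"
    using slash_norm_bounded[OF _ assms] R(2) by blast
  then obtain C where C: "\<And>\<rho>. \<rho> \<in> R \<Longrightarrow> C \<rho> \<ge> 0"
    "\<And>\<rho> w. \<rho> \<in> R \<Longrightarrow> Im w \<ge> y0 \<Longrightarrow> slash_norm \<rho> w \<le> C \<rho>"
    "\<And>\<rho> w. \<rho> \<in> R \<Longrightarrow> Im w \<ge> y0 \<Longrightarrow> cusp_form \<Gamma> r f \<Longrightarrow> Im w powr (r / 2) * slash_norm \<rho> w \<le> C \<rho>"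
    by metis
  have C_le: "C \<rho> \<le> sum C R" if "\<rho> \<in> R" for \<rho> using that R(1) C(1) by (intro member_le_sum) auto
  have reduce: "\<exists>\<rho>\<in>R. slash_norm g w = slash_norm \<rho> w" if gw: "g \<in> SL2Z" "Im w \<ge> y0" for g w
  proof -
    obtain \<rho> \<gamma> where "\<rho> \<in> R" "\<gamma> \<in> \<Gamma>" "g = mmul \<gamma> \<rho>" using R(3)[OF gw(1)] by blast
    thus ?thesis using slash_norm_transform[of \<gamma> \<rho> w] R(2) gw(2) assms by (intro bexI[of _ \<rho>]) auto
  qed
  show ?thesis
  proof (rule that[of "sum C R"])
    show "sum C R \<ge> 0" using C(1) by (rule sum_nonneg)
    fix g w assume gw: "g \<in> SL2Z" "Im w \<ge> y0"
    then obtain \<rho> where \<rho>: "\<rho> \<in> R" "slash_norm g w = slash_norm \<rho> w" using reduce by blast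
    show "slash_norm g w \<le> sum C R" using C(2)[OF \<rho>(1) gw(2)] C_le[OF \<rho>(1)] \<rho>(2) by linarith
    assume "cusp_form \<Gamma> r f"
    thus "Im w powr (r / 2) * slash_norm g w \<le> sum C R" using C(3)[OF \<rho>(1) gw(2)] C_le[OF \<rho>(1)] \<rho>(2) by force
  qed
qed

text \<open>z is moved to height at least 1 / 5 and the bound there is carried back. In general |j|
  \<ge> Im z gives Im w / Im z \<le> (Im z)^(-2), hence exponent r; for a cusp form the power of Im
  w is absorbed by the stronger bound, and only (Im z)^(-r/2) remains.\<close>

lemma growth_bounds:
  obtains C where "C \<ge> 0"
    "\<And>z. 0 < Im z \<Longrightarrow> Im z \<le> 1 \<Longrightarrow> norm (f z) \<le> C * Im z powr (- r)"
    "\<And>z. 0 < Im z \<Longrightarrow> cusp_form \<Gamma> r f \<Longrightarrow> norm (f z) \<le> C * Im z powr (- (r / 2))"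
proof -
  obtain C where C: "C \<ge> 0" "\<And>g w. g \<in> SL2Z \<Longrightarrow> Im w \<ge> 1 / 5 \<Longrightarrow> slash_norm g w \<le> C"
    "\<And>g w. g \<in> SL2Z \<Longrightarrow> Im w \<ge> 1 / 5 \<Longrightarrow> cusp_form \<Gamma> r f \<Longrightarrow> Im w powr (r / 2) * slash_norm g w \<le> C"
    using slash_norm_uniformly_bounded[of "1 / 5"] by auto
  show ?thesis
  proof (rule that[OF C(1)])
    fix z assume z: "0 < Im z"
    obtain g where g: "g \<in> SL2Z" "Im (moeb g z) \<ge> 1 / 5" using exists_large_Im[OF z] by blast
    define w where "w = moeb g z"
    have w: "Im w \<ge> 1 / 5" using g by (simp add: w_def)
    have eq: "norm (f z) = slash_norm (minv g) w * (Im w / Im z) powr (r / 2)"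
      unfolding w_def by (rule norm_f_eq_slash_norm[OF g(1) z])
    show "norm (f z) \<le> C * Im z powr (- r)" if z1: "Im z \<le> 1"
    proof -
      define j where "j = norm (jfac g z)"
      obtain a b c d where g': "g = (a,b,c,d)" by (cases g) auto
      have j0: "j > 0" using jfac_nonzero[OF g(1) z] by (simp add: j_def)
      have "Im z \<le> j"
      proof (cases "c = 0")
        case True
        hence "d = 1 \<or> d = -1" using g(1) by (auto simp: g' SL2Z_def zmult_eq_1_iff)
        hence "j = 1" using True by (auto simp: j_def g')
        thus ?thesis using z1 by simp
      next
        case False
        hence "1 \<le> \<bar>real_of_int c\<bar>" by linarith
        hence "1 * Im z \<le> \<bar>real_of_int c\<bar> * Im z" using z by (intro mult_right_mono) auto
        moreover have "\<bar>Im (jfac g z)\<bar> \<le> j" unfolding j_def by (rule abs_Im_le_cmod)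
        moreover have "\<bar>Im (jfac g z)\<bar> = \<bar>real_of_int c\<bar> * Im z" using z by (simp add: g' abs_mult)
        ultimately show ?thesis by linarith
      qed
      hence "Im w / Im z \<le> 1 / (Im z)\<^sup>2"
      proof -
        assume "Im z \<le> j"
        have "Im w / Im z = 1 / j\<^sup>2" using z by (simp add: w_def Im_moeb[OF g(1) z] j_def)
        also have "\<dots> \<le> 1 / (Im z)\<^sup>2" using \<open>Im z \<le> j\<close> z j0 by (intro divide_left_mono power_mono mult_pos_pos) auto
        finally show ?thesis .
      qed
      hence "(Im w / Im z) powr (r / 2) \<le> (1 / (Im z)\<^sup>2) powr (r / 2)"
        using w z r_pos by (intro powr_mono2) auto
      also have "(1 / (Im z)\<^sup>2) powr (r / 2) = Im z powr (- r)"
      proof -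
        have "1 / (Im z)\<^sup>2 = Im z powr (- 2)" using z by (simp add: powr_minus_divide)
        thus ?thesis by (simp only: powr_powr) simp
      qed
      finally show ?thesis unfolding eq using C(2)[OF minv_SL2Z[OF g(1)] w] slash_norm_nonneg C(1)
        by (intro mult_mono) auto
    qed
    show "norm (f z) \<le> C * Im z powr (- (r / 2))" if "cusp_form \<Gamma> r f"
    proof -
      have "norm (f z) = (Im w powr (r / 2) * slash_norm (minv g) w) * Im z powr (- (r / 2))"
        unfolding eq powr_divide powr_minus[of _ "r / 2"] divide_inverse[of "Im w powr (r / 2)"] by (simp only: mult_ac)
      also have "\<dots> \<le> C * Im z powr (- (r / 2))"
        using C(3)[OF minv_SL2Z[OF g(1)] w that] by (intro mult_right_mono) auto
      finally show ?thesis .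
    qed
  qed
qed

end

section \<open>Singular points\<close>

context modular_setting
begin

text \<open>Let x = A / C be an image of the non-cuspidal cusp. The inverse matrix takes x + i t to
  height 1 / (C^2 t), which tends to infinity, and there |f|\<gamma>| stays above a positive
  constant. Carrying this back shows that |f(x + i t)| is at least a multiple of t^(-r).\<close>

lemma singular_points_noncusp:
  assumes "\<not> cusp_form \<Gamma> r f"
  obtains D :: "real set" where "closure D = UNIV"
    "\<And>x. x \<in> D \<Longrightarrow> \<not> ((\<lambda>t. t powr r * norm (f (Complex x t))) \<longlongrightarrow> 0) (at_right 0)"
proof -
  obtain \<gamma> \<kappa>' a' where \<gamma>: "admissible_scaling \<gamma>"
    and exp: "has_expansion (slash_scaled f r \<gamma> (cusp_width \<Gamma> \<gamma>)) \<kappa>' a'" and a0: "a' 0 \<noteq> 0" and \<kappa>': "\<not> \<kappa>' > 0"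
    using assms unfolding cusp_form_def by blast
  have \<kappa>0: "\<kappa>' = 0" using exp \<kappa>' by (auto simp: has_expansion_def)
  obtain A0 B0 C0 E0 where \<gamma>_eq: "\<gamma> = (A0,B0,C0,E0)" by (cases \<gamma>) auto
  have \<gamma>S: "\<gamma> \<in> SL2Z" using \<gamma> by (simp add: \<gamma>_eq)
  define M where "M = cusp_width \<Gamma> \<gamma>"
  have M: "M > 0" using cusp_width_props(1)[OF \<gamma>S] by (simp add: M_def)
  obtain C c where C: "C \<ge> 0" "c > 0" "\<And>z. Im z \<ge> 1 \<Longrightarrow> norm (slash_scaled f r \<gamma> M z - a' 0) \<le> C * exp (- c * Im z)"
    using expansion_decay[OF exp, of 1] \<kappa>0 unfolding M_def by auto
  define q where "q = norm (a' 0) / 2"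
  have q: "q > 0" using a0 by (simp add: q_def)
  have "((\<lambda>y. C * exp (- c * y)) \<longlongrightarrow> 0) at_top"
  proof -
    have "filterlim (\<lambda>y. - c * y) at_bot at_top"
      using C(2) by (intro filterlim_tendsto_neg_mult_at_bot[OF tendsto_const]) (auto simp: filterlim_ident)
    hence "((\<lambda>y. exp (- c * y)) \<longlongrightarrow> 0) at_top" by (rule filterlim_compose[OF exp_at_bot])
    thus ?thesis by (rule tendsto_mult_right_zero)
  qed
  hence "\<forall>\<^sub>F y in at_top. C * exp (- c * y) < q" using q by (intro order_tendstoD)
  then obtain Y0 where Y0: "\<And>y. y \<ge> Y0 \<Longrightarrow> C * exp (- c * y) < q" unfolding eventually_at_top_linorder by blast
  define Y where "Y = max Y0 1"
  define c1 where "c1 = q * real M powr (- (r / 2))"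
  have c1: "c1 > 0" using q M by (simp add: c1_def)
  have lower_bound: "slash_norm \<gamma> w \<ge> c1" if w: "Im w \<ge> Y * real M" for w
  proof -
    define z where "z = w / of_nat M"
    have Mz: "of_nat M * z = w" using M by (simp add: z_def)
    have Imz: "Im z \<ge> Y" using w M by (simp add: z_def Im_divide_of_nat field_simps)
    have "norm (slash_scaled f r \<gamma> M z - a' 0) < q" using C(3)[of z] Y0[of "Im z"] Imz by (simp add: Y_def)
    hence "norm (slash_scaled f r \<gamma> M z) \<ge> q"
      using norm_triangle_ineq2[of "a' 0" "slash_scaled f r \<gamma> M z"] by (simp add: q_def norm_minus_commute)
    hence "q * real M powr (- (r / 2)) \<le> (slash_norm \<gamma> w * real M powr (r / 2)) * real M powr (- (r / 2))"
      unfolding norm_slash_scaled[OF M] Mz by (intro mult_right_mono) auto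
    thus ?thesis using M by (simp add: c1_def mult.assoc powr_add[symmetric])
  qed
  define D where "D = {x. \<exists>\<delta>\<in>\<Gamma>. \<exists>A B C E. mmul \<delta> \<gamma> = (A,B,C,E) \<and> C \<noteq> 0 \<and> x = real_of_int A / real_of_int C}"
  have "\<not> ((\<lambda>t. t powr r * norm (f (Complex x t))) \<longlongrightarrow> 0) (at_right 0)" if "x \<in> D" for x
  proof -
    obtain \<delta> A B C E where \<delta>: "\<delta> \<in> \<Gamma>" "mmul \<delta> \<gamma> = (A,B,C,E)" "C \<noteq> 0" "x = real_of_int A / real_of_int C"
      using \<open>x \<in> D\<close> unfolding D_def by blast
    define h where "h = mmul \<delta> \<gamma>"
    have hS: "h \<in> SL2Z" unfolding h_def using \<delta>(1) sub by (intro mmul_SL2Z \<gamma>S) auto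
    define k where "k = \<bar>real_of_int C\<bar>"
    have k: "k > 0" using \<delta>(3) by (simp add: k_def)
    have lower: "t powr r * norm (f (Complex x t)) \<ge> c1 * k powr (- r)" if t: "0 < t" "t \<le> 1 / (k\<^sup>2 * (Y * real M))" for t
    proof -
      define z where "z = Complex x t"
      have z: "Im z > 0" using t by (simp add: z_def)
      have "jfac (minv h) z = Complex 0 (- real_of_int C * t)"
        using \<delta>(3) by (simp add: h_def \<delta>(2) z_def \<delta>(4) complex_eq_iff)
      hence j: "norm (jfac (minv h) z) = k * t" using t by (simp add: k_def abs_mult complex_norm)
      define w where "w = moeb (minv h) z"
      have Imw: "Im w = t / (k * t)\<^sup>2" unfolding w_def Im_moeb[OF minv_SL2Z[OF hS] z] j by (simp add: z_def)
      have YM: "Y * real M > 0" using M by (simp add: Y_def)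
      have "Im w = 1 / (k\<^sup>2 * t)" using t k by (simp add: Imw power2_eq_square)
      also have "\<dots> \<ge> Y * real M"
      proof -
        have "W \<le> 1 / (K * s)" if "s \<le> 1 / (K * W)" "0 < s" "0 < K" "0 < W" for W K s :: real
          using that by (simp add: field_simps)
        moreover have "k\<^sup>2 > 0" using k by simp
        ultimately show ?thesis using t YM by blast
      qed
      finally have w: "Im w \<ge> Y * real M" .
      hence Imw0: "Im w > 0" using YM by linarith
      have "slash_norm h w = slash_norm \<gamma> w" unfolding h_def by (rule slash_norm_transform[OF \<delta>(1) \<gamma>S Imw0])
      hence ge: "slash_norm h w \<ge> c1" using lower_bound[OF w] by simp
      have "norm (f z) = slash_norm h w * (Im w / Im z) powr (r / 2)"
        using norm_f_eq_slash_norm[OF minv_SL2Z[OF hS] z] by (simp add: w_def)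
      also have "(Im w / Im z) powr (r / 2) = (k * t) powr (- r)"
      proof -
        have "Im w / Im z = (k * t) powr (- 2)" using t k by (simp add: Imw z_def powr_minus_divide)
        thus ?thesis by (simp only: powr_powr) simp
      qed
      also have "(k * t) powr (- r) = k powr (- r) * t powr (- r)" by (rule powr_mult)
      finally have "t powr r * norm (f z) = slash_norm h w * k powr (- r) * (t powr r * t powr (- r))" by simp
      also have "t powr r * t powr (- r) = 1" using t by (simp add: powr_add[symmetric])
      finally show ?thesis using ge by (simp add: z_def mult_right_mono)
    qed
    show ?thesis
    proof (rule not_tendsto_0_at_rightI)
      show "c1 * k powr (- r) > 0" using c1 k by simp
      fix d :: real assume d: "d > 0"
      have "1 / (k\<^sup>2 * (Y * real M)) > 0" using k M by (simp add: Y_def)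
      thus "\<exists>t. 0 < t \<and> t < d \<and> c1 * k powr (- r) \<le> t powr r * norm (f (Complex x t))"
        using d by (intro exI[of _ "min (d / 2) (1 / (k\<^sup>2 * (Y * real M)))"] conjI lower) auto
    qed
  qed
  moreover have "closure D = UNIV"
  proof (rule closure_UNIV_I)
    fix p q :: int and e :: real assume q: "q > 0" and e: "e > 0"
    obtain M' :: nat where M': "M' > 0" "\<And>k::nat. parab p q (int (M' * k)) \<in> \<Gamma>"
      using parab_period[of p q] by blast
    \<comment> \<open>The cross determinant of the cusp and p / q is fixed by the parabolic elements
      at p / q, so the distance |s| / (q |C|) shrinks as |C| grows with t. If s = 0 the cusp already
      is p / q.\<close>
    define s where "s = p * C0 - q * A0"
    obtain k :: nat where k: "real k > \<bar>s\<bar> / e + \<bar>real_of_int C0\<bar>" using reals_Archimedean2 by blast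
    define t where "t = int (M' * k)"
    define A where "A = A0 + p * t * s"
    define C where "C = C0 + q * t * s"
    have prod: "mmul (parab p q t) \<gamma> = (A, (1 - p * q * t) * B0 + p\<^sup>2 * t * E0, C, - (q\<^sup>2 * t) * B0 + (1 + p * q * t) * E0)"
      by (simp add: parab_def \<gamma>_eq A_def C_def s_def algebra_simps power2_eq_square)
    have cross: "q * A - p * C = - s" by (simp add: A_def C_def s_def algebra_simps)
    have C_big: "C \<noteq> 0 \<and> \<bar>s\<bar> < e * \<bar>real_of_int C\<bar>"
    proof (cases "s = 0")
      case True
      have "C0 \<noteq> 0"
      proof
        assume "C0 = 0"
        hence "A0 = 0" using True q by (simp add: s_def)
        thus False using \<open>C0 = 0\<close> \<gamma>S by (simp add: \<gamma>_eq SL2Z_def)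
      qed
      thus ?thesis using True e by (simp add: C_def)
    next
      case False
      have "\<bar>q * t * s\<bar> \<ge> int k"
      proof -
        have "q * int M' * \<bar>s\<bar> > 0" using q M'(1) False by (intro mult_pos_pos) auto
        hence "int k * 1 \<le> int k * (q * int M' * \<bar>s\<bar>)" by (intro mult_left_mono) auto
        thus ?thesis using q by (simp add: t_def abs_mult mult_ac)
      qed
      hence "\<bar>real_of_int C\<bar> \<ge> real k - \<bar>real_of_int C0\<bar>" unfolding C_def by linarith
      hence "\<bar>real_of_int C\<bar> > \<bar>s\<bar> / e" using k by linarith
      moreover have "\<bar>s\<bar> / e \<ge> 0" using e by simp
      ultimately have "\<bar>real_of_int C\<bar> > 0" "\<bar>s\<bar> < e * \<bar>real_of_int C\<bar>" using e by (auto simp: field_simps)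
      thus ?thesis by auto
    qed
    hence "real_of_int A / real_of_int C \<in> D" unfolding D_def using M'(2)[of k] prod t_def by blast
    moreover have "\<bar>real_of_int A / real_of_int C - of_int p / of_int q\<bar> < e"
    proof -
      have "real_of_int A / real_of_int C - of_int p / of_int q = of_int (q * A - p * C) / (of_int q * of_int C)"
        using q C_big by (simp add: field_simps)
      hence "\<bar>real_of_int A / real_of_int C - of_int p / of_int q\<bar> = \<bar>real_of_int s\<bar> / (of_int q * \<bar>of_int C\<bar>)"
        unfolding cross using q by (simp add: abs_mult)
      also have "\<dots> \<le> \<bar>real_of_int s\<bar> / (1 * \<bar>of_int C\<bar>)"
        using q C_big by (intro divide_left_mono mult_right_mono) auto
      also have "\<dots> < e" using C_big by (simp add: field_simps)
      finally show ?thesis .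
    qed
    ultimately show "\<exists>x\<in>D. \<bar>x - of_int p / of_int q\<bar> < e" by blast
  qed
  ultimately show ?thesis using that by blast
qed

lemma invariant_norm:
  assumes "\<gamma> \<in> \<Gamma>" "Im z > 0"
  shows "Im (moeb \<gamma> z) powr (r / 2) * norm (f (moeb \<gamma> z)) = Im z powr (r / 2) * norm (f z)"
proof -
  have \<gamma>: "\<gamma> \<in> SL2Z" using assms sub by auto
  define j where "j = norm (jfac \<gamma> z)"
  have j: "j > 0" using jfac_nonzero[OF \<gamma> assms(2)] by (simp add: j_def)
  have "(j\<^sup>2) powr (r / 2) = j powr r"
  proof -
    have "j\<^sup>2 = j powr 2" using j by simp
    thus ?thesis by (simp only: powr_powr) simp
  qed
  thus ?thesis unfolding Im_moeb[OF \<gamma> assms(2)] norm_f_transform[OF assms] j_def[symmetric]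
    using j by (simp add: powr_divide)
qed

text \<open>With u = q z0 - p the automorphy factor is 1 - q t u, of size growing with t. The image
  of z0 differs from p / q by u divided by q times this factor, and its height is Im z0 over the
  factor's squared modulus; both tend to 0.\<close>

lemma parab_orbit_approaches:
  assumes z0: "Im z0 > 0" and q: "q > 0" and e: "e > 0"
  obtains \<gamma> where "\<gamma> \<in> \<Gamma>" "Im (moeb \<gamma> z0) < e" "\<bar>Re (moeb \<gamma> z0) - of_int p / of_int q\<bar> < e"
proof -
  obtain M :: nat where M: "M > 0" "\<And>k::nat. parab p q (int (M * k)) \<in> \<Gamma>"
    using parab_period[of p q] by blast
  define u where "u = of_int q * z0 - of_int p"
  have Imu: "Im u = of_int q * Im z0" by (simp add: u_def)
  \<comment> \<open>Exceeds the three thresholds that the factor has to pass: one for each smallness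
    claim, and 1 so that its square is at least as large as itself. The summand 1 makes the
    inequalities strict.\<close>
  define L where "L = max 1 (max (norm u / e) (Im z0 / e)) + 1"
  obtain k :: nat where k: "real k > L / Im z0" using reals_Archimedean2 by blast
  define t where "t = int (M * k)"
  define \<gamma> where "\<gamma> = parab p q t"
  have \<gamma>: "\<gamma> \<in> \<Gamma>" unfolding \<gamma>_def t_def by (rule M(2))
  have \<gamma>S: "\<gamma> \<in> SL2Z" unfolding \<gamma>_def by (rule parab_SL2Z)
  define den where "den = jfac \<gamma> z0"
  have den: "den = 1 - of_int q * of_int t * u"
    by (simp add: den_def \<gamma>_def parab_def u_def algebra_simps power2_eq_square)
  have den0: "den \<noteq> 0" using jfac_nonzero[OF \<gamma>S z0] by (simp add: den_def)
  have den_ge: "norm den > L"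
  proof -
    have "Im den = - (of_int (q * t * q) * Im z0)" by (simp add: den Imu)
    hence "\<bar>Im den\<bar> = of_int (q * t * q) * Im z0" using q z0 by (simp add: t_def abs_mult)
    moreover have "real_of_int (q * t * q) \<ge> real k"
    proof -
      have "int k * 1 \<le> int k * (q * int M * q)"
        using q M(1) by (intro mult_left_mono) (auto intro!: int_one_le_iff_zero_less[THEN iffD2] mult_pos_pos)
      hence "int k \<le> q * t * q" by (simp add: t_def mult_ac)
      thus ?thesis by (metis of_int_le_iff of_int_of_nat_eq)
    qed
    ultimately have "\<bar>Im den\<bar> \<ge> real k * Im z0" using z0 by (simp add: mult_right_mono)
    moreover have "real k * Im z0 > L" using k z0 by (simp add: field_simps)
    ultimately show ?thesis using abs_Im_le_cmod[of den] by linarith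
  qed
  have L: "L > 1" "L > norm u / e" "L > Im z0 / e" by (auto simp: L_def)
  have "Im (moeb \<gamma> z0) < e"
  proof -
    have "norm den * 1 \<le> norm den * norm den" using den_ge L(1) by (intro mult_left_mono) auto
    hence "(norm den)\<^sup>2 > Im z0 / e" using den_ge L(3) by (simp add: power2_eq_square)
    hence "Im z0 < (norm den)\<^sup>2 * e" using e by (simp add: field_simps)
    hence "Im z0 / (norm den)\<^sup>2 < e" using den0 by (simp add: divide_less_eq mult.commute)
    thus ?thesis using Im_moeb[OF \<gamma>S z0] by (simp add: den_def)
  qed
  moreover have "\<bar>Re (moeb \<gamma> z0) - of_int p / of_int q\<bar> < e"
  proof -
    have q0: "complex_of_int q \<noteq> 0" using q by simp
    define X where "X = of_int (1 - p * q * t) * z0 + of_int (p\<^sup>2 * t)"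
    have "moeb \<gamma> z0 = X / den"
      by (simp add: \<gamma>_def parab_def den_def X_def)
    moreover have "of_int q * X - of_int p * den = u"
      by (simp add: den X_def u_def algebra_simps power2_eq_square)
    moreover have "X / den - of_int p / of_int q = (of_int q * X - of_int p * den) / (of_int q * den)"
      using den0 q0 by (simp add: field_simps)
    ultimately have "moeb \<gamma> z0 - of_int p / of_int q = u / (of_int q * den)" by simp
    hence "norm (moeb \<gamma> z0 - of_int p / of_int q) = norm u / (of_int q * norm den)"
      using q by (simp add: norm_divide norm_mult)
    also have "\<dots> \<le> norm u / (1 * norm den)"
      using q den0 by (intro divide_left_mono mult_right_mono) auto
    also have "\<dots> < e"
    proof -
      have "norm u / e < norm den" using den_ge L(2) by linarith
      thus ?thesis using e den0 by (simp add: field_simps)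
    qed
    finally have "norm (moeb \<gamma> z0 - of_int p / of_int q) < e" .
    moreover have "Re (moeb \<gamma> z0 - of_int p / of_int q) = Re (moeb \<gamma> z0) - of_int p / of_int q"
      by (metis Re_complex_of_real minus_complex.sel(1) of_real_divide of_real_of_int_eq)
    ultimately show ?thesis using abs_Re_le_cmod[of "moeb \<gamma> z0 - of_int p / of_int q"] by linarith
  qed
  ultimately show ?thesis using \<gamma> that by blast
qed

text \<open>\<open>U n\<close> collects the x over which t^(r/2) |f| exceeds c at some height below
  1 / (n + 1). It is open by continuity in x, and dense because the invariant quantity equals 2 c
  along the orbit of \<open>z0\<close>, which comes near every rational. Points common to all
  \<open>U n\<close> see the value c at arbitrarily small heights.\<close>

lemma singular_points_nonzero:
  assumes "Im z0 > 0" "f z0 \<noteq> 0"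
  obtains D :: "real set" where "closure D = UNIV"
    "\<And>x. x \<in> D \<Longrightarrow> \<not> ((\<lambda>t. t powr (r / 2) * norm (f (Complex x t))) \<longlongrightarrow> 0) (at_right 0)"
proof -
  define c where "c = Im z0 powr (r / 2) * norm (f z0) / 2"
  have c: "c > 0" using assms by (simp add: c_def)
  define U where "U n = {x. \<exists>t. 0 < t \<and> t < 1 / real (Suc n) \<and> c < t powr (r / 2) * norm (f (Complex x t))}" for n
  have U_open: "open (U n)" for n
  proof -
    have "open {x. c < t powr (r / 2) * norm (f (Complex x t))}" if "t > 0" for t
    proof -
      have "continuous_on UNIV (\<lambda>x. f (Complex x t))"
        by (rule continuous_on_compose2[OF holomorphic_on_imp_continuous_on[OF f_holomorphic]])
           (use that in \<open>auto intro!: continuous_intros simp: Complex_eq\<close>)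
      thus ?thesis by (intro open_Collect_less continuous_intros)
    qed
    hence "open (\<Union>t\<in>{0<..<1 / real (Suc n)}. {x. c < t powr (r / 2) * norm (f (Complex x t))})" by auto
    moreover have "U n = (\<Union>t\<in>{0<..<1 / real (Suc n)}. {x. c < t powr (r / 2) * norm (f (Complex x t))})"
      by (auto simp: U_def)
    ultimately show ?thesis by simp
  qed
  have U_dense: "closure (U n) = UNIV" for n
  proof (rule closure_UNIV_I)
    fix p q :: int and e :: real assume q: "q > 0" and e: "e > 0"
    have e': "min e (1 / real (Suc n)) > 0" using e by simp
    obtain \<gamma> where \<gamma>: "\<gamma> \<in> \<Gamma>" "Im (moeb \<gamma> z0) < min e (1 / real (Suc n))"
       "\<bar>Re (moeb \<gamma> z0) - of_int p / of_int q\<bar> < min e (1 / real (Suc n))"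
      using parab_orbit_approaches[OF assms(1) q e'] by blast
    have "Im (moeb \<gamma> z0) > 0" using \<gamma>(1) sub assms(1) by (intro Im_moeb_pos) auto
    moreover have "c < Im (moeb \<gamma> z0) powr (r / 2) * norm (f (Complex (Re (moeb \<gamma> z0)) (Im (moeb \<gamma> z0))))"
    proof -
      have "Im (moeb \<gamma> z0) powr (r / 2) * norm (f (moeb \<gamma> z0)) = 2 * c"
        using invariant_norm[OF \<gamma>(1) assms(1)] by (simp add: c_def)
      thus ?thesis using c by simp
    qed
    ultimately have "Re (moeb \<gamma> z0) \<in> U n" using \<gamma>(2) unfolding U_def by auto
    thus "\<exists>x\<in>U n. \<bar>x - of_int p / of_int q\<bar> < e" using \<gamma>(3) by auto
  qed
  have "UNIV \<subseteq> closure (\<Inter>(range U))"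
    by (rule Baire) (use U_open U_dense in auto)
  moreover have "\<not> ((\<lambda>t. t powr (r / 2) * norm (f (Complex x t))) \<longlongrightarrow> 0) (at_right 0)" if x: "x \<in> \<Inter>(range U)" for x
  proof (rule not_tendsto_0_at_rightI[OF c])
    fix d :: real assume "d > 0"
    then obtain n where n: "1 / real (Suc n) < d" using nat_approx_posE by blast
    obtain t where "0 < t" "t < 1 / real (Suc n)" "c < t powr (r / 2) * norm (f (Complex x t))"
      using x unfolding U_def by blast
    thus "\<exists>t. 0 < t \<and> t < d \<and> c \<le> t powr (r / 2) * norm (f (Complex x t))" using n by (intro exI[of _ t]) auto
  qed
  ultimately show ?thesis using that[of "\<Inter>(range U)"] by auto
qed

end

section \<open>Transfer of the abstract results to the series of f\<close>

context modular_setting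
begin

definition tail_coeff :: "nat \<Rightarrow> complex" where
  "tail_coeff = (\<lambda>n. if real n + \<kappa> > 0 then a n else 0)"

definition const_term :: complex where
  "const_term = (if \<kappa> = 0 then a 0 else 0)"

lemma expansion': "has_expansion (\<lambda>z. f (of_real (real m) * z)) \<kappa> a"
  using expansion by simp

sublocale S: half_plane_series tail_coeff \<kappa> "2 * pi / real m"
  unfolding tail_coeff_def using half_plane_series_of_expansion(1)[OF expansion'] m_pos by simp

lemma f_eq_H: "t > 0 \<Longrightarrow> f (Complex x t) = S.H x t + const_term"
  unfolding tail_coeff_def const_term_def using half_plane_series_of_expansion(2)[OF expansion'] m_pos by simp

lemma \<kappa>_range: "0 \<le> \<kappa>" "\<kappa> < 1"
  using expansion by (auto simp: has_expansion_def)

lemma frac_term_eq: "frac_term a \<kappa> \<alpha> m n y = S.fterm \<alpha> y n"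
proof -
  have "exp (2 * of_real pi * \<i> * of_real ((real n + \<kappa>) * y / real m)) = cis (2 * pi / real m * (real n + \<kappa>) * y)"
    unfolding cis_conv_exp by (rule arg_cong[of _ _ exp]) (simp add: mult_ac)
  moreover have "tail_coeff n = (if real n + \<kappa> > 0 then a n else 0)" by (simp add: tail_coeff_def)
  ultimately show ?thesis unfolding frac_term_def S.fterm_def by simp
qed

definition critical_exponent :: real where
  "critical_exponent = (if cusp_form \<Gamma> r f then r / 2 else r)"

lemma critical_exponent_pos: "critical_exponent > 0"
  using r_pos by (simp add: critical_exponent_def)

text \<open>For t \<le> 1 the constant term is harmless, since t^(-\<open>critical_exponent\<close>)
  is at least 1 there; for t > 1 exponential decay of H is compared with the same power.\<close>

lemma H_growth:
  obtains B where "half_plane_series_growth tail_coeff \<kappa> (2 * pi / real m) critical_exponent B"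
proof -
  define \<omega> where "\<omega> = 2 * pi / real m"
  obtain C where C: "C \<ge> 0"
    "\<And>z. 0 < Im z \<Longrightarrow> Im z \<le> 1 \<Longrightarrow> norm (f z) \<le> C * Im z powr (- r)"
    "\<And>z. 0 < Im z \<Longrightarrow> cusp_form \<Gamma> r f \<Longrightarrow> norm (f z) \<le> C * Im z powr (- (r / 2))"
    using growth_bounds by blast
  have p: "\<omega> * S.\<nu>0 > 0" unfolding \<omega>_def by (intro mult_pos_pos S.\<omega>_pos S.\<nu>0_pos)
  obtain K where K: "K > 0" "\<And>t. t > 0 \<Longrightarrow> exp (- (\<omega> * S.\<nu>0) * t) \<le> K * t powr (- critical_exponent)"
    using exp_decay_le_powr[OF p critical_exponent_pos] by blast
  define L where "L = S.majorant 1 * exp (\<omega> * S.\<nu>0 * 1) * K"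
  have L: "L \<ge> 0" using S.majorant_nonneg[of 1] K(1) by (simp add: L_def)
  have "norm (S.H x t) \<le> (C + norm const_term + L) * t powr (- critical_exponent)" if t: "t > 0" for x t
  proof (cases "t \<le> 1")
    case True
    have "norm (f (Complex x t)) \<le> C * t powr (- critical_exponent)"
      using C(2)[of "Complex x t"] C(3)[of "Complex x t"] t True by (auto simp: critical_exponent_def)
    moreover have "norm const_term * 1 \<le> norm const_term * t powr (- critical_exponent)"
    proof (rule mult_left_mono)
      show "1 \<le> t powr (- critical_exponent)"
        using powr_mono2'[of "- critical_exponent" t 1] critical_exponent_pos t True by simp
    qed simp
    moreover have "norm (S.H x t) \<le> norm (f (Complex x t)) + norm const_term"
      using norm_triangle_ineq4[of "f (Complex x t)" const_term] by (simp add: f_eq_H[OF t])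
    moreover have "L * t powr (- critical_exponent) \<ge> 0" using L by simp
    ultimately show ?thesis by (simp add: distrib_right)
  next
    case False
    hence t1: "1 \<le> t" by simp
    have "norm (S.H x t) \<le> S.majorant 1 * exp (- \<omega> * S.\<nu>0 * (t - 1))"
      unfolding \<omega>_def using t1 by (intro S.norm_H_le) auto
    also have "\<dots> = S.majorant 1 * exp (\<omega> * S.\<nu>0 * 1) * exp (- (\<omega> * S.\<nu>0) * t)"
      unfolding exp_shift by simp
    also have "\<dots> \<le> S.majorant 1 * exp (\<omega> * S.\<nu>0 * 1) * (K * t powr (- critical_exponent))"
      using S.majorant_nonneg[of 1] by (intro mult_left_mono K t) auto
    also have "\<dots> = L * t powr (- critical_exponent)" by (simp add: L_def)
    also have "\<dots> \<le> (C + norm const_term + L) * t powr (- critical_exponent)"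
      using C(1) by (intro mult_right_mono) auto
    finally show ?thesis .
  qed
  hence "half_plane_series_growth tail_coeff \<kappa> (2 * pi / real m) critical_exponent (C + norm const_term + L)"
    by unfold_locales (use critical_exponent_pos in auto)
  thus ?thesis by (rule that)
qed

text \<open>f and H differ by a constant, which after multiplication by a positive power of t tends
  to 0; so both have the same singular points.\<close>

lemma dense_singular_points:
  assumes "\<exists>z. Im z > 0 \<and> f z \<noteq> 0"
  obtains D :: "real set" where "closure D = UNIV"
    "\<And>x. x \<in> D \<Longrightarrow> \<not> ((\<lambda>t. t powr critical_exponent * norm (S.H x t)) \<longlongrightarrow> 0) (at_right 0)"
proof -
  obtain D :: "real set" where D: "closure D = UNIV"
    "\<And>x. x \<in> D \<Longrightarrow> \<not> ((\<lambda>t. t powr critical_exponent * norm (f (Complex x t))) \<longlongrightarrow> 0) (at_right 0)"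
  proof (cases "cusp_form \<Gamma> r f")
    case True
    obtain z0 where "Im z0 > 0" "f z0 \<noteq> 0" using assms by blast
    from singular_points_nonzero[OF this] that True show ?thesis
      unfolding critical_exponent_def by auto
  next
    case False
    from singular_points_noncusp[OF this] that False show ?thesis
      unfolding critical_exponent_def by auto
  qed
  have "\<not> ((\<lambda>t. t powr critical_exponent * norm (S.H x t)) \<longlongrightarrow> 0) (at_right 0)" if x: "x \<in> D" for x
  proof
    assume H0: "((\<lambda>t. t powr critical_exponent * norm (S.H x t)) \<longlongrightarrow> 0) (at_right 0)"
    have "((\<lambda>t. t powr critical_exponent * norm const_term) \<longlongrightarrow> 0) (at_right (0::real))"
      by (rule powr_tendsto_0_at_right_0[OF critical_exponent_pos])
    from tendsto_add[OF H0 this]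
    have sum0: "((\<lambda>t. t powr critical_exponent * norm (S.H x t) + t powr critical_exponent * norm const_term) \<longlongrightarrow> 0) (at_right 0)" by simp
    have "((\<lambda>t. t powr critical_exponent * norm (f (Complex x t))) \<longlongrightarrow> 0) (at_right 0)"
    proof (rule Lim_null_comparison[OF _ sum0])
      show "\<forall>\<^sub>F t in at_right 0. norm (t powr critical_exponent * norm (f (Complex x t))) \<le>
          t powr critical_exponent * norm (S.H x t) + t powr critical_exponent * norm const_term"
        using eventually_at_right_less
      proof eventually_elim
        case (elim t)
        have "t powr critical_exponent * norm (f (Complex x t)) \<le> t powr critical_exponent * (norm (S.H x t) + norm const_term)"
          using elim by (intro mult_left_mono) (auto simp: f_eq_H norm_triangle_ineq)
        thus ?case by (simp add: distrib_left)
      qed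
    qed
    thus False using D(2)[OF x] by blast
  qed
  with D(1) show ?thesis by (rule that)
qed

text \<open>Rationality is assumed for the expansions of \<open>slash_scaled\<close>; at the
  identity matrix this differs from f(m z) only by a constant factor, which leaves \<kappa>
  unchanged.\<close>

lemma \<kappa>_rational:
  assumes "rational_kappas \<Gamma> r f"
  obtains qd p :: nat where "qd > 0" "\<kappa> * real qd = real p"
proof -
  define k where "k = 1 / complex_of_real (1 / sqrt (real m)) powr of_real r"
  have "has_expansion (slash_scaled f r (1,0,0,1) m) \<kappa> (\<lambda>n. a n * k)"
    unfolding has_expansion_def
  proof (intro conjI \<kappa>_range allI impI)
    fix z assume "Im z > 0"
    hence "(\<lambda>n. a n * exp (2 * of_real pi * \<i> * of_real (real n + \<kappa>) * z) * k) sums (f (of_nat m * z) * k)"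
      using expansion by (intro sums_mult2) (auto simp: has_expansion_def)
    thus "(\<lambda>n. a n * k * exp (2 * of_real pi * \<i> * of_real (real n + \<kappa>) * z)) sums slash_scaled f r (1,0,0,1) m z"
      by (simp add: k_def mult_ac)
  qed
  moreover have "admissible_scaling (1,0,0,1)" by (simp add: SL2Z_def)
  ultimately have "\<kappa> \<in> \<rat>" using assms unfolding rational_kappas_def m_def by blast
  then obtain p q :: int where pq: "q > 0" "\<kappa> = of_int p / of_int q" by (rule Rats_cases')
  have "p \<ge> 0" using \<kappa>_range(1) pq by (simp add: zero_le_divide_iff)
  with pq show ?thesis by (intro that[of "nat q" "nat p"]) auto
qed

theorem divergence_on_dense_set:
  assumes "\<exists>z. Im z > 0 \<and> f z \<noteq> 0" "\<alpha> > 0" "\<alpha> \<le> critical_exponent"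
  shows "\<exists>D::real set. closure D = UNIV \<and> (\<forall>y\<in>D. \<not> summable (\<lambda>n. frac_term a \<kappa> \<alpha> m n y))"
proof -
  obtain D :: "real set" where D: "closure D = UNIV"
    "\<And>x. x \<in> D \<Longrightarrow> \<not> ((\<lambda>t. t powr critical_exponent * norm (S.H x t)) \<longlongrightarrow> 0) (at_right 0)"
    using dense_singular_points[OF assms(1)] by blast
  have "\<not> summable (\<lambda>n. frac_term a \<kappa> \<alpha> m n y)" if y: "y \<in> D" for y
  proof
    assume "summable (\<lambda>n. frac_term a \<kappa> \<alpha> m n y)"
    hence "summable (S.fterm \<alpha> y)" by (simp add: frac_term_eq)
    from S.convergence_imp_small_growth[OF assms(2) this]
    have lim: "((\<lambda>t. t powr \<alpha> * norm (S.H y t)) \<longlongrightarrow> 0) (at_right 0)" .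
    have "((\<lambda>t. t powr critical_exponent * norm (S.H y t)) \<longlongrightarrow> 0) (at_right 0)"
    proof (rule Lim_null_comparison[OF _ lim])
      show "\<forall>\<^sub>F t in at_right 0. norm (t powr critical_exponent * norm (S.H y t)) \<le> t powr \<alpha> * norm (S.H y t)"
        using eventually_at_right_real[of 0 "1::real"]
      proof (rule eventually_mono)
        fix t :: real assume "t \<in> {0<..<1}"
        hence "t powr critical_exponent \<le> t powr \<alpha>" using assms(3) by (intro powr_mono') auto
        thus "norm (t powr critical_exponent * norm (S.H y t)) \<le> t powr \<alpha> * norm (S.H y t)"
          by (simp add: mult_right_mono)
      qed simp
    qed
    thus False using D(2)[OF y] by blast
  qed
  with D(1) show ?thesis by blast
qed

theorem nowhere_C1:
  assumes nz: "\<exists>z. Im z > 0 \<and> f z \<noteq> 0" and rat: "rational_kappas \<Gamma> r f"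
    and \<alpha>: "\<alpha> > critical_exponent" "\<alpha> \<le> critical_exponent + 1" and uv: "u < v"
  shows "\<not> Ck {u<..<v} 1 0 (S.frac_integral \<alpha>)"
    and "\<not> Ck {u<..<v} 1 0 (\<lambda>y. Re (S.frac_integral \<alpha> y))"
    and "\<not> Ck {u<..<v} 1 0 (\<lambda>y. Im (S.frac_integral \<alpha> y))"
proof -
  let ?g = "S.frac_integral \<alpha>"
  obtain B where "half_plane_series_growth tail_coeff \<kappa> (2 * pi / real m) critical_exponent B"
    using H_growth by blast
  then interpret G: half_plane_series_growth tail_coeff \<kappa> "2 * pi / real m" critical_exponent B .
  obtain qd p :: nat where qd: "qd > 0" "\<kappa> * real qd = real p" using \<kappa>_rational[OF rat] by blast
  obtain D :: "real set" where D: "closure D = UNIV"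
    "\<And>x. x \<in> D \<Longrightarrow> \<not> ((\<lambda>t. t powr critical_exponent * norm (S.H x t)) \<longlongrightarrow> 0) (at_right 0)"
    using dense_singular_points[OF nz] by blast
  have "(u + v) / 2 \<in> closure D" using D(1) by simp
  then obtain x where x: "x \<in> D" "dist x ((u + v) / 2) < (v - u) / 2"
    using uv unfolding closure_approachable by (meson diff_gt_0_iff_gt half_gt_zero)
  have xuv: "x \<in> {u<..<v}" using x(2) by (auto simp: dist_real_def abs_less_iff field_simps)
  \<comment> \<open>The function, its real part and its imaginary part are the combinations with (P,
    Q) = (1, 0), (1/2, 1/2) and (-i/2, i/2); in each P is nonzero.\<close>
  have not_diff: False
    if "P \<noteq> 0" "((\<lambda>y. P * ?g y + Q * cnj (?g y)) has_vector_derivative G') (at x)" for P Q G'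
    using G.differentiable_imp_small_growth[OF \<alpha> qd that] D(2)[OF x(1)] by blast
  have C1D: "\<exists>d. (h has_vector_derivative d) (at x)" if "Ck {u<..<v} 1 0 h" for h :: "real \<Rightarrow> 'c::real_normed_vector"
    using that xuv unfolding Ck_def derivs_upto_def by auto
  show "\<not> Ck {u<..<v} 1 0 ?g"
    using C1D[of ?g] not_diff[of 1 0] by auto
  show "\<not> Ck {u<..<v} 1 0 (\<lambda>y. Re (?g y))"
  proof
    assume "Ck {u<..<v} 1 0 (\<lambda>y. Re (?g y))"
    then obtain d where "((\<lambda>y. Re (?g y)) has_vector_derivative d) (at x)" using C1D by blast
    hence "((\<lambda>y. complex_of_real (Re (?g y))) has_vector_derivative of_real d) (at x)"
      by (intro has_vector_derivative_of_real) (simp add: has_real_derivative_iff_has_vector_derivative)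
    moreover have "(\<lambda>y. complex_of_real (Re (?g y))) = (\<lambda>y. 1/2 * ?g y + 1/2 * cnj (?g y))"
      by (simp add: fun_eq_iff complex_eq_iff)
    ultimately show False using not_diff[of "1/2" "1/2"] by simp
  qed
  show "\<not> Ck {u<..<v} 1 0 (\<lambda>y. Im (?g y))"
  proof
    assume "Ck {u<..<v} 1 0 (\<lambda>y. Im (?g y))"
    then obtain d where "((\<lambda>y. Im (?g y)) has_vector_derivative d) (at x)" using C1D by blast
    hence "((\<lambda>y. complex_of_real (Im (?g y))) has_vector_derivative of_real d) (at x)"
      by (intro has_vector_derivative_of_real) (simp add: has_real_derivative_iff_has_vector_derivative)
    moreover have "(\<lambda>y. complex_of_real (Im (?g y))) = (\<lambda>y. (- \<i> / 2) * ?g y + (\<i> / 2) * cnj (?g y))"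
      by (simp add: fun_eq_iff complex_eq_iff)
    ultimately show False using not_diff[of "- \<i> / 2" "\<i> / 2"] by simp
  qed
qed

end

theorem theorem1:
  fixes \<Gamma> :: "mat2 set" and \<mu> :: "mat2 \<Rightarrow> complex" and r \<alpha> \<kappa> :: real
    and f :: "complex \<Rightarrow> complex" and a :: "nat \<Rightarrow> complex" and m :: nat
  assumes "finite_index_subgroup \<Gamma>"
    and "r > 0"
    and "modular_form \<Gamma> \<mu> r f"
    and "\<exists>z. Im z > 0 \<and> f z \<noteq> 0"
    and "rational_kappas \<Gamma> r f"
    and "m = cusp_width \<Gamma> (1,0,0,1)"
    and "has_expansion (\<lambda>z. f (of_nat m * z)) \<kappa> a"
    and "\<alpha> > 0"
  defines "\<alpha>\<^sub>0 \<equiv> (if cusp_form \<Gamma> r f then r / 2 else r)"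
  shows
    "(\<alpha> \<le> \<alpha>\<^sub>0 \<longrightarrow>
        (\<exists>D::real set. closure D = UNIV \<and>
           (\<forall>y\<in>D. \<not> summable (\<lambda>n. frac_term a \<kappa> \<alpha> m n y)))) \<and>
     (\<alpha> > \<alpha>\<^sub>0 \<longrightarrow>
        (\<exists>g :: real \<Rightarrow> complex.
           uniform_limit UNIV (\<lambda>N y. \<Sum>n<N. frac_term a \<kappa> \<alpha> m n y) g sequentially \<and>
           continuous_on UNIV g \<and>
           (\<alpha> - \<alpha>\<^sub>0 \<notin> \<int> \<longrightarrow> Ck UNIV (nat \<lfloor>\<alpha> - \<alpha>\<^sub>0\<rfloor>) (frac (\<alpha> - \<alpha>\<^sub>0)) g) \<and>
           (\<alpha> - \<alpha>\<^sub>0 \<in> \<int> \<longrightarrow> Ck_log UNIV (nat (\<lfloor>\<alpha> - \<alpha>\<^sub>0\<rfloor> - 1)) 1 g) \<and>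
           (\<alpha> - \<alpha>\<^sub>0 \<le> 1 \<longrightarrow>
              (\<forall>u v. u < v \<longrightarrow>
                 \<not> Ck {u<..<v} 1 0 g \<and>
                 \<not> Ck {u<..<v} 1 0 (\<lambda>y. Re (g y)) \<and>
                 \<not> Ck {u<..<v} 1 0 (\<lambda>y. Im (g y))))))"
proof -
  interpret modular_setting \<Gamma> \<mu> r \<kappa> f a m
    by unfold_locales (use assms in auto)
  have \<alpha>0: "\<alpha>\<^sub>0 = critical_exponent" by (simp add: assms(9) critical_exponent_def)
  obtain B where "half_plane_series_growth tail_coeff \<kappa> (2 * pi / real m) critical_exponent B"
    using H_growth by blast
  then interpret G: half_plane_series_growth tail_coeff \<kappa> "2 * pi / real m" critical_exponent B .
  show ?thesis unfolding \<alpha>0 frac_term_eq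
  proof (intro conjI impI)
    assume "\<alpha> \<le> critical_exponent"
    thus "\<exists>D::real set. closure D = UNIV \<and> (\<forall>y\<in>D. \<not> summable (\<lambda>n. S.fterm \<alpha> y n))"
      using divergence_on_dense_set[OF assms(4,8)] by (simp add: frac_term_eq)
  next
    assume "\<alpha> > critical_exponent"
    then show "\<exists>g :: real \<Rightarrow> complex.
           uniform_limit UNIV (\<lambda>N y. \<Sum>n<N. S.fterm \<alpha> y n) g sequentially \<and>
           continuous_on UNIV g \<and>
           (\<alpha> - critical_exponent \<notin> \<int> \<longrightarrow> Ck UNIV (nat \<lfloor>\<alpha> - critical_exponent\<rfloor>) (frac (\<alpha> - critical_exponent)) g) \<and>
           (\<alpha> - critical_exponent \<in> \<int> \<longrightarrow> Ck_log UNIV (nat (\<lfloor>\<alpha> - critical_exponent\<rfloor> - 1)) 1 g) \<and>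
           (\<alpha> - critical_exponent \<le> 1 \<longrightarrow>
              (\<forall>u v. u < v \<longrightarrow>
                 \<not> Ck {u<..<v} 1 0 g \<and>
                 \<not> Ck {u<..<v} 1 0 (\<lambda>y. Re (g y)) \<and>
                 \<not> Ck {u<..<v} 1 0 (\<lambda>y. Im (g y))))"
      using G.uniform_convergence G.continuous_frac_integral G.Ck_frac_integral
        G.Ck_log_frac_integral nowhere_C1[OF assms(4,5)]
      by (intro exI[of _ "S.frac_integral \<alpha>"] conjI impI allI) auto
  qed
qed

end
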